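(* Let $X\subset Q=\mathbb P^1\times\mathbb P^1$ be a reduced ACM zero-dimensional scheme, with $(1,0)$-lines $R_0,\dots,R_a$ and $(0,1)$-lines $C_0,\dots,C_b$ and points $P_{ij}=R_i\cap C_j$ as in the context, and let $$0\to \bigoplus_{i=1}^{m-1}\mathscr O_Q(-a_{2i},-a'_{2i})\to \bigoplus_{i=1}^{m}\mathscr O_Q(-a_{1i},-a'_{1i})\to \mathscr I_X\to 0$$ be the minimal free resolution of $X$. Let $P_{i_1j_1},\dots,P_{i_hj_h}\in X$ be interior points for $X$ such that $i_1,\dots,i_h$ are pairwise distinct and $j_1,\dots,j_h$ are pairwise distinct, and let $Z=X\setminus\{P_{i_1j_1},\dots,P_{i_hj_h}\}$. For $l=1,\dots,h$ let $q_l+1=\#(X\cap C_{j_l})$ and $p_l+1=\#(X\cap R_{i_l})$, and for every $(i,j)$ let $$r_{ij}=\#\{l\in\{1,\dots,h\}\mid (q_l,p_l)=(i,j)\}.$$ Then the minimal free resolution of $Z$ is $$0\to \bigoplus_{l=1}^h\mathscr O_Q(-q_l-1,-p_l-1)\to \bigoplus_{i=1}^{m-1}\mathscr O_Q(-a_{2i},-a'_{2i})\oplus\bigoplus_{l=1}^h\mathscr O_Q(-q_l,-p_l-1)\oplus\bigoplus_{l=1}^h\mathscr O_Q(-q_l-1,-p_l)\to$$ $$\to \bigoplus_{i=1}^m\mathscr O_Q(-a_{1i},-a'_{1i})\oplus\bigoplus_{l=1}^h\mathscr O_Q(-q_l,-p_l)\to\mathscr I_Z\to 0;$$ there exists a minimal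 set of generators of $I_Z$ given by curves that split into unions of $(1,0)$- and $(0,1)$-lines (i.e. each generator is a product of forms of degree $(1,0)$ and $(0,1)$); and $$\Delta M_Z(i,j)=\Delta M_X(i,j)-r_{ij}\quad\text{for every }(i,j).$$ In particular, writing $\Delta M_Z=(c_{ij})$, a pair $(i,j)$ is the degree of: (1) a minimal generator for $Z$ if and only if $(i,j)$ is a corner for $\Delta M_Z$ or $c_{ij}<0$; (2) a first syzygy for $Z$ if and only if $(i,j)$ is a vertex for $\Delta M_Z$, or $c_{i,j-1}<0$, or $c_{i-1,j}<0$; (3) a second syzygy for $Z$ if and only if $c_{i-1,j-1}<0$.
   Context: Let $k$ be an algebraically closed field, $Q=\mathbb P^1_k\times\mathbb P^1_k$, and $S=\bigoplus_{a,b\ge0}H^0\mathscr O_Q(a,b)$, the bigraded ring $k[x_0,x_1,y_0,y_1]$ with $\deg x_i=(1,0)$, $\deg y_i=(0,1)$. A $(1,0)$-line (resp. $(0,1)$-line) is the zero locus of a nonzero form of degree $(1,0)$ (resp. $(0,1)$). For a zero-dimensional scheme $X\subset Q$, $I_X\subset S$ is its saturated bihomogeneous ideal, $\mathscr I_X$ its ideal sheaf, $S(X)=S/I_X$, and $X$ is ACM if $S(X)$ is Cohen–Macaulay (i.e. $\operatorname{depth}S(X)=2$). The Hilbert function of $X$ is $M_X(i,j)=\dim_k S(X)_{i,j}$ (zero if $i<0$ or $j<0$), and its first difference is $\Delta M_X=(c_{ij})$ with $c_{ij}=M_X(i,j)-M_X(i-1,j)-M_X(i,j-1)+M_X(i-1,j-1)$.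 Minimal free resolution of $X$: a resolution of $\mathscr I_X$ by finite direct sums of sheaves $\mathscr O_Q(-a,-a')$ that comes from the minimal bigraded free $S$-resolution of $I_X$ (with $S(-a,-a')$ corresponding to $\mathscr O_Q(-a,-a')$); in particular it stays exact on global sections after every twist. The degrees of the minimal generators, first syzygies and second syzygies are the degrees $(a,a')$ of the shifts in the successive terms. Let $X$ be reduced and ACM. $R_0,\dots,R_a$ and $C_0,\dots,C_b$ are the $(1,0)$- and $(0,1)$-lines, respectively, that contain at least one point of $X$, and $P_{ij}=R_i\cap C_j$. They are ordered so that $X$ has a Ferrers-diagram shape: if $P_{ij}\in X$ and $r\le i$, $s\le j$, then $P_{rs}\in X$ (such an ordering exists since $X$ is reduced ACM). A pair $(r,s)$ with $r,s\ge1$ is a corner for $X$ if $P_{r-1,s},P_{r,s-1}\in X$ but $P_{rs}\notin X$. A point $P_{ij}\in X$ is an interior point for $X$ if there is a corner $(r,s)$ for $X$ with $i<r$ and $j<s$. For a zero-dimensional scheme with first difference $(c_{ij})$: a pair $(i,j)$ is a corner for the first difference if $c_{ij}\le0$ and $c_{i,j-1}=c_{i-1,j}=1$, where for $j=0$ (resp. $i=0$) the condition on $c_{i,j-1}$ (resp. on $c_{i-1,j}$) is omitted (so that $(a+1,0)$ and $(0,b+1)$ count as corners, where $a+1$ and $b+1$ are the least $i$ and $j$ with $(I)_{i,0}\neq0$ and $(I)_{0,j}\ne0$, $I$ being the ideal of the scheme). A pair $(i,j)$ is a vertex if $c_{i-1,j}=c_{i,j-1}\le0$ and $c_{i-1,j-1}=1$.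 *)

theory Defs
  imports
    "HOL-Computational_Algebra.Polynomial"
    "HOL-Library.Poly_Mapping"
    "HOL-Library.Product_Plus"
    "HOL-Library.Extended_Nat"
    "Jordan_Normal_Form.Matrix"
begin

section \<open>The bigraded ring\<close>

text \<open>The exponent vector \<open>(a, b, c, d)\<close> stands for the monomial
  \<open>x\<^sub>0 ^ a * x\<^sub>1 ^ b * y\<^sub>0 ^ c * y\<^sub>1 ^ d\<close>, so \<open>'k bipoly\<close> is \<open>k[x\<^sub>0, x\<^sub>1, y\<^sub>0, y\<^sub>1]\<close>;
  addition and multiplication are those of \<open>Poly_Mapping\<close>.\<close>

type_synonym expo = "nat \<times> nat \<times> nat \<times> nat"
type_synonym 'k bipoly = "expo \<Rightarrow>\<^sub>0 'k"
type_synonym bideg = "int \<times> int"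

fun bidegree :: "expo \<Rightarrow> bideg" where
  "bidegree (a, b, c, d) = (int a + int b, int c + int d)"

text \<open>The graded piece of degree \<open>d\<close>; it contains \<open>0\<close>, and only \<open>0\<close> if a component of
  \<open>d\<close> is negative.\<close>

definition forms :: "bideg \<Rightarrow> 'k::field bipoly set" where
  "forms d = {f. \<forall>e \<in> Poly_Mapping.keys f. bidegree e = d}"

definition scalar :: "'k::field \<Rightarrow> 'k bipoly \<Rightarrow> 'k bipoly" where
  "scalar c f = Poly_Mapping.single 0 c * f"

fun eval_expo :: "expo \<Rightarrow> 'k::field \<times> 'k \<Rightarrow> 'k \<times> 'k \<Rightarrow> 'k" where
  "eval_expo (a, b, c, d) (u0, u1) (v0, v1) = u0 ^ a * u1 ^ b * v0 ^ c * v1 ^ d"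

definition eval_bipoly :: "'k::field bipoly \<Rightarrow> 'k \<times> 'k \<Rightarrow> 'k \<times> 'k \<Rightarrow> 'k" where
  "eval_bipoly f u v =
     (\<Sum>e \<in> Poly_Mapping.keys f. Poly_Mapping.lookup f e * eval_expo e u v)"

definition generated_ideal :: "'k::field bipoly set \<Rightarrow> 'k bipoly set" where
  "generated_ideal G = Modules.module.span (*) G"

definition minimal_generating_set :: "'k::field bipoly set \<Rightarrow> 'k bipoly set \<Rightarrow> bool" where
  "minimal_generating_set G I \<longleftrightarrow>
     finite G \<and> generated_ideal G = I \<and> (\<forall>H. H \<subset> G \<longrightarrow> generated_ideal H \<noteq> I)"


section \<open>Points and lines of the quadric\<close>

definition proportional :: "'k::field \<times> 'k \<Rightarrow> 'k \<times> 'k \<Rightarrow> bool" where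
  "proportional u v \<longleftrightarrow>
     u \<noteq> (0, 0) \<and> v \<noteq> (0, 0) \<and> (\<exists>c. c \<noteq> 0 \<and> v = (c * fst u, c * snd u))"

quotient_type (overloaded) 'k P1 = "'k::field \<times> 'k" / partial: proportional
proof (rule part_equivpI)
  show "\<exists>u :: 'k \<times> 'k. proportional u u"
    by (rule exI[of _ "(1, 0)"]) (auto simp: proportional_def intro: exI[of _ 1])
  show "symp (proportional :: 'k \<times> 'k \<Rightarrow> _)"
  proof (rule sympI)
    fix u v :: "'k \<times> 'k"
    assume "proportional u v"
    then obtain c where "u \<noteq> (0, 0)" "v \<noteq> (0, 0)" "c \<noteq> 0" "v = (c * fst u, c * snd u)"
      unfolding proportional_def by blast
    then show "proportional v u"
      unfolding proportional_def by (auto simp: prod_eq_iff intro!: exI[of _ "inverse c"])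
  qed
  show "transp (proportional :: 'k \<times> 'k \<Rightarrow> _)"
  proof (rule transpI)
    fix u v w :: "'k \<times> 'k"
    assume "proportional u v" "proportional v w"
    then obtain c d where "u \<noteq> (0, 0)" "w \<noteq> (0, 0)" "c \<noteq> 0" "d \<noteq> 0"
      "v = (c * fst u, c * snd u)" "w = (d * fst v, d * snd v)"
      unfolding proportional_def by blast
    then show "proportional u w"
      unfolding proportional_def by (auto simp: mult.assoc intro!: exI[of _ "d * c"])
  qed
qed

text \<open>Over an algebraically closed field a reduced zero-dimensional subscheme of
  \<open>Q = P1 \<times> P1\<close> is a finite nonempty set of closed points.\<close>

type_synonym 'k quadric = "('k P1 \<times> 'k P1) set"

text \<open>\<open>rep_P1\<close> chooses homogeneous coordinates. For forms, the only polynomials to which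
  the following notions are applied, the choice does not matter.\<close>

definition vanishes_at :: "'k::field bipoly \<Rightarrow> 'k P1 \<times> 'k P1 \<Rightarrow> bool" where
  "vanishes_at f p \<longleftrightarrow> eval_bipoly f (rep_P1 (fst p)) (rep_P1 (snd p)) = 0"

definition zero_locus :: "'k::field bipoly \<Rightarrow> 'k quadric" where
  "zero_locus f = {p. vanishes_at f p}"

definition line_of_type :: "bideg \<Rightarrow> 'k::field quadric \<Rightarrow> bool" where
  "line_of_type d L \<longleftrightarrow> (\<exists>f \<in> forms d. f \<noteq> 0 \<and> L = zero_locus f)"

text \<open>The saturated bihomogeneous ideal of a reduced scheme.\<close>

definition ideal_of :: "'k::field quadric \<Rightarrow> 'k bipoly set" where
  "ideal_of X = generated_ideal {f. \<exists>d. f \<in> forms d \<and> (\<forall>p \<in> X. vanishes_at f p)}"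


section \<open>Depth and the Cohen--Macaulay property\<close>

text \<open>Regular sequences on \<open>S / I\<close> in the maximal ideal \<open>(x\<^sub>0, x\<^sub>1, y\<^sub>0, y\<^sub>1)\<close>,
  the set of polynomials without constant term.\<close>

definition regular_sequence :: "'k::field bipoly set \<Rightarrow> 'k bipoly list \<Rightarrow> bool" where
  "regular_sequence I fs \<longleftrightarrow>
     (\<forall>f \<in> set fs. Poly_Mapping.lookup f 0 = 0) \<and>
     (\<forall>n < length fs. \<forall>g.
        fs ! n * g \<in> generated_ideal (I \<union> set (take n fs)) \<longrightarrow>
        g \<in> generated_ideal (I \<union> set (take n fs))) \<and>
     generated_ideal (I \<union> set fs) \<noteq> UNIV"

definition depth_quotient :: "'k::field bipoly set \<Rightarrow> enat" where
  "depth_quotient I = Sup {enat (length fs) |fs. regular_sequence I fs}"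

text \<open>For zero-dimensional \<open>X\<close> the ring \<open>S / I\<^sub>X\<close> has dimension 2.\<close>

definition ACM :: "'k::field quadric \<Rightarrow> bool" where
  "ACM X \<longleftrightarrow> depth_quotient (ideal_of X) = 2"


section \<open>Hilbert functions\<close>

text \<open>\<open>residue_basis I d B\<close>: the residue classes of the (pairwise incongruent) elements of
  \<open>B\<close> form a \<open>k\<close>-basis of the degree \<open>d\<close> piece of \<open>S / I\<close>.\<close>

definition residue_basis :: "'k::field bipoly set \<Rightarrow> bideg \<Rightarrow> 'k bipoly set \<Rightarrow> bool" where
  "residue_basis I d B \<longleftrightarrow> finite B \<and> B \<subseteq> forms d \<and>
     (\<forall>f \<in> forms d. \<exists>!c. (\<forall>b. b \<notin> B \<longrightarrow> c b = 0) \<and> f - (\<Sum>b\<in>B. scalar (c b) b) \<in> I)"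

definition hilbert_function :: "'k::field quadric \<Rightarrow> int \<Rightarrow> int \<Rightarrow> int" where
  "hilbert_function X i j = (THE n. \<exists>B. residue_basis (ideal_of X) (i, j) B \<and> n = int (card B))"

definition first_difference :: "'k::field quadric \<Rightarrow> int \<Rightarrow> int \<Rightarrow> int" where
  "first_difference X i j =
     hilbert_function X i j - hilbert_function X (i - 1) j
     - hilbert_function X i (j - 1) + hilbert_function X (i - 1) (j - 1)"

definition difference_corner :: "(int \<Rightarrow> int \<Rightarrow> int) \<Rightarrow> int \<Rightarrow> int \<Rightarrow> bool" where
  "difference_corner c i j \<longleftrightarrow>
     c i j \<le> 0 \<and> (j = 0 \<or> c i (j - 1) = 1) \<and> (i = 0 \<or> c (i - 1) j = 1)"

definition difference_vertex :: "(int \<Rightarrow> int \<Rightarrow> int) \<Rightarrow> int \<Rightarrow> int \<Rightarrow> bool" where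
  "difference_vertex c i j \<longleftrightarrow>
     c (i - 1) j = c i (j - 1) \<and> c i (j - 1) \<le> 0 \<and> c (i - 1) (j - 1) = 1"


section \<open>Minimal bigraded free resolutions\<close>

text \<open>A list \<open>D\<close> of degrees represents the bigraded free module \<open>\<Oplus>\<^sub>n S(- D ! n)\<close>, whose
  elements are the vectors of length \<open>length D\<close>. A degree-preserving homomorphism from
  \<open>D\<close> to \<open>E\<close> is a matrix of forms; its columns are the images of the basis vectors.\<close>

definition graded_matrix :: "bideg list \<Rightarrow> bideg list \<Rightarrow> 'k::field bipoly mat \<Rightarrow> bool" where
  "graded_matrix D E A \<longleftrightarrow> A \<in> carrier_mat (length E) (length D) \<and>
     (\<forall>i < length E. \<forall>j < length D. A $$ (i, j) \<in> forms (D ! j - E ! i))"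

definition minimal_matrix :: "'k::field bipoly mat \<Rightarrow> bool" where
  "minimal_matrix A \<longleftrightarrow>
     (\<forall>i < dim_row A. \<forall>j < dim_col A. Poly_Mapping.lookup (A $$ (i, j)) 0 = 0)"

text \<open>\<open>minimal_free_resolution I F0 F1 F2\<close>: there is a minimal bigraded free resolution
  \<open>0 \<rightarrow> F2 \<rightarrow> F1 \<rightarrow> F0 \<rightarrow> I \<rightarrow> 0\<close>, where the first map to the right of \<open>F0\<close> sends the
  \<open>n\<close>-th basis vector to the generator \<open>g $ n\<close>. Shorter resolutions are padded with the
  zero module \<open>[]\<close>. Length 2 suffices for the ideals \<open>ideal_of X\<close>, because \<open>S / ideal_of X\<close>
  has depth at least 1 for nonempty \<open>X\<close>.\<close>

definition minimal_free_resolution ::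
  "'k::field bipoly set \<Rightarrow> bideg list \<Rightarrow> bideg list \<Rightarrow> bideg list \<Rightarrow> bool" where
  "minimal_free_resolution I F0 F1 F2 \<longleftrightarrow>
     (\<exists>g A B.
        g \<in> carrier_vec (length F0) \<and> (\<forall>n < length F0. g $ n \<in> forms (F0 ! n)) \<and>
        graded_matrix F1 F0 A \<and> minimal_matrix A \<and>
        graded_matrix F2 F1 B \<and> minimal_matrix B \<and>
        {scalar_prod g v |v. v \<in> carrier_vec (length F0)} = I \<and>
        {v \<in> carrier_vec (length F0). scalar_prod g v = 0} =
          {A *\<^sub>v w |w. w \<in> carrier_vec (length F1)} \<and>
        {w \<in> carrier_vec (length F1). A *\<^sub>v w = 0\<^sub>v (length F0)} =
          {B *\<^sub>v z |z. z \<in> carrier_vec (length F2)} \<and>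
        {z \<in> carrier_vec (length F2). B *\<^sub>v z = 0\<^sub>v (length F1)} = {0\<^sub>v (length F2)})"

definition minimal_generator_degree :: "'k::field quadric \<Rightarrow> bideg \<Rightarrow> bool" where
  "minimal_generator_degree X d \<longleftrightarrow>
     (\<exists>F0 F1 F2. minimal_free_resolution (ideal_of X) F0 F1 F2 \<and> d \<in> set F0)"

definition first_syzygy_degree :: "'k::field quadric \<Rightarrow> bideg \<Rightarrow> bool" where
  "first_syzygy_degree X d \<longleftrightarrow>
     (\<exists>F0 F1 F2. minimal_free_resolution (ideal_of X) F0 F1 F2 \<and> d \<in> set F1)"

definition second_syzygy_degree :: "'k::field quadric \<Rightarrow> bideg \<Rightarrow> bool" where
  "second_syzygy_degree X d \<longleftrightarrow>
     (\<exists>F0 F1 F2. minimal_free_resolution (ideal_of X) F0 F1 F2 \<and> d \<in> set F2)"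


section \<open>The grid of a reduced ACM scheme\<close>

text \<open>\<open>lines_of X d n L\<close>: \<open>L 0, \<dots>, L n\<close> are, without repetition, the lines of type \<open>d\<close>
  that contain a point of \<open>X\<close>.\<close>

definition lines_of :: "'k::field quadric \<Rightarrow> bideg \<Rightarrow> nat \<Rightarrow> (nat \<Rightarrow> 'k quadric) \<Rightarrow> bool" where
  "lines_of X d n L \<longleftrightarrow> bij_betw L {0..n} {M. line_of_type d M \<and> M \<inter> X \<noteq> {}}"

text \<open>In the following \<open>P i j\<close> is the intersection point of \<open>R i\<close> and \<open>C j\<close>. It is
  meaningful only for \<open>i \<le> a\<close> and \<open>j \<le> b\<close>, whence the bounds.\<close>

definition ferrers_shape ::
  "nat \<Rightarrow> nat \<Rightarrow> (nat \<Rightarrow> nat \<Rightarrow> 'k::field P1 \<times> 'k P1) \<Rightarrow> 'k quadric \<Rightarrow> bool" where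
  "ferrers_shape a b P X \<longleftrightarrow>
     (\<forall>i \<le> a. \<forall>j \<le> b. P i j \<in> X \<longrightarrow> (\<forall>r \<le> i. \<forall>s \<le> j. P r s \<in> X))"

definition scheme_corner ::
  "nat \<Rightarrow> nat \<Rightarrow> (nat \<Rightarrow> nat \<Rightarrow> 'k::field P1 \<times> 'k P1) \<Rightarrow> 'k quadric \<Rightarrow> nat \<Rightarrow> nat \<Rightarrow> bool" where
  "scheme_corner a b P X r s \<longleftrightarrow> 1 \<le> r \<and> r \<le> a \<and> 1 \<le> s \<and> s \<le> b \<and>
     P (r - 1) s \<in> X \<and> P r (s - 1) \<in> X \<and> P r s \<notin> X"

definition interior_point ::
  "nat \<Rightarrow> nat \<Rightarrow> (nat \<Rightarrow> nat \<Rightarrow> 'k::field P1 \<times> 'k P1) \<Rightarrow> 'k quadric \<Rightarrow> nat \<Rightarrow> nat \<Rightarrow> bool" where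
  "interior_point a b P X i j \<longleftrightarrow> i \<le> a \<and> j \<le> b \<and> P i j \<in> X \<and>
     (\<exists>r s. scheme_corner a b P X r s \<and> i < r \<and> j < s)"

end

theory Submission
  imports Defs "HOL-Library.Product_Lexorder"
begin

text \<open>Choose coordinates of the lines. A polynomial lies in \<open>I\<^sub>X\<close> iff it vanishes on the cone over every
  point of \<open>X\<close>, and working modulo the linear form of a line amounts to substituting a point of
  that line. Peeling off one row of the Ferrers diagram at a time shows that \<open>I\<^sub>X\<close> is generated by the
  products \<open>R\<^sub>0 \<cdots> R\<^bsub>k-1\<^esub> C\<^sub>0 \<cdots> C\<^bsub>\<lambda>\<^sub>k-1\<^esub>\<close>, where \<open>\<lambda>\<^sub>k\<close> is the length of row \<open>k\<close>, with the obvious relations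
  between consecutive ones. Comparing this resolution, which need not be minimal, with the given
  one yields the degrees in the given one: the outer and inner corners of the diagram.

  For a removed point \<open>P\<close> let \<open>f\<close> be the product of the rows meeting the column of \<open>P\<close> and the columns
  meeting the row of \<open>P\<close>, except the two lines through \<open>P\<close>. It has degree \<open>(q, p)\<close> and separates \<open>P\<close> from the
  rest of \<open>X\<close>. Since the removed points lie in distinct rows and columns, counting zeros on the two
  lines through \<open>P\<close> shows that no separator has smaller degree, so \<open>I\<^sub>Z / I\<^sub>X\<close> is the direct sum of the
  modules \<open>S / (R, C)\<close> generated by the \<open>f\<close>. The mapping cone with their Koszul resolutions is minimal,
  because an interior point puts \<open>(q, p)\<close> outside the diagram and away from the corners. The Hilbert
  function drops by one in each degree in which a removed point has a separator.\<close>

text \<open>Of the given resolution only exactness and minimality are known; its matrices cannot be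
  inspected. The mapping cone is minimal as soon as the maps joining the Koszul part to it have no
  constant entries, and homogeneity turns this into a condition on degrees, because a constant entry
  joins equal degrees. Hence sets of degrees suffice and multiplicities never have to be matched.
  The staircase resolution has a constant entry wherever two consecutive rows have equal length. The
  comparison of resolutions therefore records, besides an equality of degrees, the linear equations
  satisfied by the constant terms of the comparison maps: these exclude the redundant generators and
  relations. A cell of the diagram and a bidegree share their coordinates: a product of row forms
  and column forms has as first degree its number of rows, and as second its number of columns. So
  \<open>q\<close>, counted along a column, is a first degree. Interiority enters as the single
  inequality \<open>lam q \<le> p\<close>, which yields both the disjointness of degrees required by
  the cone and the sign pattern of the first difference.\<close>

section \<open>Substitution homomorphisms\<close>

text \<open>The lexicographic order makes exponent vectors a linearly ordered cancellative monoid,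
  and so \<open>'k bipoly\<close> an integral domain. Every cancellation of a nonzero form below
  relies on this.\<close>

instance prod :: ("{ordered_cancel_comm_monoid_add, linorder}",
    "{ordered_cancel_comm_monoid_add, linorder}") ordered_cancel_comm_monoid_add
  by standard (auto simp: less_eq_prod_def add_strict_left_mono add_left_mono)

fun monomial_at :: "expo \<Rightarrow> 'r::comm_ring_1 \<times> 'r \<Rightarrow> 'r \<times> 'r \<Rightarrow> 'r" where
  "monomial_at (a, b, c, d) (x0, x1) (y0, y1) = x0 ^ a * x1 ^ b * y0 ^ c * y1 ^ d"

text \<open>The coefficient map is a parameter so that evaluation at field elements (identity) and
  substitution of polynomials (\<open>Const\<close>) are instances of one homomorphism.\<close>

definition evaluate ::
  "('k::comm_ring_1 \<Rightarrow> 'r::comm_ring_1) \<Rightarrow> 'r \<times> 'r \<Rightarrow> 'r \<times> 'r \<Rightarrow> 'k bipoly \<Rightarrow> 'r" where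
  "evaluate \<phi> x y f = (\<Sum>e\<in>Poly_Mapping.keys f. \<phi> (Poly_Mapping.lookup f e) * monomial_at e x y)"

lemma monomial_at_0: "monomial_at 0 x y = 1"
  by (cases x; cases y) (simp add: zero_prod_def)

lemma monomial_at_add: "monomial_at (e + e') x y = monomial_at e x y * monomial_at e' x y"
  by (cases e; cases e'; cases x; cases y) (simp add: power_add)

lemma sum_single: "(\<Sum>e\<in>Poly_Mapping.keys f. Poly_Mapping.single e (Poly_Mapping.lookup f e)) = f"
  by (rule poly_mapping_eqI)
    (simp add: lookup_sum lookup_single when_def sum.delta' in_keys_iff)

context comm_ring_hom
begin

lemma evaluate_superset:
  assumes "finite A" "Poly_Mapping.keys f \<subseteq> A"
  shows "evaluate hom x y f = (\<Sum>e\<in>A. hom (Poly_Mapping.lookup f e) * monomial_at e x y)"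
  unfolding evaluate_def
  by (rule sum.mono_neutral_left) (use assms in \<open>auto simp: in_keys_iff\<close>)

end

lemma evaluate_add:
  assumes "comm_ring_hom \<phi>"
  shows "evaluate \<phi> x y (f + g) = evaluate \<phi> x y f + evaluate \<phi> x y g"
proof -
  interpret comm_ring_hom \<phi> by fact
  let ?A = "Poly_Mapping.keys f \<union> Poly_Mapping.keys g"
  show ?thesis
    using keys_add[of f g]
    by (simp add: evaluate_superset[of ?A] lookup_add hom_add algebra_simps sum.distrib)
qed

lemma evaluate_single:
  assumes "comm_ring_hom \<phi>"
  shows "evaluate \<phi> x y (Poly_Mapping.single e c) = \<phi> c * monomial_at e x y"
proof -
  interpret comm_ring_hom \<phi> by fact
  show ?thesis by (simp add: evaluate_superset[of "{e}"])
qed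

lemma evaluate_sum:
  assumes "comm_ring_hom \<phi>"
  shows "evaluate \<phi> x y (\<Sum>i\<in>A. F i) = (\<Sum>i\<in>A. evaluate \<phi> x y (F i))"
  by (induction A rule: infinite_finite_induct)
    (simp_all add: evaluate_add[OF assms], simp_all add: evaluate_def)

lemma comm_ring_hom_evaluate:
  assumes "comm_ring_hom \<phi>"
  shows "comm_ring_hom (evaluate \<phi> x y)"
proof -
  interpret comm_ring_hom \<phi> by fact
  have mult: "evaluate \<phi> x y (f * g) = evaluate \<phi> x y f * evaluate \<phi> x y g" for f g
  proof -
    let ?s = "\<lambda>f e. Poly_Mapping.single e (Poly_Mapping.lookup f e)"
    have "f * g = (\<Sum>e\<in>Poly_Mapping.keys f. ?s f e) * (\<Sum>e'\<in>Poly_Mapping.keys g. ?s g e')"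
      by (simp add: sum_single)
    also have "evaluate \<phi> x y \<dots> =
      (\<Sum>e\<in>Poly_Mapping.keys f. \<Sum>e'\<in>Poly_Mapping.keys g.
        (\<phi> (Poly_Mapping.lookup f e) * monomial_at e x y) *
        (\<phi> (Poly_Mapping.lookup g e') * monomial_at e' x y))"
      by (simp add: sum_product evaluate_sum[OF assms] mult_single evaluate_single[OF assms]
          hom_mult monomial_at_add algebra_simps)
    also have "\<dots> = evaluate \<phi> x y f * evaluate \<phi> x y g"
      by (simp add: sum_product evaluate_def)
    finally show ?thesis .
  qed
  have "evaluate \<phi> x y 1 = 1"
    using evaluate_single[OF assms, of x y 0 1] by (simp add: monomial_at_0)
  then show ?thesis
    by unfold_locales (simp_all add: evaluate_add[OF assms] mult, simp add: evaluate_def)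
qed

abbreviation Const :: "'k::field \<Rightarrow> 'k bipoly" where
  "Const c \<equiv> Poly_Mapping.single 0 c"

interpretation Const: comm_ring_hom Const
  by unfold_locales (simp_all add: single_add mult_single)

lemma comm_ring_hom_ident: "comm_ring_hom (\<lambda>x :: 'k::field. x)"
  by unfold_locales simp_all

definition "X0 = (Poly_Mapping.single (1, 0, 0, 0) 1 :: 'k::field bipoly)"
definition "X1 = (Poly_Mapping.single (0, 1, 0, 0) 1 :: 'k::field bipoly)"
definition "Y0 = (Poly_Mapping.single (0, 0, 1, 0) 1 :: 'k::field bipoly)"
definition "Y1 = (Poly_Mapping.single (0, 0, 0, 1) 1 :: 'k::field bipoly)"

definition subst :: "'k::field bipoly \<times> 'k bipoly \<Rightarrow> 'k bipoly \<times> 'k bipoly \<Rightarrow> 'k bipoly \<Rightarrow> 'k bipoly"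
  where "subst = evaluate Const"

interpretation subst: comm_ring_hom "subst x y" for x y
  unfolding subst_def by (rule comm_ring_hom_evaluate[OF Const.comm_ring_hom_axioms])

lemma monomial_at_eval_expo: "monomial_at e u v = eval_expo e u v"
  by (cases e; cases u; cases v) simp

lemma eval_bipoly_evaluate: "eval_bipoly f u v = evaluate (\<lambda>c. c) u v f"
  by (simp add: eval_bipoly_def evaluate_def monomial_at_eval_expo)

interpretation eval: comm_ring_hom "\<lambda>f. eval_bipoly f u v" for u v
  unfolding eval_bipoly_evaluate by (rule comm_ring_hom_evaluate[OF comm_ring_hom_ident])

lemma eval_vars:
  "eval_bipoly (Const c) u v = c"
  "eval_bipoly X0 u v = fst u" "eval_bipoly X1 u v = snd u"
  "eval_bipoly Y0 u v = fst v" "eval_bipoly Y1 u v = snd v"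
  by (cases u; cases v;
      simp add: eval_bipoly_evaluate X0_def X1_def Y0_def Y1_def monomial_at_0
        evaluate_single[OF comm_ring_hom_ident])+

lemma subst_vars:
  "subst x y (Const c) = Const c"
  "subst x y X0 = fst x" "subst x y X1 = snd x"
  "subst x y Y0 = fst y" "subst x y Y1 = snd y"
  by (cases x; cases y;
      simp add: subst_def X0_def X1_def Y0_def Y1_def monomial_at_0
        evaluate_single[OF Const.comm_ring_hom_axioms])+

lemma single_zero_exponent: "Poly_Mapping.single (0, 0, 0, 0) 1 = (1 :: 'k::field bipoly)"
  using single_one[where ?'a = expo and ?'b = 'k] unfolding zero_prod_def .

lemma X_power:
  "X0 ^ n = Poly_Mapping.single (n, 0, 0, 0) 1" "X1 ^ n = Poly_Mapping.single (0, n, 0, 0) 1"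
  "Y0 ^ n = Poly_Mapping.single (0, 0, n, 0) 1" "Y1 ^ n = Poly_Mapping.single (0, 0, 0, n) 1"
  by (induction n) (simp_all add: X0_def X1_def Y0_def Y1_def mult_single single_zero_exponent)

lemma single_monomial: "Poly_Mapping.single e c = Const c * monomial_at e (X0, X1) (Y0, Y1)"
proof (cases e)
  case (fields a b c' d)
  have "(0::expo) + (a, b, c', d) = e" by (simp add: fields)
  then show ?thesis by (simp add: fields X_power mult_single)
qed

lemma bipoly_expand: "f = (\<Sum>e\<in>Poly_Mapping.keys f. Const (Poly_Mapping.lookup f e) *
    monomial_at e (X0, X1) (Y0, Y1))"
  by (simp flip: single_monomial add: sum_single)

text \<open>A homomorphism fixing the constants moves inside every monomial and acts only on the
  substituted values. With \<open>H\<close> itself a substitution, this is the rule for composing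
  substitutions.\<close>

lemma hom_subst:
  assumes "comm_ring_hom H" "\<And>c. H (Const c) = Const c"
  shows "H (subst x y f) = subst (H (fst x), H (snd x)) (H (fst y), H (snd y)) f"
proof -
  interpret comm_ring_hom H by fact
  have "H (monomial_at e x y) = monomial_at e (H (fst x), H (snd x)) (H (fst y), H (snd y))" for e
    by (cases e; cases x; cases y) (simp add: hom_mult hom_power)
  then show ?thesis
    by (simp add: subst_def evaluate_def hom_sum hom_mult assms(2))
qed

lemma subst_subst:
  "subst x y (subst x' y' f) =
     subst (subst x y (fst x'), subst x y (snd x')) (subst x y (fst y'), subst x y (snd y')) f"
  by (rule hom_subst[OF subst.comm_ring_hom_axioms]) (simp add: subst_vars)

lemma subst_id: "subst (X0, X1) (Y0, Y1) f = f"
  using bipoly_expand[of f] by (simp add: subst_def evaluate_def)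

lemma dvd_diff_mult:
  fixes a :: "'r::comm_ring_1"
  assumes "g dvd a - a'" "g dvd b - b'"
  shows "g dvd a * b - a' * b'"
proof -
  have "a * b - a' * b' = (a - a') * b + a' * (b - b')" by (simp add: algebra_simps)
  then show ?thesis using assms by simp
qed

lemma dvd_diff_power:
  fixes a :: "'r::comm_ring_1"
  assumes "g dvd a - a'"
  shows "g dvd a ^ n - a' ^ n"
  by (induction n) (use assms in \<open>auto intro: dvd_diff_mult\<close>)

text \<open>Congruence modulo \<open>g\<close> respects sums and products. With \<open>g\<close> the
  form of a line, this turns reduction modulo \<open>g\<close> into a substitution.\<close>

lemma subst_cong_dvd:
  assumes "g dvd fst x - fst x'" "g dvd snd x - snd x'" "g dvd fst y - fst y'" "g dvd snd y - snd y'"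
  shows "g dvd subst x y f - subst x' y' f"
proof -
  have "g dvd monomial_at e x y - monomial_at e x' y'" for e
    using assms by (cases e; cases x; cases y; cases x'; cases y')
      (auto intro!: dvd_diff_mult dvd_diff_power)
  then show ?thesis
    by (auto simp: subst_def evaluate_def sum_subtractf[symmetric] right_diff_distrib[symmetric]
        intro!: dvd_sum dvd_mult)
qed

section \<open>Forms and linear forms\<close>

lemma bidegree_add: "bidegree (e + e') = bidegree e + bidegree e'"
  by (cases e; cases e') simp

lemma forms_0: "0 \<in> forms d"
  by (simp add: forms_def)

lemma forms_add: "f \<in> forms d \<Longrightarrow> g \<in> forms d \<Longrightarrow> f + g \<in> forms d"
  using keys_add[of f g] by (auto simp: forms_def)

lemma forms_uminus: "f \<in> forms d \<Longrightarrow> - f \<in> forms d"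
  by (simp add: forms_def in_keys_iff)

lemma forms_diff: "f \<in> forms d \<Longrightarrow> g \<in> forms d \<Longrightarrow> f - g \<in> forms d"
  using forms_add[of f d "- g"] forms_uminus[of g d] by simp

lemma forms_sum: "(\<And>i. i \<in> A \<Longrightarrow> F i \<in> forms d) \<Longrightarrow> (\<Sum>i\<in>A. F i) \<in> forms d"
  by (induction A rule: infinite_finite_induct) (simp_all add: forms_0 forms_add)

lemma forms_mult: "f \<in> forms d \<Longrightarrow> g \<in> forms d' \<Longrightarrow> f * g \<in> forms (d + d')"
  using keys_mult[of f g] by (fastforce simp: forms_def bidegree_add)

lemma forms_single: "bidegree e = d \<Longrightarrow> Poly_Mapping.single e c \<in> forms d"
  by (simp add: forms_def)

lemma forms_Const: "Const c \<in> forms 0"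
  by (rule forms_single) (simp add: zero_prod_def)

lemma forms_one: "1 \<in> forms 0"
  using forms_Const[of 1] by simp

lemma forms_Const_mult: "f \<in> forms d \<Longrightarrow> Const c * f \<in> forms d"
  using forms_mult[OF forms_Const] by fastforce

lemma forms_prod_x: "(\<And>i. i \<in> A \<Longrightarrow> F i \<in> forms (1, 0)) \<Longrightarrow> (\<Prod>i\<in>A. F i) \<in> forms (int (card A), 0)"
proof (induction A rule: infinite_finite_induct)
  case (insert i A)
  have "F i * prod F A \<in> forms ((1, 0) + (int (card A), 0))"
    by (rule forms_mult) (use insert in auto)
  with insert show ?case by simp
qed (use forms_one in \<open>auto simp: zero_prod_def\<close>)

lemma forms_prod_y: "(\<And>i. i \<in> A \<Longrightarrow> F i \<in> forms (0, 1)) \<Longrightarrow> (\<Prod>i\<in>A. F i) \<in> forms (0, int (card A))"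
proof (induction A rule: infinite_finite_induct)
  case (insert i A)
  have "F i * prod F A \<in> forms ((0, 1) + (0, int (card A)))"
    by (rule forms_mult) (use insert in auto)
  with insert show ?case by simp
qed (use forms_one in \<open>auto simp: zero_prod_def\<close>)

lemma forms_power_x: "f \<in> forms (1, 0) \<Longrightarrow> f ^ n \<in> forms (int n, 0)"
  using forms_prod_x[of "{..<n}" "\<lambda>_. f"] by simp

lemma forms_power_y: "f \<in> forms (0, 1) \<Longrightarrow> f ^ n \<in> forms (0, int n)"
  using forms_prod_y[of "{..<n}" "\<lambda>_. f"] by simp

lemma forms_nonneg: "f \<in> forms (s, t) \<Longrightarrow> f \<noteq> 0 \<Longrightarrow> 0 \<le> s \<and> 0 \<le> t"
proof -
  assume f: "f \<in> forms (s, t)" "f \<noteq> 0"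
  then obtain e where "e \<in> Poly_Mapping.keys f"
    by (metis ex_in_conv keys_eq_empty)
  with f have "bidegree e = (s, t)" by (simp add: forms_def)
  then show ?thesis by (cases e) auto
qed

section \<open>Bigraded components\<close>

definition component :: "bideg \<Rightarrow> 'k::field bipoly \<Rightarrow> 'k bipoly" where
  "component d f = (\<Sum>e\<in>{e \<in> Poly_Mapping.keys f. bidegree e = d}.
     Poly_Mapping.single e (Poly_Mapping.lookup f e))"

lemma lookup_component:
  "Poly_Mapping.lookup (component d f) e = (if bidegree e = d then Poly_Mapping.lookup f e else 0)"
  by (auto simp: component_def lookup_sum lookup_single when_def in_keys_iff sum.delta')

lemma component_add: "component d (f + g) = component d f + component d g"
  by (rule poly_mapping_eqI) (simp add: lookup_component lookup_add)

lemma component_0: "component d 0 = 0"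
  by (rule poly_mapping_eqI) (simp add: lookup_component)

lemma component_sum: "component d (\<Sum>i\<in>A. F i) = (\<Sum>i\<in>A. component d (F i))"
  by (induction A rule: infinite_finite_induct) (simp_all add: component_0 component_add)

lemma component_in_forms: "component d f \<in> forms d"
  by (simp add: forms_def) (metis in_keys_iff lookup_component)

lemma component_form: "f \<in> forms d' \<Longrightarrow> component d f = (if d = d' then f else 0)"
  by (rule poly_mapping_eqI) (auto simp: lookup_component forms_def in_keys_iff)

lemma sum_components: "(\<Sum>d\<in>bidegree ` Poly_Mapping.keys f. component d f) = f"
  by (rule poly_mapping_eqI)
    (auto simp: lookup_sum lookup_component sum.delta' in_keys_iff image_iff)

text \<open>Multiplication by a form shifts the grading. This is what allows an arbitrary solution
  of a homogeneous linear system to be replaced by a homogeneous one.\<close>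

lemma component_mult:
  assumes "g \<in> forms d'"
  shows "component d (g * f) = g * component (d - d') f"
proof -
  let ?D = "bidegree ` Poly_Mapping.keys f"
  have "component d (g * f) = component d (g * (\<Sum>d''\<in>?D. component d'' f))"
    by (simp add: sum_components)
  also have "\<dots> = (\<Sum>d''\<in>?D. component d (g * component d'' f))"
    by (simp add: sum_distrib_left component_sum)
  also have "\<dots> = (\<Sum>d''\<in>?D. if d'' = d - d' then g * component d'' f else 0)"
    by (intro sum.cong refl) (auto simp: component_form[OF forms_mult[OF assms component_in_forms]])
  also have "\<dots> = g * component (d - d') f"
  proof (cases "d - d' \<in> ?D")
    case False
    then have "component (d - d') f = 0"
      by (intro poly_mapping_eqI) (metis lookup_component lookup_zero image_eqI in_keys_iff)
    with False show ?thesis by (auto intro: sum.neutral)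
  qed simp
  finally show ?thesis .
qed

text \<open>All monomials except 1 vanish at the origin. Seen as an evaluation, the constant term is
  a ring homomorphism.\<close>

lemma lookup_0_eval: "Poly_Mapping.lookup f 0 = eval_bipoly f (0, 0) (0, 0)"
proof -
  have *: "eval_expo e (0, 0) (0, 0) = (if e = 0 then 1 else 0 :: 'a)" for e
    by (cases e) (auto simp: zero_prod_def)
  show ?thesis
    by (simp add: eval_bipoly_def * in_keys_iff if_distrib[of "\<lambda>x. _ * x"] sum.delta cong: if_cong)
qed

lemma comm_ring_hom_lookup_0: "comm_ring_hom (\<lambda>f :: 'k::field bipoly. Poly_Mapping.lookup f 0)"
  unfolding lookup_0_eval by (rule eval.comm_ring_hom_axioms)

lemma lookup_0_form: "f \<in> forms d \<Longrightarrow> Poly_Mapping.lookup f 0 \<noteq> 0 \<Longrightarrow> d = 0"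
  unfolding forms_def in_keys_iff by (drule CollectD, drule bspec[of _ _ 0]) (simp_all add: in_keys_iff zero_prod_def)

section \<open>Linear forms and restriction to lines and cones\<close>

definition linx :: "'k::field \<times> 'k \<Rightarrow> 'k bipoly" where
  "linx c = Const (fst c) * X0 + Const (snd c) * X1"

definition liny :: "'k::field \<times> 'k \<Rightarrow> 'k bipoly" where
  "liny c = Const (fst c) * Y0 + Const (snd c) * Y1"

text \<open>The 2 by 2 determinant: on nonzero vectors it detects whether they represent the same
  point of the projective line.\<close>

definition cross :: "'k::field \<times> 'k \<Rightarrow> 'k \<times> 'k \<Rightarrow> 'k" where
  "cross u u' = fst u * snd u' - snd u * fst u'"

definition alpha :: "'k::field \<times> 'k \<Rightarrow> 'k bipoly" where
  "alpha u = linx (snd u, - fst u)"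

definition beta :: "'k::field \<times> 'k \<Rightarrow> 'k bipoly" where
  "beta v = liny (snd v, - fst v)"

text \<open>Coefficients of a linear form with value 1 at \<open>u\<close>. A choice is needed
  because either coordinate of \<open>u\<close> may vanish.\<close>

definition dual :: "'k::field \<times> 'k \<Rightarrow> 'k \<times> 'k" where
  "dual u = (SOME c. fst c * fst u + snd c * snd u = 1)"

text \<open>The restriction to the line of \<open>u\<close>, realised as a representative of the
  residue class modulo \<open>alpha u\<close> inside the same ring. Multiplying by a linear form,
  instead of inserting constants, preserves degrees.\<close>

definition on_x :: "'k::field \<times> 'k \<Rightarrow> 'k bipoly \<Rightarrow> 'k bipoly" where
  "on_x u = subst (Const (fst u) * linx (dual u), Const (snd u) * linx (dual u)) (Y0, Y1)"

definition on_y :: "'k::field \<times> 'k \<Rightarrow> 'k bipoly \<Rightarrow> 'k bipoly" where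
  "on_y v = subst (X0, X1) (Const (fst v) * liny (dual v), Const (snd v) * liny (dual v))"

text \<open>The variables \<open>X0\<close> and \<open>Y0\<close> stay as parameters on the cone
  over the point. They keep the two degrees visible, so vanishing is meaningful for inhomogeneous
  polynomials too.\<close>

definition on_cone :: "'k::field \<times> 'k \<Rightarrow> 'k \<times> 'k \<Rightarrow> 'k bipoly \<Rightarrow> 'k bipoly" where
  "on_cone u v = subst (Const (fst u) * X0, Const (snd u) * X0) (Const (fst v) * Y0, Const (snd v) * Y0)"

interpretation on_x: comm_ring_hom "on_x u" for u
  unfolding on_x_def by (rule subst.comm_ring_hom_axioms)

interpretation on_y: comm_ring_hom "on_y v" for v
  unfolding on_y_def by (rule subst.comm_ring_hom_axioms)

interpretation on_cone: comm_ring_hom "on_cone u v" for u v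
  unfolding on_cone_def by (rule subst.comm_ring_hom_axioms)

lemma dual: "u \<noteq> (0, 0) \<Longrightarrow> fst (dual u) * fst u + snd (dual u) * snd u = 1"
  unfolding dual_def
proof (rule someI_ex)
  assume "u \<noteq> (0, 0)"
  then have "fst u \<noteq> 0 \<or> snd u \<noteq> 0" by (simp add: prod_eq_iff)
  then show "\<exists>c. fst c * fst u + snd c * snd u = 1"
  proof
    assume "fst u \<noteq> 0"
    then show ?thesis by (intro exI[of _ "(inverse (fst u), 0)"]) simp
  next
    assume "snd u \<noteq> 0"
    then show ?thesis by (intro exI[of _ "(0, inverse (snd u))"]) simp
  qed
qed

lemma forms_vars: "X0 \<in> forms (1, 0)" "X1 \<in> forms (1, 0)" "Y0 \<in> forms (0, 1)" "Y1 \<in> forms (0, 1)"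
  by (simp_all add: X0_def X1_def Y0_def Y1_def forms_single)

lemma forms_lin: "linx c \<in> forms (1, 0)" "liny c \<in> forms (0, 1)"
  by (simp_all add: linx_def liny_def forms_add forms_Const_mult forms_vars)

lemma forms_alpha: "alpha u \<in> forms (1, 0)"
  by (simp add: alpha_def forms_lin)

lemma forms_beta: "beta v \<in> forms (0, 1)"
  by (simp add: beta_def forms_lin)

lemma eval_linear:
  "eval_bipoly (linx c) u v = fst c * fst u + snd c * snd u"
  "eval_bipoly (liny c) u v = fst c * fst v + snd c * snd v"
  "eval_bipoly (alpha u') u v = cross u u'"
  "eval_bipoly (beta v') u v = cross v v'"
  by (simp_all add: linx_def liny_def alpha_def beta_def cross_def eval.hom_add eval.hom_mult eval_vars)

lemma lin_eq_0_iff: "linx c = 0 \<longleftrightarrow> c = (0, 0)" "liny c = 0 \<longleftrightarrow> c = (0, 0)"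
proof -
  show "linx c = 0 \<longleftrightarrow> c = (0, 0)"
    using eval_linear(1)[of c "(1, 0)" "(0,0)"] eval_linear(1)[of c "(0, 1)" "(0,0)"]
    by (auto simp: prod_eq_iff) (auto simp: linx_def)
  show "liny c = 0 \<longleftrightarrow> c = (0, 0)"
    using eval_linear(2)[of c "(0,0)" "(1, 0)"] eval_linear(2)[of c "(0,0)" "(0, 1)"]
    by (auto simp: prod_eq_iff) (auto simp: liny_def)
qed

lemma alpha_nonzero: "u \<noteq> (0, 0) \<Longrightarrow> alpha u \<noteq> 0"
  by (auto simp: alpha_def lin_eq_0_iff prod_eq_iff)

lemma beta_nonzero: "v \<noteq> (0, 0) \<Longrightarrow> beta v \<noteq> 0"
  by (auto simp: beta_def lin_eq_0_iff prod_eq_iff)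

lemma cross_nonzero: "cross u u' \<noteq> 0 \<Longrightarrow> u \<noteq> (0, 0) \<and> u' \<noteq> (0, 0)"
  by (auto simp: cross_def)

lemma cross_self: "cross u u = 0"
  by (simp add: cross_def)

lemma dual_nonzero: "u \<noteq> (0, 0) \<Longrightarrow> dual u \<noteq> (0, 0)"
  using dual[of u] by (auto simp: prod_eq_iff)

text \<open>Modulo \<open>alpha u\<close> the variables are the multiples \<open>fst u * \<xi>\<close> and \<open>snd u * \<xi>\<close> of any linear
  form \<open>\<xi>\<close> with value \<open>1\<close> at \<open>u\<close>.\<close>

lemma alpha_dvd_diff:
  assumes "u \<noteq> (0, 0)"
  shows "alpha u dvd f - on_x u f"
proof -
  define c where "c = dual u"
  have c: "fst c * fst u + snd c * snd u = 1" using dual[OF assms] by (simp add: c_def)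
  have c': "Const (fst c) * Const (fst u) + Const (snd c) * Const (snd u) = 1"
    using arg_cong[OF c, of Const] by (simp add: single_add mult_single)
  have "X0 - Const (fst u) * linx c = Const (snd c) * alpha u"
    using arg_cong[OF c', of "\<lambda>z. X0 * z"]
    by (simp add: linx_def alpha_def single_uminus algebra_simps)
  moreover have "X1 - Const (snd u) * linx c = - Const (fst c) * alpha u"
    using arg_cong[OF c', of "\<lambda>z. X1 * z"]
    by (simp add: linx_def alpha_def single_uminus algebra_simps)
  ultimately have "alpha u dvd subst (X0, X1) (Y0, Y1) f - on_x u f"
    unfolding on_x_def c_def by (intro subst_cong_dvd) auto
  then show ?thesis by (simp add: subst_id)
qed

lemma beta_dvd_diff:
  assumes "v \<noteq> (0, 0)"
  shows "beta v dvd f - on_y v f"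
proof -
  define c where "c = dual v"
  have c: "fst c * fst v + snd c * snd v = 1" using dual[OF assms] by (simp add: c_def)
  have c': "Const (fst c) * Const (fst v) + Const (snd c) * Const (snd v) = 1"
    using arg_cong[OF c, of Const] by (simp add: single_add mult_single)
  have "Y0 - Const (fst v) * liny c = Const (snd c) * beta v"
    using arg_cong[OF c', of "\<lambda>z. Y0 * z"]
    by (simp add: liny_def beta_def single_uminus algebra_simps)
  moreover have "Y1 - Const (snd v) * liny c = - Const (fst c) * beta v"
    using arg_cong[OF c', of "\<lambda>z. Y1 * z"]
    by (simp add: liny_def beta_def single_uminus algebra_simps)
  ultimately have "beta v dvd subst (X0, X1) (Y0, Y1) f - on_y v f"
    unfolding on_y_def c_def by (intro subst_cong_dvd) auto
  then show ?thesis by (simp add: subst_id)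
qed

lemma on_x_lin:
  "on_x u (linx c) = Const (fst c * fst u + snd c * snd u) * linx (dual u)"
  "on_x u (alpha u') = Const (cross u u') * linx (dual u)"
  "on_x u (liny c) = liny c" "on_x u (beta v) = beta v"
proof -
  show *: "on_x u (linx c) = Const (fst c * fst u + snd c * snd u) * linx (dual u)" for c
    by (simp add: on_x_def linx_def[of c] subst.hom_add subst.hom_mult subst_vars single_add
        algebra_simps flip: mult_single[of 0 _ 0, simplified])
  show "on_x u (alpha u') = Const (cross u u') * linx (dual u)"
    by (simp add: alpha_def * cross_def algebra_simps)
  show *: "on_x u (liny c) = liny c" for c
    by (simp add: on_x_def liny_def subst.hom_add subst.hom_mult subst_vars)
  show "on_x u (beta v) = beta v" by (simp add: beta_def *)
qed

lemma on_y_lin: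
  "on_y v (liny c) = Const (fst c * fst v + snd c * snd v) * liny (dual v)"
  "on_y v (beta v') = Const (cross v v') * liny (dual v)"
  "on_y v (linx c) = linx c" "on_y v (alpha u) = alpha u"
proof -
  show *: "on_y v (liny c) = Const (fst c * fst v + snd c * snd v) * liny (dual v)" for c
    by (simp add: on_y_def liny_def[of c] subst.hom_add subst.hom_mult subst_vars single_add
        algebra_simps flip: mult_single[of 0 _ 0, simplified])
  show "on_y v (beta v') = Const (cross v v') * liny (dual v)"
    by (simp add: beta_def * cross_def algebra_simps)
  show *: "on_y v (linx c) = linx c" for c
    by (simp add: on_y_def linx_def subst.hom_add subst.hom_mult subst_vars)
  show "on_y v (alpha u) = alpha u" by (simp add: alpha_def *)
qed

lemma on_cone_lin:
  "on_cone u v (linx c) = Const (fst c * fst u + snd c * snd u) * X0"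
  "on_cone u v (liny c) = Const (fst c * fst v + snd c * snd v) * Y0"
  "on_cone u v (alpha u') = Const (cross u u') * X0"
  "on_cone u v (beta v') = Const (cross v v') * Y0"
proof -
  show *: "on_cone u v (linx c) = Const (fst c * fst u + snd c * snd u) * X0" for c
    by (simp add: on_cone_def linx_def subst.hom_add subst.hom_mult subst_vars single_add
        algebra_simps flip: mult_single[of 0 _ 0, simplified])
  show **: "on_cone u v (liny c) = Const (fst c * fst v + snd c * snd v) * Y0" for c
    by (simp add: on_cone_def liny_def subst.hom_add subst.hom_mult subst_vars single_add
        algebra_simps flip: mult_single[of 0 _ 0, simplified])
  show "on_cone u v (alpha u') = Const (cross u u') * X0"
    by (simp add: alpha_def * cross_def algebra_simps)
  show "on_cone u v (beta v') = Const (cross v v') * Y0"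
    by (simp add: beta_def ** cross_def algebra_simps)
qed

lemma Const_eq_0_iff: "Const c = 0 \<longleftrightarrow> c = 0"
  by (metis lookup_single_eq lookup_zero single_zero)

text \<open>Restricting to two crossing lines, in either order, factors through the cone over their
  intersection. So vanishing on the cone makes both iterated restrictions zero.\<close>

lemma on_y_on_x:
  "on_y v (on_x u f) = subst (linx (dual u), linx (dual u)) (liny (dual v), liny (dual v)) (on_cone u v f)"
  "on_x u (on_y v f) = subst (linx (dual u), linx (dual u)) (liny (dual v), liny (dual v)) (on_cone u v f)"
proof -
  have Y: "on_y v X0 = X0" "on_y v X1 = X1" "on_y v (Const c) = Const c"
    "on_y v Y0 = Const (fst v) * liny (dual v)" "on_y v Y1 = Const (snd v) * liny (dual v)" for c
    by (simp_all add: on_y_def subst_vars)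
  have X: "on_x u Y0 = Y0" "on_x u Y1 = Y1" "on_x u (Const c) = Const c"
    "on_x u X0 = Const (fst u) * linx (dual u)" "on_x u X1 = Const (snd u) * linx (dual u)" for c
    by (simp_all add: on_x_def subst_vars)
  have *: "subst (linx (dual u), linx (dual u)) (liny (dual v), liny (dual v)) (on_cone u v f) =
    subst (Const (fst u) * linx (dual u), Const (snd u) * linx (dual u))
      (Const (fst v) * liny (dual v), Const (snd v) * liny (dual v)) f"
    by (simp add: on_cone_def subst_subst subst.hom_mult subst_vars)
  show "on_y v (on_x u f) = subst (linx (dual u), linx (dual u)) (liny (dual v), liny (dual v)) (on_cone u v f)"
    unfolding * by (subst on_x_def, subst hom_subst[OF on_y.comm_ring_hom_axioms Y(3)])
      (simp add: on_y.hom_mult Y on_y_lin)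
  show "on_x u (on_y v f) = subst (linx (dual u), linx (dual u)) (liny (dual v), liny (dual v)) (on_cone u v f)"
    unfolding * by (subst on_y_def, subst hom_subst[OF on_x.comm_ring_hom_axioms X(3)])
      (simp add: on_x.hom_mult X on_x_lin)
qed

text \<open>A form becomes its value times one monomial that remembers the degree. In a negative
  degree \<open>f\<close> is zero, so truncation by \<open>nat\<close> does no harm.\<close>

lemma on_cone_form:
  assumes "f \<in> forms (s, t)"
  shows "on_cone u v f = Poly_Mapping.single (nat s, 0, nat t, 0) (eval_bipoly f u v)"
proof -
  have pw: "Const x ^ n = Const (x ^ n)" for x :: 'a and n
    by (induction n) (simp_all add: mult_single)
  have "Const (Poly_Mapping.lookup f e) * monomial_at e (Const (fst u) * X0, Const (snd u) * X0)
      (Const (fst v) * Y0, Const (snd v) * Y0) =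
     Poly_Mapping.single (nat s, 0, nat t, 0) (Poly_Mapping.lookup f e * eval_expo e u v)"
    if "e \<in> Poly_Mapping.keys f" for e
  proof (cases e)
    case (fields a b c d)
    then have st: "s = int a + int b" "t = int c + int d"
      using that assms by (auto simp: forms_def)
    then have "(nat s, 0, nat t, 0) = (0::expo) + (a + b, 0, c + d, 0)"
      by (simp add: nat_add_distrib)
    then show ?thesis
      by (simp add: fields pw X_power mult_single power_mult_distrib split: prod.splits)
        (cases u; cases v; simp add: algebra_simps pw X_power mult_single)
  qed
  then show ?thesis
    by (simp add: on_cone_def subst_def evaluate_def eval_bipoly_def) (induction rule: infinite_finite_induct, simp_all add: single_add)
qed

section \<open>Ideals of points\<close>

lemma module_bipoly: "Modules.module ((*) :: 'k::field bipoly \<Rightarrow> _)"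
  by unfold_locales (simp_all add: algebra_simps)

lemma generated_ideal_base: "f \<in> G \<Longrightarrow> f \<in> generated_ideal G"
  unfolding generated_ideal_def by (rule module.span_base[OF module_bipoly])

lemma generated_ideal_add:
  "f \<in> generated_ideal G \<Longrightarrow> g \<in> generated_ideal G \<Longrightarrow> f + g \<in> generated_ideal G"
  unfolding generated_ideal_def by (rule module.span_add[OF module_bipoly])

lemma generated_ideal_mult: "f \<in> generated_ideal G \<Longrightarrow> c * f \<in> generated_ideal G"
  unfolding generated_ideal_def by (rule module.span_scale[OF module_bipoly])

lemma generated_ideal_sum:
  "(\<And>i. i \<in> A \<Longrightarrow> F i \<in> generated_ideal G) \<Longrightarrow> (\<Sum>i\<in>A. F i) \<in> generated_ideal G"
  unfolding generated_ideal_def by (rule module.span_sum[OF module_bipoly])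

lemma generated_ideal_least:
  assumes "G \<subseteq> I" "0 \<in> I" "\<And>f g. f \<in> I \<Longrightarrow> g \<in> I \<Longrightarrow> f + g \<in> I" "\<And>c f. f \<in> I \<Longrightarrow> c * f \<in> I"
  shows "generated_ideal G \<subseteq> I"
  unfolding generated_ideal_def
  by (rule module.span_minimal[OF module_bipoly assms(1)])
    (use assms in \<open>auto simp: module.subspace_def[OF module_bipoly]\<close>)

abbreviation on_point :: "'k::field P1 \<times> 'k P1 \<Rightarrow> 'k bipoly \<Rightarrow> 'k bipoly" where
  "on_point p \<equiv> on_cone (rep_P1 (fst p)) (rep_P1 (snd p))"

lemma vanishes_at_on_point:
  assumes "f \<in> forms d"
  shows "vanishes_at f p \<longleftrightarrow> on_point p f = 0"
  using assms by (cases d)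
    (auto simp: vanishes_at_def on_cone_form, metis lookup_single_eq lookup_zero)

text \<open>Components of different bidegree restrict to multiples of different monomials and cannot
  cancel.\<close>

lemma on_cone_component_eq_0:
  assumes "on_cone u v f = 0"
  shows "on_cone u v (component d f) = 0"
proof (cases "d \<in> bidegree ` Poly_Mapping.keys f")
  case False
  then have "component d f = 0"
    by (intro poly_mapping_eqI) (metis lookup_component lookup_zero image_eqI in_keys_iff)
  then show ?thesis by simp
next
  case True
  let ?D = "bidegree ` Poly_Mapping.keys f"
  define m :: "bideg \<Rightarrow> expo" where "m = (\<lambda>(s, t). (nat s, 0, nat t, 0))"
  \<comment> \<open>Only degrees that occur in \<open>f\<close> are considered; being nonnegative,
    they are not identified by \<open>nat\<close>.\<close>
  have nonneg: "0 \<le> fst d' \<and> 0 \<le> snd d'" if "d' \<in> ?D" for d' using that by auto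
  then have m_inj: "m d' = m d'' \<longleftrightarrow> d' = d''" if "d' \<in> ?D" "d'' \<in> ?D" for d' d''
    using that nonneg[of d'] nonneg[of d''] by (cases d'; cases d'') (auto simp: m_def)
  have "on_cone u v (component d' f) = Poly_Mapping.single (m d') (eval_bipoly (component d' f) u v)" for d'
    using component_in_forms[of d' f] by (cases d') (simp add: m_def on_cone_form)
  then have "on_cone u v f = (\<Sum>d'\<in>?D. Poly_Mapping.single (m d') (eval_bipoly (component d' f) u v))"
    using arg_cong[OF sum_components[of f], of "on_cone u v"] by (simp add: on_cone.hom_sum)
  then have "0 = Poly_Mapping.lookup (\<Sum>d'\<in>?D. Poly_Mapping.single (m d') (eval_bipoly (component d' f) u v)) (m d)"
    by (simp add: assms)
  also have "\<dots> = (\<Sum>d'\<in>?D. if d' = d then eval_bipoly (component d' f) u v else 0)"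
    unfolding lookup_sum using True by (intro sum.cong refl) (simp add: lookup_single m_inj when_def)
  also have "\<dots> = eval_bipoly (component d f) u v" using True by (simp add: sum.delta)
  finally show ?thesis
    using component_in_forms[of d f] by (cases d) (simp add: on_cone_form)
qed

text \<open>Testing on cones makes the decomposition of \<open>f\<close> into forms unnecessary.\<close>

lemma mem_ideal_of_iff: "f \<in> ideal_of X \<longleftrightarrow> (\<forall>p\<in>X. on_point p f = 0)"
proof
  let ?I = "{f. \<forall>p\<in>X. on_point p f = 0}"
  assume "f \<in> ideal_of X"
  also have "ideal_of X \<subseteq> ?I"
    unfolding ideal_of_def
    by (rule generated_ideal_least)
      (auto simp: vanishes_at_on_point on_cone.hom_add on_cone.hom_mult)
  finally show "\<forall>p\<in>X. on_point p f = 0" by simp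
next
  assume f: "\<forall>p\<in>X. on_point p f = 0"
  have "component d f \<in> ideal_of X" for d
    unfolding ideal_of_def
    by (rule generated_ideal_base)
      (intro CollectI exI[of _ d] conjI ballI component_in_forms,
        simp add: vanishes_at_on_point[OF component_in_forms] on_cone_component_eq_0 f)
  then have "(\<Sum>d\<in>bidegree ` Poly_Mapping.keys f. component d f) \<in> ideal_of X"
    unfolding ideal_of_def by (intro generated_ideal_sum)
  then show "f \<in> ideal_of X" by (simp add: sum_components)
qed

text \<open>This replaces unique factorisation. A zero residue at \<open>j\<close> gives a factor
  \<open>\<gamma> j\<close>; at another index \<open>i\<close> the residue of that factor is
  nonzero, so in a domain the quotient inherits the zero residue and the induction
  continues.\<close>

lemma prod_dvd_by_residues:
  fixes h :: "'k::field bipoly"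
  assumes "finite J" "\<And>j. j \<in> J \<Longrightarrow> comm_ring_hom (\<tau> j)"
    and "\<And>j f. j \<in> J \<Longrightarrow> \<gamma> j dvd f - \<tau> j f"
    and "\<And>i j. i \<in> J \<Longrightarrow> j \<in> J \<Longrightarrow> i \<noteq> j \<Longrightarrow> \<tau> j (\<gamma> i) \<noteq> (0 :: 'k bipoly)"
    and "\<And>j. j \<in> J \<Longrightarrow> \<tau> j h = 0"
  shows "(\<Prod>j\<in>J. \<gamma> j) dvd h"
  using assms
proof (induction J arbitrary: h rule: finite_induct)
  case (insert j J)
  have "\<gamma> j dvd h"
    using insert.prems(2)[of j h] insert.prems(4)[of j] by simp
  then obtain h' where h: "h = \<gamma> j * h'" by (auto elim: dvdE)
  have "(\<Prod>j\<in>J. \<gamma> j) dvd h'"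
  proof (rule insert.IH)
    fix i assume i: "i \<in> J"
    interpret comm_ring_hom "\<tau> i" using insert.prems(1)[of i] i by simp
    have "\<tau> i (\<gamma> j) * \<tau> i h' = 0"
      using insert.prems(4)[of i] i by (simp add: h hom_mult)
    moreover have "\<tau> i (\<gamma> j) \<noteq> 0" using insert.prems(3)[of j i] i insert.hyps by auto
    ultimately show "\<tau> i h' = 0" by simp
  qed (use insert.prems in auto)
  then show ?case using insert.hyps by (simp add: h mult_dvd_mono)
qed simp

lemma linear_residue_nonzero: "cross u u' \<noteq> 0 \<Longrightarrow> on_x u (alpha u') \<noteq> 0"
  "cross v v' \<noteq> 0 \<Longrightarrow> on_y v (beta v') \<noteq> 0"
  using dual_nonzero[of u] dual_nonzero[of v] cross_nonzero[of u u'] cross_nonzero[of v v']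
  by (auto simp: on_x_lin on_y_lin Const_eq_0_iff lin_eq_0_iff)

text \<open>On a line, each point at which \<open>f\<close> vanishes splits off the form of the
  column through it.\<close>

lemma beta_prod_dvd:
  assumes "u \<noteq> (0, 0)" "finite J" "\<And>j. j \<in> J \<Longrightarrow> V j \<noteq> (0, 0)"
    and "\<And>i j. i \<in> J \<Longrightarrow> j \<in> J \<Longrightarrow> i \<noteq> j \<Longrightarrow> cross (V i) (V j) \<noteq> 0"
    and "\<And>j. j \<in> J \<Longrightarrow> on_cone u (V j) f = 0"
  shows "(\<Prod>j\<in>J. beta (V j)) dvd on_x u f"
  by (rule prod_dvd_by_residues[where \<tau> = "\<lambda>j. on_y (V j)"])
    (use assms in \<open>auto simp: on_y_on_x on_y.comm_ring_hom_axioms beta_dvd_diff linear_residue_nonzero\<close>)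

lemma alpha_prod_dvd:
  assumes "v \<noteq> (0, 0)" "finite J" "\<And>j. j \<in> J \<Longrightarrow> U j \<noteq> (0, 0)"
    and "\<And>i j. i \<in> J \<Longrightarrow> j \<in> J \<Longrightarrow> i \<noteq> j \<Longrightarrow> cross (U i) (U j) \<noteq> 0"
    and "\<And>j. j \<in> J \<Longrightarrow> on_cone (U j) v f = 0"
  shows "(\<Prod>j\<in>J. alpha (U j)) dvd on_y v f"
  by (rule prod_dvd_by_residues[where \<tau> = "\<lambda>j. on_x (U j)"])
    (use assms in \<open>auto simp: on_y_on_x on_x.comm_ring_hom_axioms alpha_dvd_diff linear_residue_nonzero\<close>)

lemma on_cone_on_x:
  assumes "u \<noteq> (0, 0)" shows "on_cone u v (on_x u f) = on_cone u v f"
proof -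
  obtain e where "f - on_x u f = alpha u * e" using alpha_dvd_diff[OF assms] by (auto elim: dvdE)
  then have "on_cone u v (f - on_x u f) = 0"
    by (simp add: on_cone.hom_mult on_cone_lin cross_self)
  then show ?thesis by (simp add: on_cone.hom_minus)
qed

lemma on_cone_on_y:
  assumes "v \<noteq> (0, 0)" shows "on_cone u v (on_y v f) = on_cone u v f"
proof -
  obtain e where "f - on_y v f = beta v * e" using beta_dvd_diff[OF assms] by (auto elim: dvdE)
  then have "on_cone u v (f - on_y v f) = 0"
    by (simp add: on_cone.hom_mult on_cone_lin cross_self)
  then show ?thesis by (simp add: on_cone.hom_minus)
qed

lemma Const_power_prod: "(\<Prod>i\<in>A. Const (c i) * z) = Const (\<Prod>i\<in>A. c i) * z ^ card A"
  by (induction A rule: infinite_finite_induct)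
    (simp_all add: mult_single[of 0 _ 0, simplified, symmetric] algebra_simps)

lemma single_eq_mult_single:
  assumes "Poly_Mapping.single e c = Poly_Mapping.single e' (1 :: 'k::field) * g" "c \<noteq> 0"
  shows "\<exists>b. e = e' + (b :: expo)"
proof -
  have "e \<in> Poly_Mapping.keys (Poly_Mapping.single e' 1 * g)"
    unfolding assms(1)[symmetric] using assms(2) by simp
  then have "e \<in> {a + b |a b. a \<in> Poly_Mapping.keys (Poly_Mapping.single e' (1 :: 'k)) \<and> b \<in> Poly_Mapping.keys g}"
    using keys_mult[of "Poly_Mapping.single e' 1" g] by blast
  then show ?thesis by (auto split: if_splits)
qed

text \<open>Restricted to the line of \<open>v\<close>, \<open>f\<close> is divisible by
  \<open>card J\<close> linear forms. On the cone over \<open>(u, v)\<close> this becomes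
  divisibility by \<open>X0 ^ card J\<close> of a nonzero multiple of the monomial with exponents
  \<open>s\<close> and \<open>t\<close>.\<close>

lemma separator_degree_x:
  assumes "f \<in> forms (s, t)" "eval_bipoly f u v \<noteq> 0" "v \<noteq> (0, 0)" "finite J"
    and "\<And>i. i \<in> J \<Longrightarrow> U i \<noteq> (0, 0)"
    and "\<And>i j. i \<in> J \<Longrightarrow> j \<in> J \<Longrightarrow> i \<noteq> j \<Longrightarrow> cross (U i) (U j) \<noteq> 0"
    and "\<And>i. i \<in> J \<Longrightarrow> on_cone (U i) v f = 0"
  shows "int (card J) \<le> s"
proof -
  obtain c where "on_y v f = (\<Prod>j\<in>J. alpha (U j)) * c"
    using alpha_prod_dvd[of v J U f] assms(3-7) by (meson dvdE)
  from arg_cong[OF this, of "on_cone u v"]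
  have "on_cone u v f = (\<Prod>j\<in>J. Const (cross u (U j)) * X0) * on_cone u v c"
    by (simp add: on_cone_on_y assms on_cone.hom_mult on_cone.hom_prod on_cone_lin)
  also have "\<dots> = X0 ^ card J * (Const (\<Prod>j\<in>J. cross u (U j)) * on_cone u v c)" (is "_ = _ * ?c")
    by (simp only: Const_power_prod mult.assoc mult.left_commute)
  finally have eq: "Poly_Mapping.single (nat s, 0, nat t, 0) (eval_bipoly f u v) =
      Poly_Mapping.single (card J, 0, 0, 0) 1 * ?c"
    by (simp add: on_cone_form[OF assms(1)] X_power)
  then have "card J \<le> nat s" using single_eq_mult_single[OF eq assms(2)] by auto
  moreover have "0 \<le> s" using forms_nonneg[OF assms(1)] assms(2) by (cases "f = 0") (simp_all add: eval_bipoly_def)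
  ultimately show ?thesis by linarith
qed

lemma separator_degree_y:
  assumes "f \<in> forms (s, t)" "eval_bipoly f u v \<noteq> 0" "u \<noteq> (0, 0)" "finite J"
    and "\<And>i. i \<in> J \<Longrightarrow> V i \<noteq> (0, 0)"
    and "\<And>i j. i \<in> J \<Longrightarrow> j \<in> J \<Longrightarrow> i \<noteq> j \<Longrightarrow> cross (V i) (V j) \<noteq> 0"
    and "\<And>i. i \<in> J \<Longrightarrow> on_cone u (V i) f = 0"
  shows "int (card J) \<le> t"
proof -
  obtain c where "on_x u f = (\<Prod>j\<in>J. beta (V j)) * c"
    using beta_prod_dvd[of u J V f] assms(3-7) by (meson dvdE)
  from arg_cong[OF this, of "on_cone u v"]
  have "on_cone u v f = (\<Prod>j\<in>J. Const (cross v (V j)) * Y0) * on_cone u v c"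
    by (simp add: on_cone_on_x assms on_cone.hom_mult on_cone.hom_prod on_cone_lin)
  also have "\<dots> = Y0 ^ card J * (Const (\<Prod>j\<in>J. cross v (V j)) * on_cone u v c)" (is "_ = _ * ?c")
    by (simp only: Const_power_prod mult.assoc mult.left_commute)
  finally have eq: "Poly_Mapping.single (nat s, 0, nat t, 0) (eval_bipoly f u v) =
      Poly_Mapping.single (0, 0, card J, 0) 1 * ?c"
    by (simp add: on_cone_form[OF assms(1)] X_power)
  then have "card J \<le> nat t" using single_eq_mult_single[OF eq assms(2)] by auto
  moreover have "0 \<le> t" using forms_nonneg[OF assms(1)] assms(2) by (cases "f = 0") (simp_all add: eval_bipoly_def)
  ultimately show ?thesis by linarith
qed

text \<open>The ideal of the cone over a point is generated by the forms of its two lines: reduce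
  modulo the first, then the remainder has residue zero modulo the second.\<close>

lemma on_cone_eq_0_imp:
  assumes "u \<noteq> (0, 0)" "v \<noteq> (0, 0)" "on_cone u v f = 0"
  shows "\<exists>s t. f = alpha u * s + beta v * t"
proof -
  obtain s where s: "f - on_x u f = alpha u * s"
    using alpha_dvd_diff[OF assms(1)] by (auto elim: dvdE)
  have "on_y v (on_x u f) = 0" by (simp add: on_y_on_x assms(3))
  then obtain t where t: "on_x u f = beta v * t"
    using beta_dvd_diff[OF assms(2), of "on_x u f"] by (auto elim: dvdE)
  have "f = alpha u * s + beta v * t" using s t by (simp add: algebra_simps)
  then show ?thesis by blast
qed

lemma alpha_dvd_mult_beta:
  assumes "u \<noteq> (0, 0)" "v \<noteq> (0, 0)" "alpha u dvd beta v * t"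
  shows "alpha u dvd t"
proof -
  obtain e where "beta v * t = alpha u * e" using assms(3) by (auto elim: dvdE)
  from arg_cong[OF this, of "on_x u"] have "on_x u t = 0"
    by (simp add: on_x.hom_mult on_x_lin cross_self beta_nonzero[OF assms(2)])
  then show ?thesis using alpha_dvd_diff[OF assms(1), of t] by simp
qed

lemma beta_dvd_mult_alpha:
  assumes "u \<noteq> (0, 0)" "v \<noteq> (0, 0)" "beta v dvd alpha u * t"
  shows "beta v dvd t"
proof -
  obtain e where "alpha u * t = beta v * e" using assms(3) by (auto elim: dvdE)
  from arg_cong[OF this, of "on_y v"] have "on_y v t = 0"
    by (simp add: on_y.hom_mult on_y_lin cross_self alpha_nonzero[OF assms(1)])
  then show ?thesis using beta_dvd_diff[OF assms(2), of t] by simp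
qed

text \<open>Exactness of the Koszul complex on the two lines through a point.\<close>

lemma alpha_beta_regular:
  assumes "u \<noteq> (0, 0)" "v \<noteq> (0, 0)" "beta v * t + alpha u * s = 0"
  shows "\<exists>c. t = alpha u * c \<and> s = - (beta v * c)"
proof -
  have "beta v * t = alpha u * (- s)" using assms(3) by (simp add: eq_neg_iff_add_eq_0)
  then have "alpha u dvd beta v * t" by simp
  then obtain c where c: "t = alpha u * c"
    using alpha_dvd_mult_beta[OF assms(1,2)] by (meson dvdE)
  then have "alpha u * (beta v * c + s) = 0" using assms(3) by (simp add: algebra_simps)
  then have "beta v * c + s = 0" using alpha_nonzero[OF assms(1)] by simp
  with c show ?thesis by (auto simp: add_eq_0_iff)
qed

text \<open>Coprimality of column forms and row forms, obtained by stripping one \<open>beta\<close>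
  at a time and, for each, one \<open>alpha\<close> at a time.\<close>

lemma beta_prod_dvd_mult_alpha_prod:
  assumes "finite K" "\<And>i. i \<in> K \<Longrightarrow> U i \<noteq> (0, 0)"
    and "finite J" "\<And>j. j \<in> J \<Longrightarrow> V j \<noteq> (0, 0)"
    and "(\<Prod>j\<in>J. beta (V j)) dvd t * (\<Prod>i\<in>K. alpha (U i))"
  shows "(\<Prod>j\<in>J. beta (V j)) dvd t"
  using assms(3-5)
proof (induction J arbitrary: t rule: finite_induct)
  case (insert j J)
  have Vj: "V j \<noteq> (0, 0)" by (rule insert.prems(1)) simp
  have single: "beta (V j) dvd t" if "beta (V j) dvd t * (\<Prod>i\<in>K. alpha (U i))" for t
    using assms(1,2) that
  proof (induction K arbitrary: t rule: finite_induct)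
    case (insert i K)
    have "beta (V j) dvd alpha (U i) * (t * (\<Prod>i\<in>K. alpha (U i)))"
      using insert.prems(2) insert.hyps by (simp add: mult.left_commute)
    then have "beta (V j) dvd t * (\<Prod>i\<in>K. alpha (U i))"
      by (rule beta_dvd_mult_alpha[OF insert.prems(1)[OF insertI1] Vj])
    then show ?case using insert.IH insert.prems(1) by blast
  qed simp
  have nz: "beta (V j) \<noteq> 0" by (rule beta_nonzero[OF Vj])
  have "beta (V j) * (\<Prod>j\<in>J. beta (V j)) dvd t * (\<Prod>i\<in>K. alpha (U i))"
    using insert.prems(2) by (simp only: prod.insert[OF insert.hyps])
  then have "beta (V j) dvd t * (\<Prod>i\<in>K. alpha (U i))" by (rule dvd_mult_left)
  from single[OF this] obtain t' where t: "t = beta (V j) * t'" by (meson dvdE)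
  have "(\<Prod>j\<in>J. beta (V j)) dvd t' * (\<Prod>i\<in>K. alpha (U i))"
    using insert.prems(2) insert.hyps nz by (simp add: t mult.assoc)
  then have "(\<Prod>j\<in>J. beta (V j)) dvd t'" using insert.IH insert.prems(1) by blast
  then show ?case using insert.hyps by (simp add: t mult_dvd_mono)
qed simp

text \<open>Consecutive products differ by exchanging \<open>\<gamma> k\<close> for
  \<open>\<rho> k\<close>, which gives one relation each. To see that these suffice, note that all
  generators but the last contain the newest \<gamma>, so by coprimality it divides the last
  coefficient; the last relation then removes the last generator.\<close>

lemma staircase_relations:
  fixes \<rho> \<gamma> w :: "nat \<Rightarrow> 'r::idom"
  assumes "\<And>i. i < n \<Longrightarrow> \<gamma> i \<noteq> 0"
    and "\<And>i t. i < n \<Longrightarrow> \<gamma> i dvd t * (\<Prod>i'<Suc i. \<rho> i') \<Longrightarrow> \<gamma> i dvd t"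
    and "(\<Sum>k\<le>n. w k * ((\<Prod>i<k. \<rho> i) * (\<Prod>i=k..<n. \<gamma> i))) = 0"
  shows "\<exists>z. \<forall>k\<le>n. w k = (if k < n then \<rho> k * z k else 0) - (if 0 < k then \<gamma> (k - 1) * z (k - 1) else 0)"
  using assms
proof (induction n arbitrary: w)
  case (Suc n)
  define S where "S = (\<Sum>k\<le>n. w k * ((\<Prod>i<k. \<rho> i) * (\<Prod>i=k..<n. \<gamma> i)))"
  define p where "p = (\<Prod>i<n. \<rho> i)"
  have "(\<Sum>k\<le>n. w k * ((\<Prod>i<k. \<rho> i) * (\<Prod>i=k..<Suc n. \<gamma> i))) = \<gamma> n * S"
    unfolding S_def sum_distrib_left by (intro sum.cong refl) (simp add: algebra_simps)
  then have eq: "\<gamma> n * S + w (Suc n) * (\<rho> n * p) = 0"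
    using Suc.prems(3) by (simp add: p_def algebra_simps)
  then have "w (Suc n) * (\<Prod>i'<Suc n. \<rho> i') = \<gamma> n * (- S)"
    by (simp add: p_def algebra_simps eq_neg_iff_add_eq_0)
  then have "\<gamma> n dvd w (Suc n) * (\<Prod>i'<Suc n. \<rho> i')" by simp
  from Suc.prems(2)[OF lessI this] obtain y where y: "w (Suc n) = \<gamma> n * y" by (meson dvdE)
  have "\<gamma> n * (S + y * (\<rho> n * p)) = 0" using eq by (simp add: y algebra_simps)
  then have S: "S + y * (\<rho> n * p) = 0" using Suc.prems(1)[of n] by simp
  \<comment> \<open>The multiple \<open>y\<close> of the last relation carries the coefficient of
    the last generator over to its predecessor.\<close>
  define w' where "w' = w(n := w n + y * \<rho> n)"
  have "(\<Sum>k\<le>n. w' k * ((\<Prod>i<k. \<rho> i) * (\<Prod>i=k..<n. \<gamma> i))) =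
      (\<Sum>k\<le>n. w k * ((\<Prod>i<k. \<rho> i) * (\<Prod>i=k..<n. \<gamma> i)) + (if k = n then y * \<rho> n * p else 0))"
    by (intro sum.cong refl) (auto simp: w'_def p_def algebra_simps)
  also have "\<dots> = 0" using S by (simp add: sum.distrib S_def algebra_simps)
  finally have sum0: "(\<Sum>k\<le>n. w' k * ((\<Prod>i<k. \<rho> i) * (\<Prod>i=k..<n. \<gamma> i))) = 0" .
  obtain z where z: "\<forall>k\<le>n. w' k = (if k < n then \<rho> k * z k else 0) -
      (if 0 < k then \<gamma> (k - 1) * z (k - 1) else 0)"
    using Suc.IH[OF Suc.prems(1)[OF less_SucI] Suc.prems(2)[OF less_SucI] sum0] by blast
  \<comment> \<open>The new coefficient is \<open>- y\<close> because a relation enters the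
    coefficient of its second generator with a minus sign.\<close>
  have "w k = (if k < Suc n then \<rho> k * (z(n := - y)) k else 0) -
      (if 0 < k then \<gamma> (k - 1) * (z(n := - y)) (k - 1) else 0)" if k: "k \<le> Suc n" for k
  proof -
    consider "k < n" | "k = n" | "k = Suc n" using k by linarith
    then show ?thesis
    proof cases
      case 1
      then have "k - 1 \<noteq> n" by linarith
      with 1 z[rule_format, of k] show ?thesis by (simp add: w'_def)
    next
      case 2
      have "w n + y * \<rho> n = - (if 0 < n then \<gamma> (n - 1) * z (n - 1) else 0)"
        using z[rule_format, of n] by (simp add: w'_def)
      then have "w n = \<rho> n * (- y) - (if 0 < n then \<gamma> (n - 1) * z (n - 1) else 0)"
        by (simp only: eq_diff_eq[symmetric] mult.commute[of y]) simp
      moreover have "0 < n \<Longrightarrow> n - 1 \<noteq> n" by linarith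
      ultimately show ?thesis using 2 by simp
    next
      case 3 then show ?thesis by (simp add: y)
    qed
  qed
  then show ?case by blast
qed simp

section \<open>Comparison of graded resolutions\<close>

text \<open>As a one-row matrix the vector of generators is treated like any other differential,
  with target the single degree 0.\<close>

definition row_mat :: "'a vec \<Rightarrow> 'a mat" where
  "row_mat g = mat 1 (dim_vec g) (\<lambda>(i, j). g $ j)"

lemma row_mat_carrier: "g \<in> carrier_vec n \<Longrightarrow> row_mat g \<in> carrier_mat 1 n"
  by (simp add: row_mat_def)

lemma row_mat_mult: "dim_vec v = dim_vec g \<Longrightarrow> row_mat g *\<^sub>v v = vec 1 (\<lambda>_. scalar_prod g v)"
  by (rule eq_vecI) (auto simp: row_mat_def scalar_prod_def)

lemma mult_mat_unit_vec:
  assumes "(A :: 'a::comm_ring_1 mat) \<in> carrier_mat m n" "j < n"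
  shows "A *\<^sub>v unit_vec n j = col A j"
  by (rule eq_vecI) (use assms in auto)

lemma mult_mat_col_eq_0:
  assumes "A \<in> carrier_mat m n" "M \<in> carrier_mat n l" "A * M = 0\<^sub>m m l" "j < l"
  shows "A *\<^sub>v col M j = 0\<^sub>v m"
  using col_mult2[OF assms(1,2,4)] assms(3,4) by simp

lemma col_in_carrier: "M \<in> carrier_mat n l \<Longrightarrow> col M j \<in> carrier_vec n"
  by (rule carrier_vecI) simp

text \<open>The maps are exposed and minimality is dropped, so that the staircase resolution, which
  may have constant entries, can be compared with a minimal one.\<close>

definition graded_resolution where
  "graded_resolution I F0 F1 F2 g A B \<longleftrightarrow>
     g \<in> carrier_vec (length F0) \<and> (\<forall>n < length F0. g $ n \<in> forms (F0 ! n)) \<and>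
     graded_matrix F1 F0 A \<and> graded_matrix F2 F1 B \<and>
     {scalar_prod g v |v. v \<in> carrier_vec (length F0)} = I \<and>
     {v \<in> carrier_vec (length F0). scalar_prod g v = 0} =
       {A *\<^sub>v w |w. w \<in> carrier_vec (length F1)} \<and>
     {w \<in> carrier_vec (length F1). A *\<^sub>v w = 0\<^sub>v (length F0)} =
       {B *\<^sub>v z |z. z \<in> carrier_vec (length F2)} \<and>
     {z \<in> carrier_vec (length F2). B *\<^sub>v z = 0\<^sub>v (length F1)} = {0\<^sub>v (length F2)}"

lemma minimal_free_resolution_iff:
  "minimal_free_resolution I F0 F1 F2 \<longleftrightarrow>
     (\<exists>g A B. graded_resolution I F0 F1 F2 g A B \<and> minimal_matrix A \<and> minimal_matrix B)"
  unfolding minimal_free_resolution_def graded_resolution_def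
  by (intro ex_cong1) (simp only: conj_ac)

lemma matrix_lift:
  assumes "N \<in> carrier_mat m n" "M \<in> carrier_mat m l"
    and "\<And>j. j < n \<Longrightarrow> \<exists>v\<in>carrier_vec l. M *\<^sub>v v = col N j"
  shows "\<exists>T\<in>carrier_mat l n. M * T = N"
proof -
  obtain V where V: "\<And>j. j < n \<Longrightarrow> V j \<in> carrier_vec l" "\<And>j. j < n \<Longrightarrow> M *\<^sub>v V j = col N j"
    using assms(3) by metis
  define T where "T = mat l n (\<lambda>(i, j). V j $ i)"
  have T: "T \<in> carrier_mat l n" by (simp add: T_def)
  have col: "col T j = V j" if "j < n" for j
    by (rule eq_vecI) (use that V(1)[OF that] in \<open>auto simp: T_def\<close>)
  have "M * T = N"
  proof (rule mat_col_eqI)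
    fix j assume "j < dim_col N"
    then have j: "j < n" using assms(1) by simp
    show "col (M * T) j = col N j"
      using col_mult2[OF assms(2) T j] V(2)[OF j] by (simp add: col[OF j])
  qed (use assms T in auto)
  with T show ?thesis by blast
qed

lemma component_mult_mat_vec:
  assumes "graded_matrix F E M" "v \<in> carrier_vec (length F)" "i < length E"
  shows "(M *\<^sub>v vec (length F) (\<lambda>k. component (d - F ! k) (v $ k))) $ i =
    component (d - E ! i) ((M *\<^sub>v v) $ i)"
proof -
  have M: "M \<in> carrier_mat (length E) (length F)"
    "\<And>k. k < length F \<Longrightarrow> M $$ (i, k) \<in> forms (F ! k - E ! i)"
    using assms by (auto simp: graded_matrix_def)
  have "component (d - E ! i) (M $$ (i, k) * v $ k) = M $$ (i, k) * component (d - F ! k) (v $ k)"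
    if "k < length F" for k
    by (simp add: component_mult[OF M(2)[OF that]])
  then show ?thesis
    using M(1) assms(2,3) by (simp add: scalar_prod_def component_sum row_def)
qed

text \<open>Exactness only provides lifts of the columns without control of degrees. Keeping the
  components of the right degree leaves the product unchanged, since the entries of \<open>M\<close>
  are forms.\<close>

lemma graded_lift:
  assumes "graded_matrix D E N" "graded_matrix F E M"
    and "\<And>j. j < length D \<Longrightarrow> \<exists>v\<in>carrier_vec (length F). M *\<^sub>v v = col N j"
  shows "\<exists>T. graded_matrix D F T \<and> M * T = N"
proof -
  obtain V where V: "\<And>j. j < length D \<Longrightarrow> V j \<in> carrier_vec (length F)"
    "\<And>j. j < length D \<Longrightarrow> M *\<^sub>v V j = col N j"
    using assms(3) by metis
  define W where "W j = vec (length F) (\<lambda>k. component (D ! j - F ! k) (V j $ k))" for j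
  define T where "T = mat (length F) (length D) (\<lambda>(i, j). W j $ i)"
  have T: "T \<in> carrier_mat (length F) (length D)" by (simp add: T_def)
  have M: "M \<in> carrier_mat (length E) (length F)" and N: "N \<in> carrier_mat (length E) (length D)"
    using assms(1,2) by (auto simp: graded_matrix_def)
  have col: "col T j = W j" if "j < length D" for j
    by (rule eq_vecI) (use that in \<open>auto simp: T_def W_def\<close>)
  have MW: "M *\<^sub>v W j = col N j" if j: "j < length D" for j
  proof (rule eq_vecI)
    fix i assume "i < dim_vec (col N j)"
    then have i: "i < length E" using N by simp
    have "N $$ (i, j) \<in> forms (D ! j - E ! i)" using assms(1) i j by (simp add: graded_matrix_def)
    moreover have "(M *\<^sub>v V j) $ i = N $$ (i, j)" using V(2)[OF j] N i j by simp
    ultimately show "(M *\<^sub>v W j) $ i = col N j $ i"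
      unfolding W_def component_mult_mat_vec[OF assms(2) V(1)[OF j] i]
      using N i j by (simp add: component_form)
  qed (use M N in simp)
  have "M * T = N"
  proof (rule mat_col_eqI)
    fix j assume "j < dim_col N"
    then have j: "j < length D" using N by simp
    show "col (M * T) j = col N j"
      using col_mult2[OF M T j] by (simp add: col[OF j] MW[OF j])
  qed (use M N T in auto)
  moreover have "graded_matrix D F T"
    by (auto simp: graded_matrix_def T_def W_def component_in_forms)
  ultimately show ?thesis by blast
qed

lemma graded_matrix_mult:
  assumes "graded_matrix D E A" "graded_matrix E F B"
  shows "graded_matrix D F (B * A)"
proof -
  have A: "A \<in> carrier_mat (length E) (length D)" and B: "B \<in> carrier_mat (length F) (length E)"
    using assms by (auto simp: graded_matrix_def)
  have "B $$ (i, k) * A $$ (k, j) \<in> forms (D ! j - F ! i)"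
    if "i < length F" "j < length D" "k < length E" for i j k
    using forms_mult[of "B $$ (i, k)" "E ! k - F ! i" "A $$ (k, j)" "D ! j - E ! k"] assms that
    by (simp add: graded_matrix_def)
  then show ?thesis
    using A B by (auto simp: graded_matrix_def scalar_prod_def intro!: forms_sum)
qed

lemma graded_row_mat:
  assumes "g \<in> carrier_vec (length F)" "\<forall>n < length F. g $ n \<in> forms (F ! n)"
  shows "graded_matrix F [0] (row_mat g)"
  using assms by (auto simp: graded_matrix_def row_mat_def)

definition chain_map where
  "chain_map F0 F1 F2 g A B F0' F1' F2' g' A' B' S0 S1 S2 \<longleftrightarrow>
     graded_matrix F0 F0' S0 \<and> graded_matrix F1 F1' S1 \<and> graded_matrix F2 F2' S2 \<and>
     row_mat g' * S0 = row_mat g \<and> A' * S1 = S0 * A \<and> B' * S2 = S1 * B"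

context
  fixes I F0 F1 F2 g A B
  assumes res: "graded_resolution I F0 F1 F2 g A B"
begin

lemma resolution_carriers:
  "g \<in> carrier_vec (length F0)" "A \<in> carrier_mat (length F0) (length F1)"
  "B \<in> carrier_mat (length F1) (length F2)" "row_mat g \<in> carrier_mat 1 (length F0)"
  using res by (auto simp: graded_resolution_def graded_matrix_def row_mat_def)

lemma resolution_exact_0:
  assumes "v \<in> carrier_vec (length F0)" "row_mat g *\<^sub>v v = 0\<^sub>v 1"
  shows "\<exists>w\<in>carrier_vec (length F1). A *\<^sub>v w = v"
proof -
  have "scalar_prod g v = 0"
    using arg_cong[OF assms(2), of "\<lambda>v. v $ 0"] assms(1) resolution_carriers(1)
    by (simp add: row_mat_mult)
  then have "v \<in> {v \<in> carrier_vec (length F0). scalar_prod g v = 0}" using assms by simp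
  also have "\<dots> = {A *\<^sub>v w |w. w \<in> carrier_vec (length F1)}"
    using res by (simp add: graded_resolution_def)
  finally show ?thesis by blast
qed

lemma resolution_exact_1:
  assumes "w \<in> carrier_vec (length F1)" "A *\<^sub>v w = 0\<^sub>v (length F0)"
  shows "\<exists>z\<in>carrier_vec (length F2). B *\<^sub>v z = w"
proof -
  have "w \<in> {w \<in> carrier_vec (length F1). A *\<^sub>v w = 0\<^sub>v (length F0)}" using assms by simp
  also have "\<dots> = {B *\<^sub>v z |z. z \<in> carrier_vec (length F2)}"
    using res by (simp add: graded_resolution_def)
  finally show ?thesis by blast
qed

lemma resolution_exact_2:
  assumes "z \<in> carrier_vec (length F2)" "B *\<^sub>v z = 0\<^sub>v (length F1)"
  shows "z = 0\<^sub>v (length F2)"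
proof -
  have "z \<in> {z \<in> carrier_vec (length F2). B *\<^sub>v z = 0\<^sub>v (length F1)}" using assms by simp
  also have "\<dots> = {0\<^sub>v (length F2)}" using res by (simp add: graded_resolution_def)
  finally show ?thesis by simp
qed

lemma resolution_complex_0: "row_mat g * A = 0\<^sub>m 1 (length F1)"
proof (rule eq_matI)
  fix i j assume ij: "i < dim_row (0\<^sub>m 1 (length F1))" "j < dim_col (0\<^sub>m 1 (length F1))"
  have "A *\<^sub>v unit_vec (length F1) j \<in> {A *\<^sub>v w |w. w \<in> carrier_vec (length F1)}" by auto
  also have "\<dots> = {v \<in> carrier_vec (length F0). scalar_prod g v = 0}"
    using res by (simp add: graded_resolution_def)
  finally have "scalar_prod g (col A j) = 0"
    using ij resolution_carriers(2) by (simp add: mult_mat_unit_vec)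
  then show "(row_mat g * A) $$ (i, j) = 0\<^sub>m 1 (length F1) $$ (i, j)"
    using ij resolution_carriers by (simp add: row_mat_def scalar_prod_def)
qed (use resolution_carriers in auto)

lemma resolution_complex_1: "A * B = 0\<^sub>m (length F0) (length F2)"
proof (rule mat_col_eqI)
  fix j assume j: "j < dim_col (0\<^sub>m (length F0) (length F2))"
  have "B *\<^sub>v unit_vec (length F2) j \<in> {B *\<^sub>v w |w. w \<in> carrier_vec (length F2)}" by auto
  also have "\<dots> = {w \<in> carrier_vec (length F1). A *\<^sub>v w = 0\<^sub>v (length F0)}"
    using res by (simp add: graded_resolution_def)
  finally have "A *\<^sub>v col B j = 0\<^sub>v (length F0)"
    using j resolution_carriers(3) by (simp add: mult_mat_unit_vec)
  then show "col (A * B) j = col (0\<^sub>m (length F0) (length F2)) j"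
    using j resolution_carriers col_mult2[OF resolution_carriers(2,3)] by simp
qed (use resolution_carriers in auto)

end

text \<open>The comparison theorem for free resolutions of one ideal: each level lifts because the
  composite with the next differential vanishes.\<close>

lemma exists_chain_map:
  assumes res: "graded_resolution I F0 F1 F2 g A B"
    and res': "graded_resolution I F0' F1' F2' g' A' B'"
  shows "\<exists>S0 S1 S2. chain_map F0' F1' F2' g' A' B' F0 F1 F2 g A B S0 S1 S2"
proof -
  note c = resolution_carriers[OF res]
  have c': "g' \<in> carrier_vec (length F0')" "A' \<in> carrier_mat (length F0') (length F1')"
    "B' \<in> carrier_mat (length F1') (length F2')" "row_mat g' \<in> carrier_mat 1 (length F0')"
    using res' by (auto simp: graded_resolution_def graded_matrix_def row_mat_def)
  have gr: "graded_matrix F0 [0] (row_mat g)" "graded_matrix F1 F0 A" "graded_matrix F2 F1 B"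
    using res by (auto simp: graded_resolution_def intro: graded_row_mat)
  have gr': "graded_matrix F0' [0] (row_mat g')" "graded_matrix F1' F0' A'" "graded_matrix F2' F1' B'"
    using res' by (auto simp: graded_resolution_def intro: graded_row_mat)
  have "\<exists>v\<in>carrier_vec (length F0). row_mat g *\<^sub>v v = col (row_mat g') j" if j: "j < length F0'" for j
  proof -
    have "scalar_prod g' (unit_vec (length F0') j) \<in> I"
      using res' by (auto simp: graded_resolution_def)
    moreover have "I = {scalar_prod g v |v. v \<in> carrier_vec (length F0)}"
      using res by (simp add: graded_resolution_def)
    ultimately obtain v where v: "v \<in> carrier_vec (length F0)" "g' $ j = scalar_prod g v"
      using j c'(1) by auto
    then have "row_mat g *\<^sub>v v = col (row_mat g') j"
      using j c'(1) c(1) v(1) by (intro eq_vecI) (auto simp: row_mat_mult row_mat_def[of g'])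
    with v show ?thesis by blast
  qed
  from graded_lift[OF gr'(1) gr(1) this] obtain S0
    where S0: "graded_matrix F0' F0 S0" "row_mat g * S0 = row_mat g'" by auto
  have S0c: "S0 \<in> carrier_mat (length F0) (length F0')" using S0 by (simp add: graded_matrix_def)
  have gS: "row_mat g * (S0 * A') = 0\<^sub>m 1 (length F1')"
    using assoc_mult_mat[OF c(4) S0c c'(2)] S0(2) resolution_complex_0[OF res'] by simp
  have "\<exists>w\<in>carrier_vec (length F1). A *\<^sub>v w = col (S0 * A') j" if j: "j < length F1'" for j
    by (rule resolution_exact_0[OF res col_in_carrier[OF mult_carrier_mat[OF S0c c'(2)]]
          mult_mat_col_eq_0[OF c(4) mult_carrier_mat[OF S0c c'(2)] gS j]])
  from graded_lift[OF graded_matrix_mult[OF gr'(2) S0(1)] gr(2) this] obtain S1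
    where S1: "graded_matrix F1' F1 S1" "A * S1 = S0 * A'" by auto
  have S1c: "S1 \<in> carrier_mat (length F1) (length F1')" using S1 by (simp add: graded_matrix_def)
  have "A * (S1 * B') = S0 * (A' * B')"
    using assoc_mult_mat[OF c(2) S1c c'(3)] S1(2) assoc_mult_mat[OF S0c c'(2,3)] by simp
  also have "\<dots> = 0\<^sub>m (length F0) (length F2')"
    using resolution_complex_1[OF res'] S0c by simp
  finally have AS: "A * (S1 * B') = 0\<^sub>m (length F0) (length F2')" .
  have "\<exists>w\<in>carrier_vec (length F2). B *\<^sub>v w = col (S1 * B') j" if j: "j < length F2'" for j
    by (rule resolution_exact_1[OF res col_in_carrier[OF mult_carrier_mat[OF S1c c'(3)]]
          mult_mat_col_eq_0[OF c(2) mult_carrier_mat[OF S1c c'(3)] AS j]])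
  from graded_lift[OF graded_matrix_mult[OF gr'(3) S1(1)] gr(3) this] obtain S2
    where S2: "graded_matrix F2' F2 S2" "B * S2 = S1 * B'" by auto
  show ?thesis using S0 S1 S2 unfolding chain_map_def by blast
qed

lemma chain_map_carriers:
  assumes "chain_map F0 F1 F2 g A B F0' F1' F2' g' A' B' S0 S1 S2"
  shows "S0 \<in> carrier_mat (length F0') (length F0)" "S1 \<in> carrier_mat (length F1') (length F1)"
    "S2 \<in> carrier_mat (length F2') (length F2)"
  using assms by (auto simp: chain_map_def graded_matrix_def)

text \<open>A chain endomorphism lifting the identity of the ideal is homotopic to the identity.
  Degrees play no part here; only exactness is used.\<close>

lemma chain_map_homotopy:
  assumes res: "graded_resolution I F0 F1 F2 g A B"
    and T: "T0 \<in> carrier_mat (length F0) (length F0)" "T1 \<in> carrier_mat (length F1) (length F1)"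
      "T2 \<in> carrier_mat (length F2) (length F2)"
    and comm: "row_mat g * T0 = row_mat g" "A * T1 = T0 * A" "B * T2 = T1 * B"
  shows "\<exists>H0\<in>carrier_mat (length F1) (length F0). \<exists>H1\<in>carrier_mat (length F2) (length F1).
    T0 = 1\<^sub>m (length F0) + A * H0 \<and> T1 = 1\<^sub>m (length F1) + (H0 * A + B * H1) \<and>
    T2 = 1\<^sub>m (length F2) + H1 * B"
proof -
  note c = resolution_carriers[OF res]
  let ?n0 = "length F0" and ?n1 = "length F1" and ?n2 = "length F2"
  have C: "T0 - 1\<^sub>m ?n0 \<in> carrier_mat ?n0 ?n0" using T by (intro minus_carrier_mat) simp
  have gT: "row_mat g * (T0 - 1\<^sub>m ?n0) = 0\<^sub>m 1 ?n0"
    using c T by (subst mult_minus_distrib_mat[of _ 1 ?n0]) (auto simp: comm)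
  have "\<exists>w\<in>carrier_vec ?n1. A *\<^sub>v w = col (T0 - 1\<^sub>m ?n0) j" if j: "j < ?n0" for j
    by (rule resolution_exact_0[OF res col_in_carrier[OF C] mult_mat_col_eq_0[OF c(4) C gT j]])
  from matrix_lift[OF C c(2) this] obtain H0
    where H0: "H0 \<in> carrier_mat ?n1 ?n0" "A * H0 = T0 - 1\<^sub>m ?n0" by blast
  have T0: "T0 = 1\<^sub>m ?n0 + A * H0"
    unfolding H0(2) by (rule eq_matI) (use T in auto)
  \<comment> \<open>The defect of \<open>T1\<close> after correction by \<open>H0\<close> is killed
    by \<open>A\<close>, so it lifts through \<open>B\<close>.\<close>
  define D where "D = T1 - 1\<^sub>m ?n1 - H0 * A"
  have D: "D \<in> carrier_mat ?n1 ?n1" using T H0 c by (auto simp: D_def)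
  have "A * D = A * T1 - A - (A * H0) * A"
    unfolding D_def
    using mult_minus_distrib_mat[OF c(2) minus_carrier_mat[OF one_carrier_mat] mult_carrier_mat[OF H0(1) c(2)], of T1]
      mult_minus_distrib_mat[OF c(2) T(2) one_carrier_mat] assoc_mult_mat[OF c(2) H0(1) c(2)]
      right_mult_one_mat[OF c(2)] by presburger
  also have "\<dots> = T0 * A - A - (T0 * A - A)"
    unfolding H0(2) comm minus_mult_distrib_mat[OF T(1) one_carrier_mat c(2)] left_mult_one_mat[OF c(2)] ..
  also have "\<dots> = 0\<^sub>m ?n0 ?n1"
    by (rule eq_matI) (use c T in auto)
  finally have AD: "A * D = 0\<^sub>m ?n0 ?n1" .
  have "\<exists>w\<in>carrier_vec ?n2. B *\<^sub>v w = col D j" if j: "j < ?n1" for j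
    by (rule resolution_exact_1[OF res col_in_carrier[OF D] mult_mat_col_eq_0[OF c(2) D AD j]])
  from matrix_lift[OF D c(3) this] obtain H1
    where H1: "H1 \<in> carrier_mat ?n2 ?n1" "B * H1 = D" by blast
  have T1: "T1 = 1\<^sub>m ?n1 + (H0 * A + B * H1)"
    unfolding H1(2) D_def by (rule eq_matI) (use T H0 c in auto)
  \<comment> \<open>At the last level there is nothing to lift to: the defect is killed by the
    injective \<open>B\<close>, hence zero.\<close>
  define E where "E = T2 - 1\<^sub>m ?n2 - H1 * B"
  have E: "E \<in> carrier_mat ?n2 ?n2" using T H1 c by (auto simp: E_def)
  have "B * E = B * T2 - B - (B * H1) * B"
    unfolding E_def
    using mult_minus_distrib_mat[OF c(3) minus_carrier_mat[OF one_carrier_mat] mult_carrier_mat[OF H1(1) c(3)], of T2]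
      mult_minus_distrib_mat[OF c(3) T(3) one_carrier_mat] assoc_mult_mat[OF c(3) H1(1) c(3)]
      right_mult_one_mat[OF c(3)] by presburger
  also have "\<dots> = T1 * B - B - (T1 * B - B - H0 * (A * B))"
    unfolding H1(2) D_def comm
      minus_mult_distrib_mat[OF minus_carrier_mat[OF one_carrier_mat] mult_carrier_mat[OF H0(1) c(2)] c(3)]
      minus_mult_distrib_mat[OF T(2) one_carrier_mat c(3)] left_mult_one_mat[OF c(3)]
      assoc_mult_mat[OF H0(1) c(2,3)] ..
  also have "\<dots> = 0\<^sub>m ?n1 ?n2"
    by (rule eq_matI) (use c T H0 in \<open>auto simp: resolution_complex_1[OF res]\<close>)
  finally have BE: "B * E = 0\<^sub>m ?n1 ?n2" .
  have E0: "E = 0\<^sub>m ?n2 ?n2"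
  proof (rule mat_col_eqI)
    fix j assume "j < dim_col (0\<^sub>m ?n2 ?n2)"
    then have j: "j < ?n2" by simp
    have "col E j = 0\<^sub>v ?n2"
      by (rule resolution_exact_2[OF res col_in_carrier[OF E] mult_mat_col_eq_0[OF c(3) E BE j]])
    then show "col E j = col (0\<^sub>m ?n2 ?n2) j" using j by simp
  qed (use E in auto)
  have "T2 = 1\<^sub>m ?n2 + (H1 * B + E)"
    unfolding E_def by (rule eq_matI) (use T H1 c in auto)
  then have "T2 = 1\<^sub>m ?n2 + H1 * B"
    using right_add_zero_mat[OF mult_carrier_mat[OF H1(1) c(3)]] by (simp add: E0)
  with T0 T1 H0 H1 show ?thesis by blast
qed

text \<open>Reduction modulo the maximal ideal of the variables; under it the differentials of a
  minimal resolution become zero.\<close>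

definition const_coeff :: "'k::field bipoly \<Rightarrow> 'k" where
  "const_coeff f = Poly_Mapping.lookup f 0"

interpretation const_coeff: comm_ring_hom const_coeff
  unfolding const_coeff_def[abs_def] by (rule comm_ring_hom_lookup_0)

lemma const_coeff_mult_mat:
  assumes "A \<in> carrier_mat m n" "B \<in> carrier_mat n l" "i < m" "j < l"
  shows "const_coeff ((A * B) $$ (i, j)) = (\<Sum>k<n. const_coeff (A $$ (i, k)) * const_coeff (B $$ (k, j)))"
  using assms by (simp add: scalar_prod_def const_coeff.hom_sum const_coeff.hom_mult atLeast0LessThan)

text \<open>A form with nonzero constant term has degree 0. This is the link from surviving entries
  to degrees.\<close>

lemma const_coeff_graded:
  assumes "graded_matrix D E A" "i < length E" "j < length D" "const_coeff (A $$ (i, j)) \<noteq> 0"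
  shows "E ! i = D ! j"
proof -
  have "A $$ (i, j) \<in> forms (D ! j - E ! i)" using assms by (simp add: graded_matrix_def)
  from lookup_0_form[OF this] assms(4) show ?thesis by (simp add: const_coeff_def)
qed

text \<open>The composite of the comparison maps is homotopic to the identity. At an index at which the
  differentials have no constant terms, the constant terms of that composite are those of the
  identity, so a constant entry survives there, and it forces an equality of degrees.\<close>

lemma resolution_degree_comparison:
  assumes res: "graded_resolution I F0 F1 F2 g A B"
    and res': "graded_resolution I F0' F1' F2' g' A' B'"
  shows "\<lbrakk>k < length F0; \<And>j. j < length F1 \<Longrightarrow> const_coeff (A $$ (k, j)) = 0\<rbrakk> \<Longrightarrow>
      \<exists>y. (\<forall>c<length F1'. (\<Sum>r<length F0'. y r * const_coeff (A' $$ (r, c))) = 0) \<and>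
        (\<exists>j<length F0'. y j \<noteq> 0 \<and> F0' ! j = F0 ! k)"
    and "\<lbrakk>k < length F1; \<And>i. i < length F0 \<Longrightarrow> const_coeff (A $$ (i, k)) = 0;
        \<And>j. j < length F2 \<Longrightarrow> const_coeff (B $$ (k, j)) = 0\<rbrakk> \<Longrightarrow>
      \<exists>x. (\<forall>r<length F0'. (\<Sum>c<length F1'. const_coeff (A' $$ (r, c)) * x c) = 0) \<and>
        (\<exists>j<length F1'. x j \<noteq> 0 \<and> F1' ! j = F1 ! k)"
    and "\<lbrakk>k < length F2; \<And>i. i < length F1 \<Longrightarrow> const_coeff (B $$ (i, k)) = 0\<rbrakk> \<Longrightarrow>
      \<exists>j<length F2'. F2' ! j = F2 ! k"
proof -
  let ?n0 = "length F0" and ?n1 = "length F1" and ?n2 = "length F2"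
  let ?m0 = "length F0'" and ?m1 = "length F1'" and ?m2 = "length F2'"
  note c = resolution_carriers[OF res] and c' = resolution_carriers[OF res']
  obtain S0 S1 S2 where S: "chain_map F0 F1 F2 g A B F0' F1' F2' g' A' B' S0 S1 S2"
    using exists_chain_map[OF res' res] by blast
  obtain R0 R1 R2 where R: "chain_map F0' F1' F2' g' A' B' F0 F1 F2 g A B R0 R1 R2"
    using exists_chain_map[OF res res'] by blast
  note Sc = chain_map_carriers[OF S] and Rc = chain_map_carriers[OF R]
  have Sg: "graded_matrix F0 F0' S0" "graded_matrix F1 F1' S1" "graded_matrix F2 F2' S2"
    "row_mat g' * S0 = row_mat g" "A' * S1 = S0 * A" "B' * S2 = S1 * B"
    using S by (auto simp: chain_map_def)
  have Rg: "graded_matrix F0' F0 R0" "graded_matrix F1' F1 R1" "graded_matrix F2' F2 R2"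
    "row_mat g * R0 = row_mat g'" "A * R1 = R0 * A'" "B * R2 = R1 * B'"
    using R by (auto simp: chain_map_def)
  have comm: "row_mat g * (R0 * S0) = row_mat g"
    using assoc_mult_mat[OF c(4) Rc(1) Sc(1)] by (simp add: Sg Rg)
  have comm1: "A * (R1 * S1) = (R0 * S0) * A"
    using assoc_mult_mat[OF c(2) Rc(2) Sc(2)] assoc_mult_mat[OF Rc(1) c'(2) Sc(2)]
      assoc_mult_mat[OF Rc(1) Sc(1) c(2)] by (simp add: Sg Rg)
  have comm2: "B * (R2 * S2) = (R1 * S1) * B"
    using assoc_mult_mat[OF c(3) Rc(3) Sc(3)] assoc_mult_mat[OF Rc(2) c'(3) Sc(3)]
      assoc_mult_mat[OF Rc(2) Sc(2) c(3)] by (simp add: Sg Rg)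
  obtain H0 H1 where H: "H0 \<in> carrier_mat ?n1 ?n0" "H1 \<in> carrier_mat ?n2 ?n1"
    "R0 * S0 = 1\<^sub>m ?n0 + A * H0" "R1 * S1 = 1\<^sub>m ?n1 + (H0 * A + B * H1)"
    "R2 * S2 = 1\<^sub>m ?n2 + H1 * B"
    using chain_map_homotopy[OF res mult_carrier_mat[OF Rc(1) Sc(1)] mult_carrier_mat[OF Rc(2) Sc(2)]
        mult_carrier_mat[OF Rc(3) Sc(3)] comm comm1 comm2] by blast
  {
    assume k: "k < ?n0" and A: "\<And>j. j < ?n1 \<Longrightarrow> const_coeff (A $$ (k, j)) = 0"
    have "(\<Sum>j<?m0. const_coeff (R0 $$ (k, j)) * const_coeff (S0 $$ (j, k))) =
        const_coeff ((R0 * S0) $$ (k, k))"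
      by (rule const_coeff_mult_mat[OF Rc(1) Sc(1) k k, symmetric])
    also have "\<dots> = const_coeff (1\<^sub>m ?n0 $$ (k, k) + (A * H0) $$ (k, k))"
      unfolding H(3) using k c H(1) by simp
    also have "\<dots> = 1"
      using k A by (simp add: const_coeff.hom_add const_coeff_mult_mat[OF c(2) H(1) k k]
          del: index_mult_mat)
    finally obtain j where j: "j < ?m0" "const_coeff (R0 $$ (k, j)) \<noteq> 0"
      by (metis (no_types, lifting) lessThan_iff mult_zero_left sum.neutral zero_neq_one)
    \<comment> \<open>Row \<open>k\<close> of \<open>R0\<close>, reduced, serves as the covector
      \<open>y\<close>. It annihilates the reduced \<open>A'\<close> because
      \<open>R0 * A' = A * R1\<close> and row \<open>k\<close> of \<open>A\<close> has no constant
      terms.\<close>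
    have "(\<Sum>r<?m0. const_coeff (R0 $$ (k, r)) * const_coeff (A' $$ (r, c))) = 0" if "c < ?m1" for c
    proof -
      have "(\<Sum>r<?m0. const_coeff (R0 $$ (k, r)) * const_coeff (A' $$ (r, c))) =
          const_coeff ((A * R1) $$ (k, c))"
        unfolding Rg by (rule const_coeff_mult_mat[OF Rc(1) c'(2) k that, symmetric])
      also have "\<dots> = 0"
        using A by (simp add: const_coeff_mult_mat[OF \<open>A \<in> carrier_mat ?n0 ?n1\<close> Rc(2) k that] del: index_mult_mat)
      finally show ?thesis .
    qed
    then show "\<exists>y. (\<forall>c<?m1. (\<Sum>r<?m0. y r * const_coeff (A' $$ (r, c))) = 0) \<and>
        (\<exists>j<?m0. y j \<noteq> 0 \<and> F0' ! j = F0 ! k)"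
      using j const_coeff_graded[OF Rg(1) k j(1)]
      by (intro exI[of _ "\<lambda>r. const_coeff (R0 $$ (k, r))"]) auto
  next
    assume k: "k < ?n1" and A: "\<And>i. i < ?n0 \<Longrightarrow> const_coeff (A $$ (i, k)) = 0"
      and B: "\<And>j. j < ?n2 \<Longrightarrow> const_coeff (B $$ (k, j)) = 0"
    have "(\<Sum>j<?m1. const_coeff (R1 $$ (k, j)) * const_coeff (S1 $$ (j, k))) =
        const_coeff ((R1 * S1) $$ (k, k))"
      by (rule const_coeff_mult_mat[OF Rc(2) Sc(2) k k, symmetric])
    also have "\<dots> = const_coeff (1\<^sub>m ?n1 $$ (k, k) + ((H0 * A) $$ (k, k) + (B * H1) $$ (k, k)))"
      unfolding H(4) using k c H(1,2) by simp
    also have "\<dots> = 1"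
      using k A B by (simp add: const_coeff.hom_add const_coeff_mult_mat[OF H(1) c(2) k k]
          const_coeff_mult_mat[OF c(3) H(2) k k] del: index_mult_mat)
    finally obtain j where j: "j < ?m1" "const_coeff (S1 $$ (j, k)) \<noteq> 0"
      by (metis (no_types, lifting) lessThan_iff mult_zero_right sum.neutral zero_neq_one)
    \<comment> \<open>Dually, column \<open>k\<close> of \<open>S1\<close>, reduced, serves as
      \<open>x\<close>, using \<open>A' * S1 = S0 * A\<close> and the absence of constant terms in
      column \<open>k\<close> of \<open>A\<close>.\<close>
    have "(\<Sum>s<?m1. const_coeff (A' $$ (r, s)) * const_coeff (S1 $$ (s, k))) = 0" if "r < ?m0" for r
    proof -
      have "(\<Sum>s<?m1. const_coeff (A' $$ (r, s)) * const_coeff (S1 $$ (s, k))) =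
          const_coeff ((S0 * A) $$ (r, k))"
        unfolding Sg(5)[symmetric] by (rule const_coeff_mult_mat[OF c'(2) Sc(2) that k, symmetric])
      also have "\<dots> = 0"
        using A by (simp add: const_coeff_mult_mat[OF Sc(1) c(2) that k] del: index_mult_mat)
      finally show ?thesis .
    qed
    then show "\<exists>x. (\<forall>r<?m0. (\<Sum>c<?m1. const_coeff (A' $$ (r, c)) * x c) = 0) \<and>
        (\<exists>j<?m1. x j \<noteq> 0 \<and> F1' ! j = F1 ! k)"
      using j const_coeff_graded[OF Sg(2) j(1) k]
      by (intro exI[of _ "\<lambda>s. const_coeff (S1 $$ (s, k))"]) auto
  next
    assume k: "k < ?n2" and B: "\<And>i. i < ?n1 \<Longrightarrow> const_coeff (B $$ (i, k)) = 0"
    have "(\<Sum>j<?m2. const_coeff (R2 $$ (k, j)) * const_coeff (S2 $$ (j, k))) =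
        const_coeff ((R2 * S2) $$ (k, k))"
      by (rule const_coeff_mult_mat[OF Rc(3) Sc(3) k k, symmetric])
    also have "\<dots> = const_coeff (1\<^sub>m ?n2 $$ (k, k) + (H1 * B) $$ (k, k))"
      unfolding H(5) using k c H(1,2) by simp
    also have "\<dots> = 1"
      using k B by (simp add: const_coeff.hom_add const_coeff_mult_mat[OF H(2) c(3) k k] del: index_mult_mat)
    finally obtain j where j: "j < ?m2" "const_coeff (S2 $$ (j, k)) \<noteq> 0"
      by (metis (no_types, lifting) lessThan_iff mult_zero_right sum.neutral zero_neq_one)
    then show "\<exists>j<?m2. F2' ! j = F2 ! k"
      using const_coeff_graded[OF Sg(3) j(1) k] by auto
  }
qed

text \<open>The degree predicates quantify over all minimal resolutions; this lemma allows them to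
  be decided on a single one.\<close>

lemma minimal_resolution_degrees:
  assumes "minimal_free_resolution I F0 F1 F2" "minimal_free_resolution I F0' F1' F2'"
  shows "set F0 = set F0'" "set F1 = set F1'" "set F2 = set F2'"
proof -
  have "set F0 \<subseteq> set F0' \<and> set F1 \<subseteq> set F1' \<and> set F2 \<subseteq> set F2'"
    if "minimal_free_resolution I F0 F1 F2" "minimal_free_resolution I F0' F1' F2'"
    for F0 F1 F2 F0' F1' F2'
  proof -
    obtain g A B g' A' B' where res: "graded_resolution I F0 F1 F2 g A B"
      "graded_resolution I F0' F1' F2' g' A' B'" and min: "minimal_matrix A" "minimal_matrix B"
      using \<open>minimal_free_resolution I F0 F1 F2\<close> \<open>minimal_free_resolution I F0' F1' F2'\<close>
      unfolding minimal_free_resolution_iff by blast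
    have A: "const_coeff (A $$ (i, j)) = 0" if "i < length F0" "j < length F1" for i j
      using min(1) that resolution_carriers(2)[OF res(1)]
      by (auto simp: minimal_matrix_def const_coeff_def)
    have B: "const_coeff (B $$ (i, j)) = 0" if "i < length F1" "j < length F2" for i j
      using min(2) that resolution_carriers(3)[OF res(1)]
      by (auto simp: minimal_matrix_def const_coeff_def)
    note cmp = resolution_degree_comparison[OF res]
    show ?thesis
    proof (intro conjI subsetI)
      fix d assume "d \<in> set F0"
      then obtain k where k: "k < length F0" "d = F0 ! k" by (metis in_set_conv_nth)
      from cmp(1)[OF k(1) A[OF k(1)]] show "d \<in> set F0'" unfolding k(2) by (metis nth_mem)
    next
      fix d assume "d \<in> set F1"
      then obtain k where k: "k < length F1" "d = F1 ! k" by (metis in_set_conv_nth)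
      from cmp(2)[OF k(1) A[OF _ k(1)] B[OF k(1)]] show "d \<in> set F1'" unfolding k(2) by (metis nth_mem)
    next
      fix d assume "d \<in> set F2"
      then obtain k where k: "k < length F2" "d = F2 ! k" by (metis in_set_conv_nth)
      from cmp(3)[OF k(1) B[OF _ k(1)]] show "d \<in> set F2'" unfolding k(2) by (metis nth_mem)
    qed
  qed
  from this[OF assms] this[OF assms(2,1)]
  show "set F0 = set F0'" "set F1 = set F1'" "set F2 = set F2'" by auto
qed

section \<open>Mapping cones\<close>

lemma append_vec_exhaust:
  assumes "v \<in> carrier_vec (n + m)"
  obtains x y where "x \<in> carrier_vec n" "y \<in> carrier_vec m" "v = x @\<^sub>v y"
proof -
  have "vec_last v m \<in> carrier_vec m" by (simp add: vec_last_def)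
  then show ?thesis
    using that[OF vec_first_carrier _ vec_first_last_append[OF assms, symmetric]] by blast
qed

lemma zero_append_vec: "0\<^sub>v (n + m) = 0\<^sub>v n @\<^sub>v 0\<^sub>v m"
  by (rule eq_vecI) auto

lemma zero_mat_mult_vec: "v \<in> carrier_vec n \<Longrightarrow> 0\<^sub>m m n *\<^sub>v v = 0\<^sub>v m"
  by (rule eq_vecI) auto

text \<open>\<open>A\<close> resolves the ideal of \<open>g\<close>, while \<open>K\<close> and
  \<open>K2\<close> resolve the module generated by the entries of \<open>f\<close> modulo that
  ideal. \<open>W\<close> and \<open>Z\<close> lift the multiplication by \<open>f\<close> to the
  two complexes, and \<open>colon\<close> says that \<open>K\<close> accounts for every relation
  modulo the ideal. The sign of \<open>W\<close> makes the two contributions to the augmentation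
  cancel.\<close>

lemma cone_exact:
  fixes A :: "'r::comm_ring_1 mat"
  assumes A: "A \<in> carrier_mat n0 n1" and W: "W \<in> carrier_mat n0 k" and K: "K \<in> carrier_mat h k"
    and K2: "K2 \<in> carrier_mat k h'" and Z: "Z \<in> carrier_mat n1 h'"
    and g: "g \<in> carrier_vec n0" and f: "f \<in> carrier_vec h"
    and exact_A: "{v \<in> carrier_vec n0. scalar_prod g v = 0} = {A *\<^sub>v w |w. w \<in> carrier_vec n1}"
    and inj_A: "\<And>w. w \<in> carrier_vec n1 \<Longrightarrow> A *\<^sub>v w = 0\<^sub>v n0 \<Longrightarrow> w = 0\<^sub>v n1"
    and gW: "\<And>u. u \<in> carrier_vec k \<Longrightarrow> scalar_prod g (W *\<^sub>v u) = scalar_prod f (K *\<^sub>v u)"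
    and WK: "\<And>c. c \<in> carrier_vec h' \<Longrightarrow> W *\<^sub>v (K2 *\<^sub>v c) = A *\<^sub>v (Z *\<^sub>v c)"
    and KK: "\<And>c. c \<in> carrier_vec h' \<Longrightarrow> K *\<^sub>v (K2 *\<^sub>v c) = 0\<^sub>v h"
    and exact_K: "\<And>u. u \<in> carrier_vec k \<Longrightarrow> K *\<^sub>v u = 0\<^sub>v h \<Longrightarrow> \<exists>c\<in>carrier_vec h'. u = K2 *\<^sub>v c"
    and inj_K2: "\<And>c. c \<in> carrier_vec h' \<Longrightarrow> K2 *\<^sub>v c = 0\<^sub>v k \<Longrightarrow> c = 0\<^sub>v h'"
    and colon: "\<And>y. y \<in> carrier_vec h \<Longrightarrow> scalar_prod f y \<in> {scalar_prod g v |v. v \<in> carrier_vec n0} \<Longrightarrow>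
      \<exists>u\<in>carrier_vec k. K *\<^sub>v u = y"
  defines "A' \<equiv> four_block_mat A (- W) (0\<^sub>m h n1) K" and "B' \<equiv> Z @\<^sub>r K2"
  shows "{v \<in> carrier_vec (n0 + h). scalar_prod (g @\<^sub>v f) v = 0} =
      {A' *\<^sub>v w |w. w \<in> carrier_vec (n1 + k)}"
    and "{w \<in> carrier_vec (n1 + k). A' *\<^sub>v w = 0\<^sub>v (n0 + h)} = {B' *\<^sub>v z |z. z \<in> carrier_vec h'}"
    and "{z \<in> carrier_vec h'. B' *\<^sub>v z = 0\<^sub>v (n1 + k)} = {0\<^sub>v h'}"
proof -
  have A'_mult: "A' *\<^sub>v (x @\<^sub>v u) = (A *\<^sub>v x - W *\<^sub>v u) @\<^sub>v (K *\<^sub>v u)"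
    if x: "x \<in> carrier_vec n1" and u: "u \<in> carrier_vec k" for x u
  proof -
    have "A' *\<^sub>v (x @\<^sub>v u) = (A *\<^sub>v x + - W *\<^sub>v u) @\<^sub>v (0\<^sub>m h n1 *\<^sub>v x + K *\<^sub>v u)"
      unfolding A'_def by (rule four_block_mat_mult_vec[OF A _ _ K x u]) (use W in auto)
    moreover have "A *\<^sub>v x + - W *\<^sub>v u = A *\<^sub>v x - W *\<^sub>v u"
      using A W x u by (intro eq_vecI) auto
    moreover have "0\<^sub>m h n1 *\<^sub>v x + K *\<^sub>v u = K *\<^sub>v u"
      using K x u by (intro eq_vecI) auto
    ultimately show ?thesis by simp
  qed
  have B'_mult: "B' *\<^sub>v c = (Z *\<^sub>v c) @\<^sub>v (K2 *\<^sub>v c)" if "c \<in> carrier_vec h'" for c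
    unfolding B'_def by (rule mat_mult_append[OF Z K2 that])
  have gA: "scalar_prod g (A *\<^sub>v w) = 0" if "w \<in> carrier_vec n1" for w
    using exact_A that by blast
  show "{v \<in> carrier_vec (n0 + h). scalar_prod (g @\<^sub>v f) v = 0} =
      {A' *\<^sub>v w |w. w \<in> carrier_vec (n1 + k)}" (is "?L = ?R")
  proof (intro equalityI subsetI)
    fix v assume "v \<in> ?L"
    then have v: "v \<in> carrier_vec (n0 + h)" "scalar_prod (g @\<^sub>v f) v = 0" by auto
    obtain x y where xy: "x \<in> carrier_vec n0" "y \<in> carrier_vec h" "v = x @\<^sub>v y"
      using append_vec_exhaust[OF v(1)] by blast
    have eq: "scalar_prod g x + scalar_prod f y = 0"
      using v(2) by (simp add: xy(3) scalar_prod_append[OF g f xy(1,2)])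
    then have "scalar_prod f y = scalar_prod g (- x)"
      using g xy(1) by (simp add: add_eq_0_iff)
    \<comment> \<open>A syzygy of the combined generators puts the \<open>f\<close> part into the
      ideal of \<open>g\<close>, so \<open>colon\<close> writes its coefficients as an image under
      \<open>K\<close>.\<close>
    then obtain u where u: "u \<in> carrier_vec k" "K *\<^sub>v u = y"
      using colon[OF xy(2)] xy(1) by (metis (mono_tags, lifting) mem_Collect_eq uminus_carrier_vec)
    have Wu: "W *\<^sub>v u \<in> carrier_vec n0" using W u by simp
    \<comment> \<open>Adding \<open>W u\<close> trades the \<open>f\<close> part for an equal
      \<open>g\<close> part and leaves a syzygy of \<open>g\<close> alone.\<close>
    have "scalar_prod g (x + W *\<^sub>v u) = 0"
      using eq gW[OF u(1)] scalar_prod_add_distrib[OF g xy(1) Wu] by (simp add: u(2))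
    then have "x + W *\<^sub>v u \<in> {A *\<^sub>v w |w. w \<in> carrier_vec n1}"
      unfolding exact_A[symmetric] using xy(1) Wu by simp
    then obtain z where z: "z \<in> carrier_vec n1" "x + W *\<^sub>v u = A *\<^sub>v z" by blast
    have "A *\<^sub>v z - W *\<^sub>v u = x"
      unfolding z(2)[symmetric] by (rule eq_vecI) (use xy(1) W u(1) in auto)
    then have "v = A' *\<^sub>v (z @\<^sub>v u)" by (simp add: A'_mult[OF z(1) u(1)] u(2) xy(3))
    then show "v \<in> ?R" using z(1) u(1) by blast
  next
    fix v assume "v \<in> ?R"
    then obtain w where w: "w \<in> carrier_vec (n1 + k)" "v = A' *\<^sub>v w" by blast
    obtain x u where xu: "x \<in> carrier_vec n1" "u \<in> carrier_vec k" "w = x @\<^sub>v u"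
      using append_vec_exhaust[OF w(1)] by blast
    have c: "A *\<^sub>v x \<in> carrier_vec n0" "W *\<^sub>v u \<in> carrier_vec n0" "K *\<^sub>v u \<in> carrier_vec h"
      using A W K xu by auto
    have "scalar_prod (g @\<^sub>v f) v = scalar_prod g (A *\<^sub>v x - W *\<^sub>v u) + scalar_prod f (K *\<^sub>v u)"
      unfolding w(2) xu(3) A'_mult[OF xu(1,2)]
      by (rule scalar_prod_append[OF g f _ c(3)]) (use c in simp)
    also have "\<dots> = 0"
      using scalar_prod_minus_distrib[OF g c(1,2)] gA[OF xu(1)] gW[OF xu(2)] by simp
    finally have "scalar_prod (g @\<^sub>v f) v = 0" .
    moreover have "v \<in> carrier_vec (n0 + h)"
      unfolding w(2) xu(3) A'_mult[OF xu(1,2)] using c by (intro append_carrier_vec) auto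
    ultimately show "v \<in> ?L" by simp
  qed
  show "{w \<in> carrier_vec (n1 + k). A' *\<^sub>v w = 0\<^sub>v (n0 + h)} = {B' *\<^sub>v z |z. z \<in> carrier_vec h'}"
    (is "?L = ?R")
  proof (intro equalityI subsetI)
    fix w assume "w \<in> ?L"
    then have w: "w \<in> carrier_vec (n1 + k)" "A' *\<^sub>v w = 0\<^sub>v (n0 + h)" by auto
    obtain x u where xu: "x \<in> carrier_vec n1" "u \<in> carrier_vec k" "w = x @\<^sub>v u"
      using append_vec_exhaust[OF w(1)] by blast
    have c: "A *\<^sub>v x \<in> carrier_vec n0" "W *\<^sub>v u \<in> carrier_vec n0"
      using A W xu by auto
    have "(A *\<^sub>v x - W *\<^sub>v u) @\<^sub>v (K *\<^sub>v u) = 0\<^sub>v n0 @\<^sub>v 0\<^sub>v h"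
      using w(2) by (simp only: xu(3) A'_mult[OF xu(1,2)] zero_append_vec)
    then have eq: "A *\<^sub>v x - W *\<^sub>v u = 0\<^sub>v n0" "K *\<^sub>v u = 0\<^sub>v h"
      using c append_vec_eq[of "A *\<^sub>v x - W *\<^sub>v u" n0 "0\<^sub>v n0"] by auto
    obtain e where e: "e \<in> carrier_vec h'" "u = K2 *\<^sub>v e" using exact_K[OF xu(2) eq(2)] by blast
    have Ze: "Z *\<^sub>v e \<in> carrier_vec n1" using Z e by simp
    have "A *\<^sub>v (x - Z *\<^sub>v e) = 0\<^sub>v n0"
      using mult_minus_distrib_mat_vec[OF A xu(1) Ze] eq(1) WK[OF e(1)] by (simp add: e(2))
    then have *: "x - Z *\<^sub>v e = 0\<^sub>v n1" using xu(1) Ze by (intro inj_A) auto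
    have "x = (x - Z *\<^sub>v e) + Z *\<^sub>v e" by (rule eq_vecI) (use xu(1) Z e(1) in auto)
    then have "x = Z *\<^sub>v e" using Ze unfolding * by simp
    then have "w = B' *\<^sub>v e" by (simp add: xu(3) e(2) B'_mult[OF e(1)])
    then show "w \<in> ?R" using e(1) by blast
  next
    fix w assume "w \<in> ?R"
    then obtain e where e: "e \<in> carrier_vec h'" "w = B' *\<^sub>v e" by blast
    have c: "Z *\<^sub>v e \<in> carrier_vec n1" "K2 *\<^sub>v e \<in> carrier_vec k" using Z K2 e by auto
    have "A' *\<^sub>v w = (A *\<^sub>v (Z *\<^sub>v e) - A *\<^sub>v (Z *\<^sub>v e)) @\<^sub>v 0\<^sub>v h"
      by (simp add: e(2) B'_mult[OF e(1)] A'_mult[OF c] WK[OF e(1)] KK[OF e(1)])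
    also have "\<dots> = 0\<^sub>v (n0 + h)"
      unfolding zero_append_vec minus_cancel_vec[OF mult_mat_vec_carrier[OF A c(1)]] ..
    finally show "w \<in> ?L" using c by (simp add: e(2) B'_mult[OF e(1)])
  qed
  show "{z \<in> carrier_vec h'. B' *\<^sub>v z = 0\<^sub>v (n1 + k)} = {0\<^sub>v h'}"
  proof (intro equalityI subsetI)
    fix z assume "z \<in> {z \<in> carrier_vec h'. B' *\<^sub>v z = 0\<^sub>v (n1 + k)}"
    then have z: "z \<in> carrier_vec h'" "B' *\<^sub>v z = 0\<^sub>v (n1 + k)" by auto
    have "Z *\<^sub>v z \<in> carrier_vec n1" using Z z(1) by simp
    then have "K2 *\<^sub>v z = 0\<^sub>v k"
      using z(2) append_vec_eq[of "Z *\<^sub>v z" n1 "0\<^sub>v n1"] unfolding B'_mult[OF z(1)] zero_append_vec by simp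
    then show "z \<in> {0\<^sub>v h'}" using inj_K2[OF z(1)] by simp
  next
    fix z :: "'r vec" assume "z \<in> {0\<^sub>v h'}"
    then have z: "z = 0\<^sub>v h'" by simp
    have "B' *\<^sub>v z = 0\<^sub>v n1 @\<^sub>v 0\<^sub>v k"
      unfolding z B'_mult[OF zero_carrier_vec] using Z K2
      by (intro arg_cong2[of _ _ _ _ append_vec] eq_vecI) auto
    then show "z \<in> {z \<in> carrier_vec h'. B' *\<^sub>v z = 0\<^sub>v (n1 + k)}"
      by (simp add: z zero_append_vec)
  qed
qed

text \<open>The blocks of the cone not given in advance are the homogeneous lifts \<open>W\<close>
  and \<open>Z\<close>. A constant entry in one of them would need a degree common to source and
  target, which \<open>disjoint\<close> excludes.\<close>

lemma minimal_mapping_cone: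
  assumes res: "minimal_free_resolution I F0 F1 []"
    and K: "graded_matrix D1 D0 K" "minimal_matrix K" and K2: "graded_matrix D2 D1 K2" "minimal_matrix K2"
    and f: "f \<in> carrier_vec (length D0)" "\<forall>n < length D0. f $ n \<in> forms (D0 ! n)"
    and KK: "K * K2 = 0\<^sub>m (length D0) (length D2)"
    and exact_K: "\<And>u. u \<in> carrier_vec (length D1) \<Longrightarrow> K *\<^sub>v u = 0\<^sub>v (length D0) \<Longrightarrow>
      \<exists>c\<in>carrier_vec (length D2). u = K2 *\<^sub>v c"
    and inj_K2: "\<And>c. c \<in> carrier_vec (length D2) \<Longrightarrow> K2 *\<^sub>v c = 0\<^sub>v (length D1) \<Longrightarrow> c = 0\<^sub>v (length D2)"
    and fK: "\<And>j. j < length D1 \<Longrightarrow> scalar_prod f (col K j) \<in> I"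
    and colon: "\<And>y. y \<in> carrier_vec (length D0) \<Longrightarrow> scalar_prod f y \<in> I \<Longrightarrow>
      \<exists>u\<in>carrier_vec (length D1). K *\<^sub>v u = y"
    and J: "J = {a + scalar_prod f y |a y. a \<in> I \<and> y \<in> carrier_vec (length D0)}"
    and disjoint: "set D1 \<inter> set F0 = {}" "set D2 \<inter> set F1 = {}"
  shows "minimal_free_resolution J (F0 @ D0) (F1 @ D1) D2"
proof -
  obtain g A B where res: "graded_resolution I F0 F1 [] g A B" and A_min: "minimal_matrix A"
    using res unfolding minimal_free_resolution_iff by blast
  let ?n0 = "length F0" and ?n1 = "length F1" and ?k0 = "length D0" and ?k1 = "length D1" and ?k2 = "length D2"
  note c = resolution_carriers[OF res]
  have Kc: "K \<in> carrier_mat ?k0 ?k1" and K2c: "K2 \<in> carrier_mat ?k1 ?k2"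
    using K K2 by (auto simp: graded_matrix_def)
  have gr: "graded_matrix F0 [0] (row_mat g)" "graded_matrix F1 F0 A"
    using res by (auto simp: graded_resolution_def intro: graded_row_mat)
  have I: "I = {scalar_prod g v |v. v \<in> carrier_vec ?n0}" using res by (simp add: graded_resolution_def)
  have fc: "row_mat f \<in> carrier_mat 1 ?k0" by (rule row_mat_carrier[OF f(1)])
  have fK_gr: "graded_matrix D1 [0] (row_mat f * K)"
    by (rule graded_matrix_mult[OF K(1) graded_row_mat[OF f]])
  have "\<exists>v\<in>carrier_vec ?n0. row_mat g *\<^sub>v v = col (row_mat f * K) j" if j: "j < ?k1" for j
  proof -
    obtain v where v: "v \<in> carrier_vec ?n0" "scalar_prod f (col K j) = scalar_prod g v"
      using fK[OF j] unfolding I by blast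
    have "col (row_mat f * K) j = vec 1 (\<lambda>_. scalar_prod f (col K j))"
      unfolding col_mult2[OF fc Kc j] using f(1) Kc by (intro row_mat_mult) simp
    also have "\<dots> = row_mat g *\<^sub>v v"
      unfolding v(2) using v(1) c(1) by (intro row_mat_mult[symmetric]) simp
    finally show ?thesis using v(1) by metis
  qed
  from graded_lift[OF fK_gr gr(1) this] obtain W
    where W: "graded_matrix D1 F0 W" "row_mat g * W = row_mat f * K" by blast
  have Wc: "W \<in> carrier_mat ?n0 ?k1" using W(1) by (simp add: graded_matrix_def)
  have "row_mat g * (W * K2) = (row_mat f * K) * K2"
    using assoc_mult_mat[OF c(4) Wc K2c] by (simp add: W(2))
  also have "\<dots> = 0\<^sub>m 1 ?k2" using assoc_mult_mat[OF fc Kc K2c] fc by (simp add: KK)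
  finally have gWK: "row_mat g * (W * K2) = 0\<^sub>m 1 ?k2" .
  have "\<exists>w\<in>carrier_vec ?n1. A *\<^sub>v w = col (W * K2) j" if j: "j < ?k2" for j
    by (rule resolution_exact_0[OF res col_in_carrier[OF mult_carrier_mat[OF Wc K2c]]
          mult_mat_col_eq_0[OF c(4) mult_carrier_mat[OF Wc K2c] gWK j]])
  from graded_lift[OF graded_matrix_mult[OF K2(1) W(1)] gr(2) this] obtain Z
    where Z: "graded_matrix D2 F1 Z" "A * Z = W * K2" by blast
  have Zc: "Z \<in> carrier_mat ?n1 ?k2" using Z(1) by (simp add: graded_matrix_def)
  have exact_A: "{v \<in> carrier_vec ?n0. scalar_prod g v = 0} = {A *\<^sub>v w |w. w \<in> carrier_vec ?n1}"
    using res by (simp add: graded_resolution_def)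
  \<comment> \<open>The module after \<open>F1\<close> is zero, so \<open>B\<close> has no columns
    and the kernel of \<open>A\<close> is trivial.\<close>
  have inj_A: "w = 0\<^sub>v ?n1" if w: "w \<in> carrier_vec ?n1" "A *\<^sub>v w = 0\<^sub>v ?n0" for w
  proof -
    obtain z where "z \<in> carrier_vec 0" "B *\<^sub>v z = w" using resolution_exact_1[OF res w] by auto
    then show ?thesis using c(3) by (intro eq_vecI) (auto simp: scalar_prod_def)
  qed
  have gW: "scalar_prod g (W *\<^sub>v u) = scalar_prod f (K *\<^sub>v u)" if u: "u \<in> carrier_vec ?k1" for u
  proof -
    have "vec 1 (\<lambda>_. scalar_prod g (W *\<^sub>v u)) = row_mat g *\<^sub>v (W *\<^sub>v u)"
      using c(1) Wc by (intro row_mat_mult[symmetric]) simp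
    also have "\<dots> = row_mat f *\<^sub>v (K *\<^sub>v u)"
      using assoc_mult_mat_vec[OF c(4) Wc u] assoc_mult_mat_vec[OF fc Kc u] by (simp add: W(2))
    also have "\<dots> = vec 1 (\<lambda>_. scalar_prod f (K *\<^sub>v u))"
      using f(1) Kc by (intro row_mat_mult) simp
    finally have eq: "vec 1 (\<lambda>_. scalar_prod g (W *\<^sub>v u)) = vec 1 (\<lambda>_. scalar_prod f (K *\<^sub>v u))" .
    show ?thesis using arg_cong[OF eq, of "\<lambda>v. v $ 0"] by simp
  qed
  have WK: "W *\<^sub>v (K2 *\<^sub>v e) = A *\<^sub>v (Z *\<^sub>v e)" if "e \<in> carrier_vec ?k2" for e
    using assoc_mult_mat_vec[OF Wc K2c that] assoc_mult_mat_vec[OF c(2) Zc that] by (simp add: Z(2))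
  have KKv: "K *\<^sub>v (K2 *\<^sub>v e) = 0\<^sub>v ?k0" if "e \<in> carrier_vec ?k2" for e
    using assoc_mult_mat_vec[OF Kc K2c that, symmetric] zero_mat_mult_vec[OF that] by (simp add: KK)
  define A' where "A' = four_block_mat A (- W) (0\<^sub>m ?k0 ?n1) K"
  define B' where "B' = Z @\<^sub>r K2"
  have exact: "{v \<in> carrier_vec (?n0 + ?k0). scalar_prod (g @\<^sub>v f) v = 0} =
      {A' *\<^sub>v w |w. w \<in> carrier_vec (?n1 + ?k1)}"
    "{w \<in> carrier_vec (?n1 + ?k1). A' *\<^sub>v w = 0\<^sub>v (?n0 + ?k0)} = {B' *\<^sub>v z |z. z \<in> carrier_vec ?k2}"
    "{z \<in> carrier_vec ?k2. B' *\<^sub>v z = 0\<^sub>v (?n1 + ?k1)} = {0\<^sub>v ?k2}"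
    unfolding A'_def B'_def
    by (rule cone_exact[OF c(2) Wc Kc K2c Zc c(1) f(1) exact_A inj_A gW WK KKv exact_K inj_K2 colon[unfolded I]];
        assumption)+
  have W_const: "Poly_Mapping.lookup (W $$ (i, j)) 0 = 0" if "i < ?n0" "j < ?k1" for i j
    using const_coeff_graded[OF W(1) that] disjoint(1) nth_mem[OF that(1)] nth_mem[OF that(2)]
    by (auto simp: const_coeff_def)
  have Z_const: "Poly_Mapping.lookup (Z $$ (i, j)) 0 = 0" if "i < ?n1" "j < ?k2" for i j
    using const_coeff_graded[OF Z(1) that] disjoint(2) nth_mem[OF that(1)] nth_mem[OF that(2)]
    by (auto simp: const_coeff_def)
  have A'_entry: "A' $$ (i, j) = (if i < ?n0 then if j < ?n1 then A $$ (i, j) else - (W $$ (i, j - ?n1))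
      else if j < ?n1 then 0 else K $$ (i - ?n0, j - ?n1))" if "i < ?n0 + ?k0" "j < ?n1 + ?k1" for i j
    using that c(2) Wc Kc by (auto simp: A'_def)
  have B'_entry: "B' $$ (i, j) = (if i < ?n1 then Z $$ (i, j) else K2 $$ (i - ?n1, j))"
    if "i < ?n1 + ?k1" "j < ?k2" for i j
    using that Zc K2c by (auto simp: B'_def append_rows_def)
  have dims: "A' \<in> carrier_mat (?n0 + ?k0) (?n1 + ?k1)" "B' \<in> carrier_mat (?n1 + ?k1) ?k2"
    using c(2) Kc Zc K2c by (auto simp: A'_def B'_def)
  have A'_gr: "graded_matrix (F1 @ D1) (F0 @ D0) A'"
    using dims(1) gr(2) W(1) K(1)
    by (auto simp: graded_matrix_def A'_entry nth_append forms_0 intro!: forms_uminus)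
  have B'_gr: "graded_matrix D2 (F1 @ D1) B'"
    using dims(2) Z(1) K2(1) by (auto simp: graded_matrix_def B'_entry nth_append)
  have A'_min: "minimal_matrix A'"
    using dims(1) A_min K(2) c(2) Kc
    by (auto simp: minimal_matrix_def A'_entry W_const)
  have B'_min: "minimal_matrix B'"
    using dims(2) K2(2) K2c by (auto simp: minimal_matrix_def B'_entry Z_const)
  have "{scalar_prod (g @\<^sub>v f) v |v. v \<in> carrier_vec (?n0 + ?k0)} = J"
  proof (intro equalityI subsetI)
    fix a assume "a \<in> {scalar_prod (g @\<^sub>v f) v |v. v \<in> carrier_vec (?n0 + ?k0)}"
    then obtain v where v: "v \<in> carrier_vec (?n0 + ?k0)" "a = scalar_prod (g @\<^sub>v f) v" by blast
    obtain x y where "x \<in> carrier_vec ?n0" "y \<in> carrier_vec ?k0" "v = x @\<^sub>v y"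
      using append_vec_exhaust[OF v(1)] by blast
    then show "a \<in> J" unfolding J I v(2) using scalar_prod_append[OF c(1) f(1)] by blast
  next
    fix a assume "a \<in> J"
    then obtain x y where xy: "x \<in> carrier_vec ?n0" "y \<in> carrier_vec ?k0" "a = scalar_prod g x + scalar_prod f y"
      unfolding J I by blast
    then have "a = scalar_prod (g @\<^sub>v f) (x @\<^sub>v y)" using scalar_prod_append[OF c(1) f(1)] by simp
    with xy show "a \<in> {scalar_prod (g @\<^sub>v f) v |v. v \<in> carrier_vec (?n0 + ?k0)}"
      by (intro CollectI exI[of _ "x @\<^sub>v y"]) simp
  qed
  moreover have "\<forall>n < length (F0 @ D0). (g @\<^sub>v f) $ n \<in> forms ((F0 @ D0) ! n)"
    using c(1) f res by (auto simp: nth_append graded_resolution_def)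
  moreover have "g @\<^sub>v f \<in> carrier_vec (length (F0 @ D0))" using c(1) f(1) by simp
  ultimately show ?thesis
    unfolding minimal_free_resolution_def using exact A'_gr A'_min B'_gr B'_min
    by (intro exI[of _ "g @\<^sub>v f"] exI[of _ A'] exI[of _ B'] conjI) simp_all
qed

lemma sum_double:
  fixes F :: "nat \<Rightarrow> 'r::comm_monoid_add"
  shows "(\<Sum>j=0..<h + h. F j) = (\<Sum>j=0..<h. F j) + (\<Sum>j=0..<h. F (h + j))"
proof -
  have "(\<Sum>j=0..<h + h. F j) = (\<Sum>j=0..<h. F j) + (\<Sum>j=h..<h + h. F j)"
    by (rule sum.atLeastLessThan_concat[symmetric]) auto
  also have "(\<Sum>j=h..<h + h. F j) = (\<Sum>j=0..<h. F (h + j))"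
    using sum.shift_bounds_nat_ivl[of F 0 h h] by (simp add: add.commute)
  finally show ?thesis .
qed

text \<open>The complex attached to the resolution of \<open>I\<close> is the direct sum of the
  Koszul complexes of the pairs \<open>\<alpha> l\<close>, \<open>\<beta> l\<close>, shifted by
  \<open>d l\<close>. The hypothesis \<open>colon\<close> contains both the annihilator of each
  \<open>f l\<close> modulo \<open>I\<close> and the directness of the sum.\<close>

lemma minimal_cone_of_points:
  fixes \<alpha> \<beta> f :: "nat \<Rightarrow> 'k::field bipoly"
  assumes res: "minimal_free_resolution I F0 F1 []"
    and \<alpha>: "\<And>l. l < h \<Longrightarrow> \<alpha> l \<in> forms (1, 0)" "\<And>l. l < h \<Longrightarrow> \<alpha> l \<noteq> 0"
    and \<beta>: "\<And>l. l < h \<Longrightarrow> \<beta> l \<in> forms (0, 1)"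
    and f: "\<And>l. l < h \<Longrightarrow> f l \<in> forms (d l)"
    and regular: "\<And>l t s. l < h \<Longrightarrow> \<beta> l * t + \<alpha> l * s = 0 \<Longrightarrow> \<exists>c. t = \<alpha> l * c \<and> s = - (\<beta> l * c)"
    and fI: "\<And>l. l < h \<Longrightarrow> \<alpha> l * f l \<in> I" "\<And>l. l < h \<Longrightarrow> \<beta> l * f l \<in> I"
    and colon: "\<And>y l. (\<Sum>l<h. y l * f l) \<in> I \<Longrightarrow> l < h \<Longrightarrow> \<exists>s t. y l = \<alpha> l * s + \<beta> l * t"
    and J: "J = {a + (\<Sum>l<h. y l * f l) |a y. a \<in> I}"
    and disjoint: "\<And>l. l < h \<Longrightarrow> d l + (0, 1) \<notin> set F0" "\<And>l. l < h \<Longrightarrow> d l + (1, 0) \<notin> set F0"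
      "\<And>l. l < h \<Longrightarrow> d l + (1, 1) \<notin> set F1"
  shows "minimal_free_resolution J (F0 @ map d [0..<h])
    (F1 @ (map (\<lambda>l. d l + (0, 1)) [0..<h] @ map (\<lambda>l. d l + (1, 0)) [0..<h]))
    (map (\<lambda>l. d l + (1, 1)) [0..<h])"
proof -
  define D0 D1 D2 where "D0 = map d [0..<h]"
    and "D1 = map (\<lambda>l. d l + (0, 1)) [0..<h] @ map (\<lambda>l. d l + (1, 0)) [0..<h]"
    and "D2 = map (\<lambda>l. d l + (1, 1)) [0..<h]"
  have len: "length D0 = h" "length D1 = h + h" "length D2 = h"
    by (simp_all add: D0_def D1_def D2_def)
  \<comment> \<open>The first \<open>h\<close> columns carry the \<beta>'s and the last
    \<open>h\<close> the \<alpha>'s, matching the order of the degrees in \<open>D1\<close>; the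
    Koszul sign is put into \<open>K2\<close>.\<close>
  define K where "K = mat h (h + h) (\<lambda>(i, j). if j < h then if i = j then \<beta> i else 0
    else if i = j - h then \<alpha> i else 0)"
  define K2 where "K2 = mat (h + h) h (\<lambda>(i, j). if i < h then if i = j then \<alpha> j else 0
    else if i - h = j then - \<beta> j else 0)"
  define fv where "fv = vec h f"
  have Kc: "K \<in> carrier_mat h (h + h)" and K2c: "K2 \<in> carrier_mat (h + h) h"
    by (simp_all add: K_def K2_def)
  have K_mult: "(K *\<^sub>v u) $ l = \<beta> l * u $ l + \<alpha> l * u $ (h + l)"
    if "u \<in> carrier_vec (h + h)" "l < h" for u l
  proof -
    have "(K *\<^sub>v u) $ l = (\<Sum>j=0..<h + h. K $$ (l, j) * u $ j)"
      using that Kc by (simp add: scalar_prod_def row_def)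
    also have "\<dots> = (\<Sum>j=0..<h. if j = l then \<beta> l * u $ l else 0) +
        (\<Sum>j=0..<h. if j = l then \<alpha> l * u $ (h + l) else 0)"
      unfolding sum_double using that by (intro arg_cong2[of _ _ _ _ "(+)"] sum.cong refl) (auto simp: K_def)
    finally show ?thesis using that by simp
  qed
  have K2_mult: "(K2 *\<^sub>v c) $ i = (if i < h then \<alpha> i * c $ i else - (\<beta> (i - h) * c $ (i - h)))"
    if "c \<in> carrier_vec h" "i < h + h" for c i
  proof -
    have "(K2 *\<^sub>v c) $ i = (\<Sum>j=0..<h. K2 $$ (i, j) * c $ j)"
      using that K2c by (simp add: scalar_prod_def row_def)
    also have "\<dots> = (\<Sum>j=0..<h. if j = (if i < h then i else i - h)
        then (if i < h then \<alpha> i * c $ i else - (\<beta> (i - h) * c $ (i - h))) else 0)"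
      using that by (intro sum.cong refl) (auto simp: K2_def)
    finally show ?thesis using that by (auto split: if_splits)
  qed
  have f_mult: "scalar_prod fv y = (\<Sum>l<h. y $ l * f l)" if "y \<in> carrier_vec h" for y
    using that by (simp add: fv_def scalar_prod_def atLeast0LessThan mult.commute)
  have KKv: "K *\<^sub>v (K2 *\<^sub>v c) = 0\<^sub>v h" if "c \<in> carrier_vec h" for c
  proof (rule eq_vecI)
    fix l assume "l < dim_vec (0\<^sub>v h)"
    then have l: "l < h" by simp
    have "K2 *\<^sub>v c \<in> carrier_vec (h + h)" using K2c that by simp
    then show "(K *\<^sub>v (K2 *\<^sub>v c)) $ l = 0\<^sub>v h $ l"
      using l that by (simp add: K_mult K2_mult algebra_simps)
  qed (use Kc in simp)
  have KK: "K * K2 = 0\<^sub>m h h"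
  proof (rule mat_col_eqI)
    fix j assume "j < dim_col (0\<^sub>m h h)"
    then have j: "j < h" by simp
    have "col (K * K2) j = K *\<^sub>v (K2 *\<^sub>v unit_vec h j)"
      using col_mult2[OF Kc K2c j] mult_mat_unit_vec[OF K2c j] by simp
    then show "col (K * K2) j = col (0\<^sub>m h h) j" using KKv[of "unit_vec h j"] j by simp
  qed (use Kc K2c in auto)
  have zero_const: "Poly_Mapping.lookup g 0 = 0" if "g \<in> forms (1, 0) \<or> g \<in> forms (0, 1)"
    for g :: "'k bipoly"
    using that lookup_0_form[of g "(1, 0)"] lookup_0_form[of g "(0, 1)"] by (auto simp: zero_prod_def)
  have K_gr: "graded_matrix D1 D0 K" "minimal_matrix K"
    using \<alpha>(1) \<beta> unfolding graded_matrix_def minimal_matrix_def len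
    by (auto simp: K_def D0_def D1_def nth_append forms_0 zero_const)
  have K2_gr: "graded_matrix D2 D1 K2" "minimal_matrix K2"
    using \<alpha>(1) \<beta> unfolding graded_matrix_def minimal_matrix_def len
    by (auto simp: K2_def D1_def D2_def nth_append forms_0 zero_const intro!: forms_uminus)
  have exact_K: "\<exists>c\<in>carrier_vec h. u = K2 *\<^sub>v c"
    if u: "u \<in> carrier_vec (h + h)" "K *\<^sub>v u = 0\<^sub>v h" for u
  proof -
    have "\<exists>c. u $ l = \<alpha> l * c \<and> u $ (h + l) = - (\<beta> l * c)" if "l < h" for l
      using regular[OF that, of "u $ l" "u $ (h + l)"] K_mult[OF u(1) that] that by (simp add: u(2))
    then obtain c where c: "\<And>l. l < h \<Longrightarrow> u $ l = \<alpha> l * c l \<and> u $ (h + l) = - (\<beta> l * c l)"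
      by metis
    have "u = K2 *\<^sub>v vec h c"
    proof (rule eq_vecI)
      fix i assume "i < dim_vec (K2 *\<^sub>v vec h c)"
      then have i: "i < h + h" using K2c by simp
      show "u $ i = (K2 *\<^sub>v vec h c) $ i"
        unfolding K2_mult[OF vec_carrier i] using c[of i] c[of "i - h"] i by auto
    qed (use u(1) K2c in simp)
    then show ?thesis by (intro bexI[of _ "vec h c"]) simp_all
  qed
  have inj_K2: "c = 0\<^sub>v h" if c: "c \<in> carrier_vec h" "K2 *\<^sub>v c = 0\<^sub>v (h + h)" for c
  proof (rule eq_vecI)
    fix i assume "i < dim_vec (0\<^sub>v h)"
    then have i: "i < h" by simp
    have "\<alpha> i * c $ i = 0" using K2_mult[OF c(1), of i] i by (simp add: c(2))
    then show "c $ i = 0\<^sub>v h $ i" using \<alpha>(2)[OF i] i by simp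
  qed (use c in simp)
  have fK: "scalar_prod fv (col K j) \<in> I" if "j < h + h" for j
  proof -
    have "scalar_prod fv (col K j) = (\<Sum>l<h. K $$ (l, j) * f l)"
      using that Kc by (simp add: f_mult)
    also have "\<dots> = (\<Sum>l<h. if l = (if j < h then j else j - h)
        then (if j < h then \<beta> j * f j else \<alpha> (j - h) * f (j - h)) else 0)"
      using that by (intro sum.cong refl) (auto simp: K_def)
    also have "\<dots> = (if j < h then \<beta> j * f j else \<alpha> (j - h) * f (j - h))"
      using that by (auto split: if_splits)
    also have "\<dots> \<in> I" using fI that by auto
    finally show ?thesis .
  qed
  have colon': "\<exists>u\<in>carrier_vec (h + h). K *\<^sub>v u = y"
    if y: "y \<in> carrier_vec h" "scalar_prod fv y \<in> I" for y
  proof -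
    have "\<exists>s t. y $ l = \<alpha> l * s + \<beta> l * t" if "l < h" for l
      using colon[of "\<lambda>l. y $ l", OF _ that] y(2) by (simp add: f_mult[OF y(1)])
    then obtain s t where st: "\<And>l. l < h \<Longrightarrow> y $ l = \<alpha> l * s l + \<beta> l * t l" by metis
    define u where "u = vec (h + h) (\<lambda>i. if i < h then t i else s (i - h))"
    have u: "u \<in> carrier_vec (h + h)" by (simp add: u_def)
    have "K *\<^sub>v u = y"
    proof (rule eq_vecI)
      fix l assume "l < dim_vec y"
      then have l: "l < h" using y by simp
      show "(K *\<^sub>v u) $ l = y $ l" unfolding K_mult[OF u l] st[OF l] using l by (simp add: u_def add.commute)
    qed (use y Kc in simp)
    with u show ?thesis by blast
  qed
  have J': "J = {a + scalar_prod fv y |a y. a \<in> I \<and> y \<in> carrier_vec h}"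
  proof (intro equalityI subsetI)
    fix b assume "b \<in> J"
    then obtain a y where "a \<in> I" "b = a + (\<Sum>l<h. y l * f l)" unfolding J by blast
    then show "b \<in> {a + scalar_prod fv y |a y. a \<in> I \<and> y \<in> carrier_vec h}"
      by (intro CollectI exI[of _ a] exI[of _ "vec h y"]) (simp add: f_mult)
  next
    fix b assume "b \<in> {a + scalar_prod fv y |a y. a \<in> I \<and> y \<in> carrier_vec h}"
    then obtain a y where "a \<in> I" "y \<in> carrier_vec h" "b = a + (\<Sum>l<h. y $ l * f l)"
      using f_mult by auto
    then show "b \<in> J" unfolding J by blast
  qed
  have "minimal_free_resolution J (F0 @ D0) (F1 @ D1) D2"
  proof (rule minimal_mapping_cone[OF res K_gr K2_gr _ _ _ _ _ _ _ _ , unfolded len])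
    show "fv \<in> carrier_vec h" by (simp add: fv_def)
    show "\<forall>n<h. fv $ n \<in> forms (D0 ! n)" using f by (simp add: fv_def D0_def)
    show "set D1 \<inter> set F0 = {}" "set D2 \<inter> set F1 = {}"
      using disjoint by (auto simp: D1_def D2_def)
  qed (fact KK exact_K inj_K2 fK colon' J')+
  then show ?thesis by (simp only: D0_def D1_def D2_def)
qed

section \<open>Ideals of Ferrers diagrams\<close>

text \<open>\<open>lam\<close> is a partition, with \<open>lam i\<close> the length of row
  \<open>i\<close>. Its value 0 beyond row \<open>a\<close> makes index \<open>Suc a\<close>
  available for the last generator, the product of all row forms.\<close>

locale staircase =
  fixes a :: nat and U V :: "nat \<Rightarrow> 'k::field \<times> 'k" and lam :: "nat \<Rightarrow> nat"
  assumes U_nonzero: "i \<le> a \<Longrightarrow> U i \<noteq> (0, 0)"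
    and V_nonzero: "j < lam 0 \<Longrightarrow> V j \<noteq> (0, 0)"
    and U_cross: "i \<le> a \<Longrightarrow> i' \<le> a \<Longrightarrow> i \<noteq> i' \<Longrightarrow> cross (U i) (U i') \<noteq> 0"
    and V_cross: "j < lam 0 \<Longrightarrow> j' < lam 0 \<Longrightarrow> j \<noteq> j' \<Longrightarrow> cross (V j) (V j') \<noteq> 0"
    and lam_antimono: "i \<le> i' \<Longrightarrow> lam i' \<le> lam i"
    and lam_eq_0: "a < i \<Longrightarrow> lam i = 0"
begin

definition stair_ideal :: "'k bipoly set" where
  "stair_ideal = {f. \<forall>i j. j < lam i \<longrightarrow> on_cone (U i) (V j) f = 0}"

definition stair_form :: "nat \<Rightarrow> 'k bipoly" where
  "stair_form k = (\<Prod>i<k. alpha (U i)) * (\<Prod>j<lam k. beta (V j))"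

text \<open>The columns that end between two consecutive rows. For rows of equal length the product
  is empty and equals 1, which is how constant entries enter the resolution.\<close>

definition \<gamma> :: "nat \<Rightarrow> 'k bipoly" where
  "\<gamma> k = (\<Prod>j=lam (Suc k)..<lam k. beta (V j))"

lemma lt_lam: "j < lam i \<Longrightarrow> i \<le> a" "j < lam i \<Longrightarrow> j < lam 0"
  using lam_eq_0[of i] lam_antimono[of 0 i] by (auto simp: not_less[symmetric])

lemma beta_V_nonzero: "j < lam i \<Longrightarrow> beta (V j) \<noteq> 0"
  by (rule beta_nonzero[OF V_nonzero[OF lt_lam(2)]])

lemma forms_stair_form: "stair_form k \<in> forms (int k, int (lam k))"
  using forms_mult[OF forms_prod_x[of "{..<k}" "\<lambda>i. alpha (U i)"] forms_prod_y[of "{..<lam k}" "\<lambda>j. beta (V j)"]]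
  by (simp add: stair_form_def forms_alpha forms_beta)

lemma on_cone_prod_eq_0:
  assumes "finite A" "i \<in> A" "on_cone u v (F i) = 0"
  shows "on_cone u v (\<Prod>i\<in>A. F i) = 0"
  using assms by (auto simp: on_cone.hom_prod intro: prod_zero)

lemma on_cone_self: "on_cone u v (alpha u) = 0" "on_cone u v (beta v) = 0"
  by (simp_all add: on_cone_lin cross_self)

lemma stair_form_mem: "stair_form k \<in> stair_ideal"
proof -
  have "on_cone (U i) (V j) (stair_form k) = 0" if "j < lam i" for i j
  proof (cases "i < k")
    case True
    then show ?thesis
      by (simp add: stair_form_def on_cone.hom_mult on_cone_prod_eq_0[of _ i] on_cone_self)
  next
    case False
    then have "j < lam k" using that lam_antimono[of k i] by simp
    then show ?thesis
      by (simp add: stair_form_def on_cone.hom_mult on_cone_prod_eq_0[of _ j] on_cone_self)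
  qed
  then show ?thesis by (simp add: stair_ideal_def)
qed

lemma stair_ideal_closed:
  "0 \<in> stair_ideal" "f \<in> stair_ideal \<Longrightarrow> g \<in> stair_ideal \<Longrightarrow> f + g \<in> stair_ideal"
  "f \<in> stair_ideal \<Longrightarrow> c * f \<in> stair_ideal"
  by (simp_all add: stair_ideal_def on_cone.hom_add on_cone.hom_mult)

text \<open>Restricting \<open>f\<close> to the first line produces a multiple of the forms of the columns meeting it;
  the rest is divisible by the form of that line, and the quotient vanishes on the remaining rows.\<close>

lemma stair_ideal_generated:
  assumes "f \<in> stair_ideal"
  shows "\<exists>w. f = (\<Sum>k\<le>Suc a. w k * stair_form k)"
proof -
  \<comment> \<open>The claim is generalised to polynomials vanishing on the rows from
    \<open>n\<close> on, multiplied by the forms of the earlier rows. The induction runs downwards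
    from \<open>Suc a\<close>, where no condition remains.\<close>
  have "(\<forall>i\<ge>n. \<forall>j<lam i. on_cone (U i) (V j) f = 0) \<longrightarrow>
      (\<exists>w. (\<Prod>i<n. alpha (U i)) * f = (\<Sum>k\<le>Suc a. w k * stair_form k))" if "n \<le> Suc a" for n f
    using that
  proof (induction n arbitrary: f rule: inc_induct)
    case base
    have stair_form_top: "stair_form (Suc a) = (\<Prod>i<Suc a. alpha (U i))"
      by (simp add: stair_form_def lam_eq_0 del: prod.lessThan_Suc)
    have sum: "(\<Sum>k\<le>Suc a. (if k = Suc a then f else 0) * stair_form k) = f * stair_form (Suc a)"
      by (simp add: if_distrib[of "\<lambda>x. x * _"] cong: if_cong)
    have "(\<Prod>i<Suc a. alpha (U i)) * f = f * stair_form (Suc a)"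
      unfolding stair_form_top by (rule mult.commute)
    from trans[OF this sum[symmetric]] show ?case by (intro impI exI)
  next
    case (step n)
    have Un: "U n \<noteq> (0, 0)" using step.hyps by (intro U_nonzero) simp
    show ?case
    proof
      assume f: "\<forall>i\<ge>n. \<forall>j<lam i. on_cone (U i) (V j) f = 0"
      have "(\<Prod>j\<in>{..<lam n}. beta (V j)) dvd on_x (U n) f"
        by (rule beta_prod_dvd[OF Un]) (use f lt_lam(2) V_nonzero V_cross in auto)
      then obtain c where c: "on_x (U n) f = (\<Prod>j<lam n. beta (V j)) * c" by (meson dvdE)
      obtain e where e: "f - on_x (U n) f = alpha (U n) * e"
        using alpha_dvd_diff[OF Un] by (meson dvdE)
      have "on_cone (U i) (V j) e = 0" if ij: "Suc n \<le> i" "j < lam i" for i j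
      proof -
        have "j < lam n" using ij lam_antimono[of n i] by simp
        then have "on_cone (U i) (V j) (f - on_x (U n) f) = 0"
          using f[rule_format, of i j] ij
          by (simp add: on_cone.hom_minus c on_cone.hom_mult on_cone_prod_eq_0[of _ j] on_cone_self)
        \<comment> \<open>On a later row the form of row \<open>n\<close> is nonzero, so the
          vanishing passes to the quotient \<open>e\<close>.\<close>
        then have "Const (cross (U i) (U n)) * X0 * on_cone (U i) (V j) e = 0"
          by (simp add: e on_cone.hom_mult on_cone_lin)
        moreover have "cross (U i) (U n) \<noteq> 0" using ij lt_lam(1)[OF ij(2)] by (intro U_cross) auto
        moreover have "X0 \<noteq> (0 :: 'k bipoly)"
          unfolding X0_def by (metis lookup_single_eq lookup_zero zero_neq_one)
        ultimately show ?thesis by (simp add: Const_eq_0_iff)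
      qed
      then obtain w where w: "(\<Prod>i<Suc n. alpha (U i)) * e = (\<Sum>k\<le>Suc a. w k * stair_form k)"
        using step.IH by blast
      have "f = on_x (U n) f + alpha (U n) * e" using e by (simp add: algebra_simps)
      then have "(\<Prod>i<n. alpha (U i)) * f = (\<Prod>i<n. alpha (U i)) * (on_x (U n) f + alpha (U n) * e)"
        by simp
      also have "\<dots> = c * stair_form n + (\<Prod>i<Suc n. alpha (U i)) * e"
        by (simp add: c stair_form_def algebra_simps)
      also have "\<dots> = (\<Sum>k\<le>Suc a. (if k = n then c * stair_form k else 0)) + (\<Sum>k\<le>Suc a. w k * stair_form k)"
        using step.hyps by (simp only: w sum.delta finite_atMost atMost_iff) simp
      also have "\<dots> = (\<Sum>k\<le>Suc a. ((if k = n then c else 0) + w k) * stair_form k)"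
        unfolding sum.distrib[symmetric] by (intro sum.cong refl) (auto simp: algebra_simps)
      finally show "\<exists>w. (\<Prod>i<n. alpha (U i)) * f = (\<Sum>k\<le>Suc a. w k * stair_form k)"
        by (rule exI[of _ "\<lambda>k. (if k = n then c else 0) + w k"])
    qed
  qed
  from this[of 0 f] assms show ?thesis by (simp add: stair_ideal_def)
qed

lemma \<gamma>_nonzero: "\<gamma> k \<noteq> 0"
  by (auto simp: \<gamma>_def beta_V_nonzero)

text \<open>Telescoping; it brings the stair forms into the shape required by
  \<open>staircase_relations\<close>.\<close>

lemma prod_\<gamma>:
  assumes "k \<le> Suc a"
  shows "(\<Prod>i=k..<Suc a. \<gamma> i) = (\<Prod>j<lam k. beta (V j))"
  using assms
proof (induction rule: inc_induct)
  case (step n)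
  have "(\<Prod>i=n..<Suc a. \<gamma> i) = \<gamma> n * (\<Prod>i=Suc n..<Suc a. \<gamma> i)"
    using step.hyps by (intro prod.atLeast_Suc_lessThan)
  also have "\<dots> = (\<Prod>j=0..<lam (Suc n). beta (V j)) * (\<Prod>j=lam (Suc n)..<lam n. beta (V j))"
    unfolding step.IH unfolding \<gamma>_def by (simp only: mult.commute atLeast0LessThan)
  also have "\<dots> = (\<Prod>j=0..<lam n. beta (V j))"
    using lam_antimono[of n "Suc n"] by (intro prod.atLeastLessThan_concat) auto
  finally show ?case by (simp add: atLeast0LessThan)
qed (simp add: lam_eq_0)

lemma stair_form_relation: "k \<le> a \<Longrightarrow> alpha (U k) * stair_form k = \<gamma> k * stair_form (Suc k)"
proof -
  assume "k \<le> a"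
  have "(\<Prod>j<lam k. beta (V j)) = (\<Prod>j=0..<lam (Suc k). beta (V j)) * \<gamma> k"
    unfolding \<gamma>_def atLeast0LessThan[symmetric] using lam_antimono[of k "Suc k"]
    by (intro prod.atLeastLessThan_concat[symmetric]) auto
  then show ?thesis by (simp add: stair_form_def atLeast0LessThan mult_ac)
qed

lemma stair_form_syzygies:
  assumes "(\<Sum>k\<le>Suc a. w k * stair_form k) = 0"
  shows "\<exists>z. \<forall>k\<le>Suc a. w k = (if k < Suc a then alpha (U k) * z k else 0)
    - (if 0 < k then \<gamma> (k - 1) * z (k - 1) else 0)"
proof (rule staircase_relations[where \<rho> = "\<lambda>i. alpha (U i)"])
  show "\<gamma> i dvd t" if "i < Suc a" "\<gamma> i dvd t * (\<Prod>i'<Suc i. alpha (U i'))" for i t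
    unfolding \<gamma>_def
    by (rule beta_prod_dvd_mult_alpha_prod[OF _ _ _ _ that(2)[unfolded \<gamma>_def]])
      (use that(1) U_nonzero V_nonzero lt_lam(2) in auto)
  have "(\<Sum>k\<le>Suc a. w k * ((\<Prod>i<k. alpha (U i)) * (\<Prod>i=k..<Suc a. \<gamma> i))) = (\<Sum>k\<le>Suc a. w k * stair_form k)"
    by (intro sum.cong refl) (simp only: atMost_iff prod_\<gamma> stair_form_def)
  then show "(\<Sum>k\<le>Suc a. w k * ((\<Prod>i<k. alpha (U i)) * (\<Prod>i=k..<Suc a. \<gamma> i))) = 0"
    using assms by simp
qed (rule \<gamma>_nonzero)

definition gens where "gens = vec (Suc (Suc a)) stair_form"

text \<open>A Hilbert-Burch matrix: bidiagonal, with the stair forms as maximal minors up to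
  sign.\<close>

definition rels where "rels = mat (Suc (Suc a)) (Suc a)
  (\<lambda>(i, k). if i = k then alpha (U k) else if i = Suc k then - \<gamma> k else 0)"

lemma rels_mult:
  assumes "z \<in> carrier_vec (Suc a)" "k \<le> Suc a"
  shows "(rels *\<^sub>v z) $ k = (if k < Suc a then alpha (U k) * z $ k else 0)
    - (if 0 < k then \<gamma> (k - 1) * z $ (k - 1) else 0)"
proof -
  have "(rels *\<^sub>v z) $ k = (\<Sum>j=0..<Suc a. rels $$ (k, j) * z $ j)"
    using assms by (simp add: rels_def scalar_prod_def row_def)
  also have "\<dots> = (\<Sum>j=0..<Suc a. (if j = k then alpha (U k) * z $ k else 0) +
      (if j = k - 1 then (if 0 < k then - (\<gamma> (k - 1) * z $ (k - 1)) else 0) else 0))"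
    using assms by (intro sum.cong refl) (auto simp: rels_def)
  also have "\<dots> = (if k < Suc a then alpha (U k) * z $ k else 0)
    - (if 0 < k then \<gamma> (k - 1) * z $ (k - 1) else 0)"
    unfolding sum.distrib using assms by (cases k) (auto simp: sum.delta)
  finally show ?thesis .
qed

lemma gens_mult: "v \<in> carrier_vec (Suc (Suc a)) \<Longrightarrow> scalar_prod gens v = (\<Sum>k\<le>Suc a. v $ k * stair_form k)"
  by (simp add: gens_def scalar_prod_def atLeast0LessThan lessThan_Suc_atMost mult.commute
      del: sum.atMost_Suc sum.lessThan_Suc sum.op_ivl_Suc)

lemma forms_\<gamma>: "\<gamma> k \<in> forms (0, int (lam k) - int (lam (Suc k)))"
  using forms_prod_y[of "{lam (Suc k)..<lam k}" "\<lambda>j. beta (V j)"] lam_antimono[of k "Suc k"]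
  by (simp add: \<gamma>_def forms_beta of_nat_diff)

lemma staircase_resolution:
  "graded_resolution stair_ideal (map (\<lambda>k. (int k, int (lam k))) [0..<Suc (Suc a)])
    (map (\<lambda>k. (int k + 1, int (lam k))) [0..<Suc a]) [] gens rels (0\<^sub>m (Suc a) 0)"
proof -
  have gens_c: "gens \<in> carrier_vec (Suc (Suc a))" and rels_c: "rels \<in> carrier_mat (Suc (Suc a)) (Suc a)"
    by (simp_all add: gens_def rels_def)
  have mult_0: "0\<^sub>m (Suc a) 0 *\<^sub>v z = 0\<^sub>v (Suc a)" if "z \<in> carrier_vec 0" for z :: "'k bipoly vec"
    using that by (intro eq_vecI) (auto simp: scalar_prod_def)
  have image: "{scalar_prod gens v |v. v \<in> carrier_vec (Suc (Suc a))} = stair_ideal"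
  proof (intro equalityI subsetI)
    fix f assume "f \<in> {scalar_prod gens v |v. v \<in> carrier_vec (Suc (Suc a))}"
    then obtain v where v: "v \<in> carrier_vec (Suc (Suc a))" "f = (\<Sum>k\<le>Suc a. v $ k * stair_form k)"
      using gens_mult by auto
    have "(\<Sum>k\<in>A. v $ k * stair_form k) \<in> stair_ideal" for A
      by (induction A rule: infinite_finite_induct) (simp_all add: stair_ideal_closed stair_form_mem)
    then show "f \<in> stair_ideal" by (simp only: v)
  next
    fix f assume "f \<in> stair_ideal"
    then obtain w where "f = (\<Sum>k\<le>Suc a. w k * stair_form k)" using stair_ideal_generated by blast
    then have "f = scalar_prod gens (vec (Suc (Suc a)) w)"
      by (simp add: gens_mult del: sum.atMost_Suc)
    then show "f \<in> {scalar_prod gens v |v. v \<in> carrier_vec (Suc (Suc a))}"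
      by (intro CollectI exI[of _ "vec (Suc (Suc a)) w"]) simp
  qed
  have exact: "{v \<in> carrier_vec (Suc (Suc a)). scalar_prod gens v = 0} =
      {rels *\<^sub>v z |z. z \<in> carrier_vec (Suc a)}"
  proof (intro equalityI subsetI)
    fix v assume "v \<in> {v \<in> carrier_vec (Suc (Suc a)). scalar_prod gens v = 0}"
    then have v: "v \<in> carrier_vec (Suc (Suc a))" "(\<Sum>k\<le>Suc a. v $ k * stair_form k) = 0"
      using gens_mult by auto
    obtain z where z: "\<forall>k\<le>Suc a. v $ k = (if k < Suc a then alpha (U k) * z k else 0)
        - (if 0 < k then \<gamma> (k - 1) * z (k - 1) else 0)"
      using stair_form_syzygies[OF v(2)] by blast
    have "v = rels *\<^sub>v vec (Suc a) z"
    proof (rule eq_vecI)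
      fix k assume "k < dim_vec (rels *\<^sub>v vec (Suc a) z)"
      then have k: "k \<le> Suc a" using rels_c by simp
      then show "v $ k = (rels *\<^sub>v vec (Suc a) z) $ k"
        using z[rule_format, OF k] by (auto simp: rels_mult)
    qed (use v rels_c in simp)
    then show "v \<in> {rels *\<^sub>v z |z. z \<in> carrier_vec (Suc a)}" using vec_carrier by blast
  next
    fix v assume "v \<in> {rels *\<^sub>v z |z. z \<in> carrier_vec (Suc a)}"
    then obtain z where z: "z \<in> carrier_vec (Suc a)" "v = rels *\<^sub>v z" by blast
    have v: "v \<in> carrier_vec (Suc (Suc a))" using z rels_c by simp
    have "scalar_prod gens v = (\<Sum>k\<le>Suc a. (if k < Suc a then alpha (U k) * z $ k * stair_form k else 0)
        - (if 0 < k then \<gamma> (k - 1) * z $ (k - 1) * stair_form k else 0))"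
      unfolding gens_mult[OF v] unfolding z(2)
      by (intro sum.cong refl) (simp add: rels_mult[OF z(1)] algebra_simps)
    also have "\<dots> = (\<Sum>k\<le>a. alpha (U k) * z $ k * stair_form k) - (\<Sum>k\<le>a. \<gamma> k * z $ k * stair_form (Suc k))"
    proof -
      have "(\<Sum>k\<le>Suc a. if k < Suc a then alpha (U k) * z $ k * stair_form k else 0) =
          (\<Sum>k\<le>a. alpha (U k) * z $ k * stair_form k)"
        by simp
      moreover have "(\<Sum>k\<le>Suc a. if 0 < k then \<gamma> (k - 1) * z $ (k - 1) * stair_form k else 0) =
          (\<Sum>k\<le>a. \<gamma> k * z $ k * stair_form (Suc k))"
        by (subst sum.atMost_Suc_shift) simp
      ultimately show ?thesis by (simp only: sum_subtractf)
    qed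
    also have "\<dots> = (\<Sum>k\<le>a. z $ k * (alpha (U k) * stair_form k - \<gamma> k * stair_form (Suc k)))"
      unfolding sum_subtractf[symmetric] by (intro sum.cong refl) (simp add: algebra_simps)
    also have "\<dots> = 0" by (intro sum.neutral) (simp add: stair_form_relation)
    finally show "v \<in> {v \<in> carrier_vec (Suc (Suc a)). scalar_prod gens v = 0}" using v by simp
  qed
  have kernel: "{z \<in> carrier_vec (Suc a). rels *\<^sub>v z = 0\<^sub>v (Suc (Suc a))} =
      {0\<^sub>m (Suc a) 0 *\<^sub>v z |z. z \<in> carrier_vec 0}"
  proof (intro equalityI subsetI)
    fix z assume "z \<in> {z \<in> carrier_vec (Suc a). rels *\<^sub>v z = 0\<^sub>v (Suc (Suc a))}"
    then have z: "z \<in> carrier_vec (Suc a)" "rels *\<^sub>v z = 0\<^sub>v (Suc (Suc a))" by auto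
    \<comment> \<open>Forward substitution: row \<open>k\<close> of the bidiagonal system determines
      \<open>alpha (U k) * z $ k\<close> from the preceding entry, and \<open>alpha (U k)\<close> is
      nonzero.\<close>
    have "k \<le> a \<longrightarrow> z $ k = 0" for k
    proof (induction k)
      case 0
      then show ?case using rels_mult[OF z(1), of 0] alpha_nonzero[OF U_nonzero[of 0]] by (simp add: z(2))
    next
      case (Suc k)
      then show ?case using rels_mult[OF z(1), of "Suc k"] alpha_nonzero[OF U_nonzero[of "Suc k"]]
        by (auto simp: z(2))
    qed
    then have "z = 0\<^sub>v (Suc a)" using z(1) by (intro eq_vecI) auto
    then show "z \<in> {0\<^sub>m (Suc a) 0 *\<^sub>v z |z. z \<in> carrier_vec 0}"
      by (intro CollectI exI[of _ "0\<^sub>v 0"]) (simp add: mult_0)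
  next
    fix z :: "'k bipoly vec" assume "z \<in> {0\<^sub>m (Suc a) 0 *\<^sub>v z |z. z \<in> carrier_vec (0::nat)}"
    then have z: "z = 0\<^sub>v (Suc a)" using mult_0 by auto
    have "rels *\<^sub>v 0\<^sub>v (Suc a) = 0\<^sub>v (Suc (Suc a))" using rels_c by (intro eq_vecI) auto
    then show "z \<in> {z \<in> carrier_vec (Suc a). rels *\<^sub>v z = 0\<^sub>v (Suc (Suc a))}" by (simp add: z)
  qed
  have gens_forms: "\<forall>n < Suc (Suc a). gens $ n \<in> forms (map (\<lambda>k. (int k, int (lam k))) [0..<Suc (Suc a)] ! n)"
    by (simp add: gens_def forms_stair_form del: upt_Suc)
  have rels_gr: "graded_matrix (map (\<lambda>k. (int k + 1, int (lam k))) [0..<Suc a])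
      (map (\<lambda>k. (int k, int (lam k))) [0..<Suc (Suc a)]) rels"
    using rels_c by (auto simp: graded_matrix_def rels_def forms_alpha forms_0 forms_\<gamma> forms_uminus
        simp del: upt_Suc)
  have "graded_matrix [] (map (\<lambda>k. (int k + 1, int (lam k))) [0..<Suc a]) (0\<^sub>m (Suc a) 0 :: 'k bipoly mat)"
    by (simp add: graded_matrix_def del: upt_Suc)
  moreover have "{z \<in> carrier_vec 0. 0\<^sub>m (Suc a) 0 *\<^sub>v z = 0\<^sub>v (Suc a)} = {0\<^sub>v 0 :: 'k bipoly vec}"
    using mult_0 by auto
  ultimately show ?thesis
    unfolding graded_resolution_def length_map length_upt list.size
    using gens_c image exact kernel gens_forms rels_gr by (simp del: upt_Suc)
qed

lemma const_coeff_linear: "const_coeff (alpha u) = 0" "const_coeff (beta v) = 0"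
  using lookup_0_form[OF forms_alpha, of u] lookup_0_form[OF forms_beta, of v]
  by (auto simp: const_coeff_def zero_prod_def)

lemma const_coeff_\<gamma>: "const_coeff (\<gamma> k) = (if lam (Suc k) < lam k then 0 else 1)"
  using lam_antimono[of k "Suc k"]
  by (auto simp: \<gamma>_def const_coeff.hom_prod const_coeff_linear)

lemma const_coeff_rels:
  assumes "i \<le> Suc a" "k \<le> a"
  shows "const_coeff (rels $$ (i, k)) = (if i = Suc k \<and> lam (Suc k) = lam k then - 1 else 0)"
  using assms lam_antimono[of k "Suc k"]
  by (auto simp: rels_def const_coeff_linear const_coeff_\<gamma> const_coeff.hom_uminus)

text \<open>A constant entry pairs relation \<open>k\<close> with generator \<open>Suc k\<close>,
  which then have the same degree and cancel in a minimal resolution. Comparing in one direction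
  shows that only unpaired degrees occur, in the other that all of them do.\<close>

lemma stair_resolution_degrees:
  assumes "minimal_free_resolution stair_ideal F0 F1 []"
  shows "set F0 = {(int k, int (lam k)) |k. k \<le> Suc a \<and> (k = 0 \<or> lam k < lam (k - 1))}"
    and "set F1 = {(int k + 1, int (lam k)) |k. k \<le> a \<and> lam (Suc k) < lam k}"
proof -
  obtain g A B where res: "graded_resolution stair_ideal F0 F1 [] g A B" and min: "minimal_matrix A"
    using assms unfolding minimal_free_resolution_iff by blast
  have A: "const_coeff (A $$ (i, j)) = 0" if "i < length F0" "j < length F1" for i j
    using min that resolution_carriers(2)[OF res]
    by (auto simp: minimal_matrix_def const_coeff_def)
  note to_stair = resolution_degree_comparison[OF res staircase_resolution]
    and from_stair = resolution_degree_comparison[OF staircase_resolution res]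
  show "set F0 = {(int k, int (lam k)) |k. k \<le> Suc a \<and> (k = 0 \<or> lam k < lam (k - 1))}"
  proof (intro equalityI subsetI)
    fix d assume "d \<in> set F0"
    then obtain n where n: "n < length F0" "d = F0 ! n" by (metis in_set_conv_nth)
    have "\<exists>y k. (\<forall>c\<le>a. (\<Sum>r<Suc (Suc a). y r * const_coeff (rels $$ (r, c))) = 0) \<and>
        k \<le> Suc a \<and> y k \<noteq> 0 \<and> d = (int k, int (lam k))"
      using to_stair(1)[OF n(1) A[OF n(1)]] n(2)
      by (fastforce simp del: upt_Suc sum.lessThan_Suc simp: less_Suc_eq_le)
    then obtain y k where y: "\<And>c. c \<le> a \<Longrightarrow> (\<Sum>r<Suc (Suc a). y r * const_coeff (rels $$ (r, c))) = 0"
      and k: "k \<le> Suc a" "y k \<noteq> 0" "d = (int k, int (lam k))" by blast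
    \<comment> \<open>If row \<open>k\<close> were as long as its predecessor, column
      \<open>k - 1\<close> of \<open>rels\<close> would have its only constant entry, -1, in row
      \<open>k\<close>; annihilation by \<open>y\<close> would then force
      \<open>y k = 0\<close>.\<close>
    have "lam k < lam (k - 1)" if "k \<noteq> 0"
    proof (rule ccontr)
      assume "\<not> lam k < lam (k - 1)"
      then have eq: "lam (Suc (k - 1)) = lam (k - 1)" using that lam_antimono[of "k - 1" k] by simp
      have "(\<Sum>r<Suc (Suc a). y r * const_coeff (rels $$ (r, k - 1))) =
          (\<Sum>r<Suc (Suc a). if r = k then - y k else 0)"
        using that k(1) eq by (intro sum.cong refl) (auto simp: const_coeff_rels)
      also have "\<dots> = - y k" using k(1) by (simp add: sum.delta del: sum.lessThan_Suc)
      finally have "- y k = (\<Sum>r<Suc (Suc a). y r * const_coeff (rels $$ (r, k - 1)))" ..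
      also have "\<dots> = 0" using k(1) by (intro y) linarith
      finally have "- y k = 0" .
      then show False using k(2) by simp
    qed
    then show "d \<in> {(int k, int (lam k)) |k. k \<le> Suc a \<and> (k = 0 \<or> lam k < lam (k - 1))}"
      by (intro CollectI exI[of _ k] conjI k) argo
  next
    fix d assume "d \<in> {(int k, int (lam k)) |k. k \<le> Suc a \<and> (k = 0 \<or> lam k < lam (k - 1))}"
    then obtain k where k: "d = (int k, int (lam k))" "k \<le> Suc a" "k = 0 \<or> lam k < lam (k - 1)" by blast
    \<comment> \<open>An unpaired generator has a row without constant entries, the condition under
      which the comparison transports its degree.\<close>
    have "const_coeff (rels $$ (k, j)) = 0" if "j < Suc a" for j
      using that k by (auto simp: const_coeff_rels)
    then have "\<exists>j<length F0. F0 ! j = d" using from_stair(1)[of k] k by (auto simp del: upt_Suc)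
    then show "d \<in> set F0" by (metis nth_mem)
  qed
  show "set F1 = {(int k + 1, int (lam k)) |k. k \<le> a \<and> lam (Suc k) < lam k}"
  proof (intro equalityI subsetI)
    fix d assume "d \<in> set F1"
    then obtain n where n: "n < length F1" "d = F1 ! n" by (metis in_set_conv_nth)
    have "\<exists>x k. (\<forall>r\<le>Suc a. (\<Sum>c<Suc a. const_coeff (rels $$ (r, c)) * x c) = 0) \<and>
        k \<le> a \<and> x k \<noteq> 0 \<and> d = (int k + 1, int (lam k))"
      using to_stair(2)[OF n(1) A[OF _ n(1)]] n(2)
      by (fastforce simp del: upt_Suc sum.lessThan_Suc simp: less_Suc_eq_le)
    then obtain x k where x: "\<And>r. r \<le> Suc a \<Longrightarrow> (\<Sum>c<Suc a. const_coeff (rels $$ (r, c)) * x c) = 0"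
      and k: "k \<le> a" "x k \<noteq> 0" "d = (int k + 1, int (lam k))" by blast
    \<comment> \<open>For rows of equal length, row \<open>Suc k\<close> of \<open>rels\<close>
      would have the single constant entry -1 in column \<open>k\<close> and force
      \<open>x k = 0\<close>.\<close>
    have "lam (Suc k) < lam k"
    proof (rule ccontr)
      assume "\<not> lam (Suc k) < lam k"
      then have eq: "lam (Suc k) = lam k" using lam_antimono[of k "Suc k"] by simp
      have "(\<Sum>c<Suc a. const_coeff (rels $$ (Suc k, c)) * x c) =
          (\<Sum>c<Suc a. if c = k then - x k else 0)"
        using k(1) eq by (intro sum.cong refl) (auto simp: const_coeff_rels)
      also have "\<dots> = - x k" using k(1) by (simp add: sum.delta del: sum.lessThan_Suc)
      finally show False using x[of "Suc k"] k by simp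
    qed
    then show "d \<in> {(int k + 1, int (lam k)) |k. k \<le> a \<and> lam (Suc k) < lam k}"
      by (intro CollectI exI[of _ k] conjI k)
  next
    fix d assume "d \<in> {(int k + 1, int (lam k)) |k. k \<le> a \<and> lam (Suc k) < lam k}"
    then obtain k where k: "d = (int k + 1, int (lam k))" "k \<le> a" "lam (Suc k) < lam k" by blast
    have "const_coeff (rels $$ (i, k)) = 0" if "i < Suc (Suc a)" for i
      using that k by (auto simp: const_coeff_rels)
    then have "\<exists>j<length F1. F1 ! j = d" using from_stair(2)[of k] k by (auto simp del: upt_Suc)
    then show "d \<in> set F1" by (metis nth_mem)
  qed
qed

end

section \<open>Hilbert functions and removed points\<close>

lemma rep_P1_nonzero: "rep_P1 p \<noteq> (0, 0)"
  using Quotient3_rep_reflp[OF Quotient3_P1, of p] by (simp add: proportional_def)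

lemma cross_rep_P1: "cross (rep_P1 p) (rep_P1 q) = 0 \<longleftrightarrow> p = q"
proof
  assume "cross (rep_P1 p) (rep_P1 q) = 0"
  then have eq: "fst (rep_P1 p) * snd (rep_P1 q) = snd (rep_P1 p) * fst (rep_P1 q)"
    by (simp add: cross_def)
  obtain x y where p: "rep_P1 p = (x, y)" by (cases "rep_P1 p")
  obtain z w where q: "rep_P1 q = (z, w)" by (cases "rep_P1 q")
  have nz: "(x, y) \<noteq> (0, 0)" "(z, w) \<noteq> (0, 0)"
    using rep_P1_nonzero[of p] rep_P1_nonzero[of q] by (simp_all add: p q)
  have xw: "x * w = y * z" using eq by (simp add: p q)
  have "\<exists>c. c \<noteq> 0 \<and> (z, w) = (c * x, c * y)"
  proof (cases "x = 0")
    case True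
    with nz xw show ?thesis by (intro exI[of _ "w / y"]) auto
  next
    case False
    with nz xw show ?thesis by (intro exI[of _ "z / x"]) (auto simp: field_simps)
  qed
  then have "proportional (rep_P1 p) (rep_P1 q)" using nz by (simp add: proportional_def p q)
  then show "p = q" using Quotient3_rel_rep[OF Quotient3_P1] by blast
qed (simp add: cross_self)

lemma form_mem_ideal_of: "f \<in> forms d \<Longrightarrow> f \<in> ideal_of X \<longleftrightarrow> (\<forall>p\<in>X. vanishes_at f p)"
  by (simp add: mem_ideal_of_iff vanishes_at_on_point)

lemma ideal_of_closed:
  "0 \<in> ideal_of X" "f \<in> ideal_of X \<Longrightarrow> g \<in> ideal_of X \<Longrightarrow> f + g \<in> ideal_of X"
  "f \<in> ideal_of X \<Longrightarrow> g \<in> ideal_of X \<Longrightarrow> f - g \<in> ideal_of X"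
  "f \<in> ideal_of X \<Longrightarrow> c * f \<in> ideal_of X" "f \<in> ideal_of X \<Longrightarrow> - f \<in> ideal_of X"
  by (simp_all add: mem_ideal_of_iff on_cone.hom_add on_cone.hom_mult on_cone.hom_minus on_cone.hom_uminus)

section \<open>Dimensions of the graded pieces of the coordinate ring\<close>

lemma vector_space_scalar: "vector_space (scalar :: 'k::field \<Rightarrow> _)"
  by unfold_locales
    (simp_all add: scalar_def single_add distrib_left distrib_right mult_single flip: mult.assoc)

lemma forms_scalar: "f \<in> forms d \<Longrightarrow> scalar c f \<in> forms d"
  by (simp add: scalar_def forms_Const_mult)

lemma forms_finite_span: "\<exists>T. finite T \<and> forms d \<subseteq> module.span (scalar :: 'k::field \<Rightarrow> _) T"
proof -
  interpret S: vector_space "scalar :: 'k \<Rightarrow> _" by (rule vector_space_scalar)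
  let ?N = "{..nat (fst d)} \<times> {..nat (fst d)} \<times> {..nat (snd d)} \<times> {..nat (snd d)}"
  let ?T = "(\<lambda>e. Poly_Mapping.single e (1 :: 'k)) ` ?N"
  have "f \<in> S.span ?T" if "f \<in> forms d" for f
  proof -
    have "Poly_Mapping.single e (Poly_Mapping.lookup f e) \<in> S.span ?T" if e: "e \<in> Poly_Mapping.keys f" for e
    proof -
      have "bidegree e = d" using e \<open>f \<in> forms d\<close> by (simp add: forms_def)
      then have "e \<in> ?N" by (cases e) auto
      then have "scalar (Poly_Mapping.lookup f e) (Poly_Mapping.single e 1) \<in> S.span ?T"
        by (intro S.span_scale S.span_base) blast
      then show ?thesis by (simp add: scalar_def mult_single)
    qed
    then have "(\<Sum>e\<in>Poly_Mapping.keys f. Poly_Mapping.single e (Poly_Mapping.lookup f e)) \<in> S.span ?T"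
      by (intro S.span_sum)
    then show ?thesis by (simp add: sum_single)
  qed
  then show ?thesis by (intro exI[of _ ?T]) auto
qed

lemma ex1_eqD: "\<exists>!x. P x \<Longrightarrow> P a \<Longrightarrow> P b \<Longrightarrow> a = b"
  by blast

text \<open>Linear independence modulo the ideal, read off from uniqueness of the expansion of the
  zero form.\<close>

lemma residue_basis_sum_unique:
  assumes B: "residue_basis (ideal_of X) d B" and f: "(\<Sum>b\<in>B. scalar (c b) b) \<in> ideal_of X" and b: "b \<in> B"
  shows "c b = 0"
proof -
  \<comment> \<open>The uniqueness concerns coefficient functions that vanish off \<open>B\<close>,
    so \<open>c\<close> is first cut down to \<open>B\<close>.\<close>
  define c' where "c' x = (if x \<in> B then c x else 0)" for x
  have eq: "(\<Sum>b\<in>B. scalar (c' b) b) = (\<Sum>b\<in>B. scalar (c b) b)"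
    by (intro sum.cong refl) (simp add: c'_def)
  have ex1: "\<exists>!c. (\<forall>b. b \<notin> B \<longrightarrow> c b = 0) \<and> 0 - (\<Sum>b\<in>B. scalar (c b) b) \<in> ideal_of X"
    using B forms_0[of d] unfolding residue_basis_def by blast
  have p1: "(\<forall>b. b \<notin> B \<longrightarrow> c' b = 0) \<and> 0 - (\<Sum>b\<in>B. scalar (c' b) b) \<in> ideal_of X"
    using ideal_of_closed(5)[OF f] by (simp add: eq) (simp add: c'_def)
  have p2: "(\<forall>b. b \<notin> B \<longrightarrow> (\<lambda>_. 0) b = (0::'a)) \<and> 0 - (\<Sum>b\<in>B. scalar ((\<lambda>_. 0) b) b) \<in> ideal_of X"
    by (simp add: scalar_def ideal_of_closed)
  let ?P = "\<lambda>c. (\<forall>b. b \<notin> B \<longrightarrow> c b = 0) \<and> 0 - (\<Sum>b\<in>B. scalar (c b) b) \<in> ideal_of X"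
  have "c' = (\<lambda>_. 0)" using ex1 p1 p2 by (rule ex1_eqD[where P = ?P])
  then show ?thesis using b by (metis c'_def)
qed

text \<open>Both residue bases are completed to bases of the space of forms by one and the same
  basis \<open>K\<close> of the forms in the ideal. As the space is finite dimensional, the
  cardinalities agree.\<close>

lemma residue_basis_card_unique:
  fixes X :: "'k::field quadric"
  assumes "residue_basis (ideal_of X) d B" "residue_basis (ideal_of X) d B'"
  shows "card B = card B'"
proof -
  interpret S: vector_space "scalar :: 'k \<Rightarrow> _" by (rule vector_space_scalar)
  define W where "W = ideal_of X \<inter> forms d"
  obtain T where T: "finite T" "forms d \<subseteq> S.span T" using forms_finite_span by blast
  obtain K where K: "K \<subseteq> W" "S.independent K" "W \<subseteq> S.span K"
    using S.maximal_independent_subset by blast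
  have "finite K"
    using S.independent_span_bound[OF T(1) K(2)] K(1) T(2) by (auto simp: W_def)
  have card_eq: "finite (B \<union> K) \<and> S.independent (B \<union> K) \<and> forms d \<subseteq> S.span (B \<union> K) \<and> B \<union> K \<subseteq> forms d \<and>
      card (B \<union> K) = card B + card K" if B: "residue_basis (ideal_of X) d B" for B
  proof -
    have fin: "finite B" and Bf: "B \<subseteq> forms d" using B by (auto simp: residue_basis_def)
    have disj: "B \<inter> K = {}"
    proof (rule ccontr)
      assume "B \<inter> K \<noteq> {}"
      then obtain b where b: "b \<in> B" "b \<in> ideal_of X" using K(1) by (auto simp: W_def)
      have "(\<Sum>x\<in>B. scalar (if x = b then 1 else 0) x) = (\<Sum>x\<in>B. if x = b then b else 0)"
        by (intro sum.cong refl) (simp add: scalar_def)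
      also have "\<dots> = b" using fin b(1) by (simp add: sum.delta)
      finally have "(\<Sum>x\<in>B. scalar (if x = b then 1 else 0) x) \<in> ideal_of X" using b(2) by simp
      from residue_basis_sum_unique[OF B this b(1)] show False by simp
    qed
    have "S.independent (B \<union> K)"
    proof
      assume dep: "S.dependent (B \<union> K)"
      have "finite (B \<union> K)" using fin \<open>finite K\<close> by simp
      from S.dependent_finite[OF this, THEN iffD1, OF dep] obtain c where c: "\<exists>x\<in>B \<union> K. c x \<noteq> 0" "(\<Sum>x\<in>B \<union> K. scalar (c x) x) = 0"
        by blast
      have split: "(\<Sum>x\<in>B. scalar (c x) x) + (\<Sum>x\<in>K. scalar (c x) x) = 0"
        using c(2) by (simp add: sum.union_disjoint[OF fin \<open>finite K\<close> disj])
      have "(\<Sum>x\<in>K. scalar (c x) x) \<in> ideal_of X"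
      proof -
        have "\<And>x. x \<in> K \<Longrightarrow> scalar (c x) x \<in> ideal_of X"
          using K(1) by (auto simp: W_def scalar_def intro: ideal_of_closed)
        then show ?thesis unfolding ideal_of_def by (intro generated_ideal_sum) auto
      qed
      then have "- (\<Sum>x\<in>K. scalar (c x) x) \<in> ideal_of X" by (rule ideal_of_closed(5))
      moreover have "(\<Sum>x\<in>B. scalar (c x) x) = - (\<Sum>x\<in>K. scalar (c x) x)"
        using split by (simp add: eq_neg_iff_add_eq_0)
      ultimately have "(\<Sum>x\<in>B. scalar (c x) x) \<in> ideal_of X" by simp
      then have cB: "c x = 0" if "x \<in> B" for x using residue_basis_sum_unique[OF B] that by blast
      then have "(\<Sum>x\<in>B. scalar (c x) x) = 0" by (simp add: scalar_def)
      then have "(\<Sum>x\<in>K. scalar (c x) x) = 0" using split by simp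
      then have "\<forall>x\<in>K. c x = 0" using K(2) S.dependent_finite[OF \<open>finite K\<close>] by blast
      with cB c(1) show False by blast
    qed
    moreover have "f \<in> S.span (B \<union> K)" if f: "f \<in> forms d" for f
    proof -
      obtain c where c: "f - (\<Sum>b\<in>B. scalar (c b) b) \<in> ideal_of X"
        using B f unfolding residue_basis_def by blast
      have "f - (\<Sum>b\<in>B. scalar (c b) b) \<in> forms d"
        using f Bf by (intro forms_diff forms_sum forms_scalar) auto
      then have "f - (\<Sum>b\<in>B. scalar (c b) b) \<in> S.span (B \<union> K)"
        using c K(3) S.span_mono[of K "B \<union> K"] by (auto simp: W_def)
      moreover have "(\<Sum>b\<in>B. scalar (c b) b) \<in> S.span (B \<union> K)"
        by (intro S.span_sum S.span_scale S.span_base) simp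
      ultimately have "(f - (\<Sum>b\<in>B. scalar (c b) b)) + (\<Sum>b\<in>B. scalar (c b) b) \<in> S.span (B \<union> K)"
        by (rule S.span_add)
      then show ?thesis by simp
    qed
    ultimately show ?thesis
      using fin \<open>finite K\<close> Bf K(1) disj by (auto simp: card_Un_disjoint W_def)
  qed
  note 1 = card_eq[OF assms(1)] and 2 = card_eq[OF assms(2)]
  have "card (B \<union> K) \<le> card (B' \<union> K)"
    using S.independent_span_bound[of "B' \<union> K" "B \<union> K"] 1 2 by blast
  moreover have "card (B' \<union> K) \<le> card (B \<union> K)"
    using S.independent_span_bound[of "B \<union> K" "B' \<union> K"] 1 2 by blast
  ultimately show ?thesis using 1 2 by linarith
qed

lemma hilbert_function_eq:
  assumes "residue_basis (ideal_of X) (i, j) B"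
  shows "hilbert_function X i j = int (card B)"
  unfolding hilbert_function_def
proof (rule the_equality)
  fix n assume "\<exists>B. residue_basis (ideal_of X) (i, j) B \<and> n = int (card B)"
  then obtain B' where "residue_basis (ideal_of X) (i, j) B'" "n = int (card B')" by blast
  then show "n = int (card B)" using residue_basis_card_unique[OF assms] by simp
qed (use assms in blast)

text \<open>The existence of a separator of \<open>p\<close> from \<open>Y\<close> in degree
  \<open>d\<close>.\<close>

definition separable :: "'k::field quadric \<Rightarrow> bideg \<Rightarrow> 'k P1 \<times> 'k P1 \<Rightarrow> bool" where
  "separable Y d p \<longleftrightarrow> (\<exists>f\<in>forms d. (\<forall>q\<in>Y. vanishes_at f q) \<and> \<not> vanishes_at f p)"

lemma residue_basis_empty: "residue_basis (ideal_of {}) d {}"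
  by (auto simp: residue_basis_def mem_ideal_of_iff intro!: ex1I[of _ "\<lambda>_. 0"])

text \<open>Vanishing at the new point is one linear condition on the forms vanishing on
  \<open>Y\<close>. It is nontrivial exactly if a separator exists, and then the separator enlarges
  the basis.\<close>

lemma residue_basis_insert:
  fixes Y :: "'k::field quadric"
  assumes B: "residue_basis (ideal_of Y) d B"
  shows "\<exists>B'. residue_basis (ideal_of (insert p Y)) d B' \<and>
    card B' = card B + (if separable Y d p then 1 else 0)"
proof (cases "separable Y d p")
  case False
  have eq: "g \<in> ideal_of (insert p Y) \<longleftrightarrow> g \<in> ideal_of Y" if "g \<in> forms d" for g
    using False that by (auto simp: form_mem_ideal_of[OF that] separable_def)
  have "f - (\<Sum>b\<in>B. scalar (c b) b) \<in> forms d" if "f \<in> forms d" for f c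
    using that B by (intro forms_diff forms_sum forms_scalar) (auto simp: residue_basis_def)
  then have "residue_basis (ideal_of (insert p Y)) d B"
    using B by (simp add: residue_basis_def eq)
  then show ?thesis using False by auto
next
  case True
  then obtain f where f: "f \<in> forms d" "\<And>q. q \<in> Y \<Longrightarrow> vanishes_at f q" "\<not> vanishes_at f p"
    by (auto simp: separable_def)
  define ev where "ev g = eval_bipoly g (rep_P1 (fst p)) (rep_P1 (snd p))" for g :: "'k bipoly"
  have ev: "ev (g - g') = ev g - ev g'" "ev (scalar c g) = c * ev g" for g g' c
    by (simp_all add: ev_def eval.hom_minus scalar_def eval.hom_mult eval_vars)
  have ev_f: "ev f \<noteq> 0" using f(3) by (simp add: ev_def vanishes_at_def)
  have mem_insert: "g \<in> ideal_of (insert p Y) \<longleftrightarrow> g \<in> ideal_of Y \<and> ev g = 0" if "g \<in> forms d" for g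
    by (auto simp: form_mem_ideal_of[OF that] vanishes_at_def ev_def)
  have fin: "finite B" and Bf: "B \<subseteq> forms d" using B by (auto simp: residue_basis_def)
  have f_mem: "f \<in> ideal_of Y" using f by (simp add: form_mem_ideal_of[OF f(1)])
  have "f \<notin> B"
  proof
    assume fB: "f \<in> B"
    have "(\<Sum>x\<in>B. scalar (if x = f then 1 else 0) x) = (\<Sum>x\<in>B. if x = f then f else 0)"
      by (intro sum.cong refl) (simp add: scalar_def)
    also have "\<dots> = f" using fin fB by (simp add: sum.delta)
    finally have "(\<Sum>x\<in>B. scalar (if x = f then 1 else 0) x) \<in> ideal_of Y" using f_mem by simp
    from residue_basis_sum_unique[OF B this fB] show False by simp
  qed
  have sum_forms: "g - (\<Sum>b\<in>B. scalar (c b) b) \<in> forms d" if "g \<in> forms d" for g c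
    using that Bf by (intro forms_diff forms_sum forms_scalar) auto
  have "residue_basis (ideal_of (insert p Y)) d (insert f B)"
    unfolding residue_basis_def
  proof (intro conjI ballI)
    fix g :: "'k bipoly" assume g: "g \<in> forms d"
    let ?P = "\<lambda>c. (\<forall>b. b \<notin> B \<longrightarrow> c b = 0) \<and> g - (\<Sum>b\<in>B. scalar (c b) b) \<in> ideal_of Y"
    have ex1: "\<exists>!c. ?P c" using B g by (simp add: residue_basis_def)
    define c where "c = (THE c. ?P c)"
    have Pc: "?P c" unfolding c_def by (rule theI'[OF ex1])
    have c: "\<And>b. b \<notin> B \<Longrightarrow> c b = 0" "g - (\<Sum>b\<in>B. scalar (c b) b) \<in> ideal_of Y" using Pc by simp_all
    have c_unique: "c' = c" if "?P c'" for c' using ex1 that Pc by (rule ex1_eqD[where P = ?P])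
    define R where "R = g - (\<Sum>b\<in>B. scalar (c b) b)"
    have R: "R \<in> forms d" unfolding R_def by (rule sum_forms[OF g])
    have sum_insert: "g - (\<Sum>b\<in>insert f B. scalar (c' b) b) =
        (g - (\<Sum>b\<in>B. scalar (c' b) b)) - scalar (c' f) f" for c'
      using fin \<open>f \<notin> B\<close> by (simp add: algebra_simps)
    have upd: "(\<Sum>b\<in>B. scalar ((c'(f := x)) b) b) = (\<Sum>b\<in>B. scalar (c' b) b)" for c' x
      using \<open>f \<notin> B\<close> by (intro sum.cong refl) auto
    show "\<exists>!c. (\<forall>b. b \<notin> insert f B \<longrightarrow> c b = 0) \<and>
        g - (\<Sum>b\<in>insert f B. scalar (c b) b) \<in> ideal_of (insert p Y)"
    \<comment> \<open>The old expansion leaves a remainder \<open>R\<close> vanishing on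
      \<open>Y\<close>; the coefficient of the separator is the one that cancels the value of
      \<open>R\<close> at \<open>p\<close>.\<close>
    proof (rule ex1I[of _ "c(f := ev R / ev f)"], intro conjI)
      show "\<forall>b. b \<notin> insert f B \<longrightarrow> (c(f := ev R / ev f)) b = 0" using c(1) by simp
      have "R - scalar (ev R / ev f) f \<in> forms d" using R f(1) by (intro forms_diff forms_scalar)
      moreover have "R - scalar (ev R / ev f) f \<in> ideal_of Y"
        using c(2)[folded R_def] f_mem unfolding scalar_def
        by (intro ideal_of_closed(3)[OF _ ideal_of_closed(4)])
      moreover have "ev (R - scalar (ev R / ev f) f) = 0" using ev_f by (simp add: ev)
      ultimately show "g - (\<Sum>b\<in>insert f B. scalar ((c(f := ev R / ev f)) b) b) \<in> ideal_of (insert p Y)"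
        unfolding sum_insert upd by (simp add: mem_insert R_def[symmetric])
    next
      fix c' assume c': "(\<forall>b. b \<notin> insert f B \<longrightarrow> c' b = 0) \<and>
        g - (\<Sum>b\<in>insert f B. scalar (c' b) b) \<in> ideal_of (insert p Y)"
      define R' where "R' = g - (\<Sum>b\<in>B. scalar (c' b) b)"
      have "R' - scalar (c' f) f \<in> forms d"
        unfolding R'_def using f(1) sum_forms[OF g] by (intro forms_diff[OF _ forms_scalar])
      then have R': "R' - scalar (c' f) f \<in> ideal_of Y" "ev (R' - scalar (c' f) f) = 0"
        using c' unfolding sum_insert R'_def[symmetric] by (simp_all add: mem_insert)
      have "(R' - scalar (c' f) f) + scalar (c' f) f \<in> ideal_of Y"
        using R'(1) f_mem unfolding scalar_def by (intro ideal_of_closed(2)[OF _ ideal_of_closed(4)])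
      then have "R' \<in> ideal_of Y" by simp
      then have "g - (\<Sum>b\<in>B. scalar ((c'(f := 0)) b) b) \<in> ideal_of Y"
        unfolding upd R'_def .
      moreover have "\<forall>b. b \<notin> B \<longrightarrow> (c'(f := 0)) b = 0" using c' by simp
      ultimately have c_eq: "c'(f := 0) = c" by (intro c_unique conjI)
      have "R' = R" unfolding R_def R'_def c_eq[symmetric] upd ..
      then have "c' f = ev R / ev f" using R'(2) ev_f by (simp add: ev field_simps)
      then show "c' = c(f := ev R / ev f)" using c_eq by auto
    qed
  qed (use fin f Bf in auto)
  then show ?thesis using True fin \<open>f \<notin> B\<close> by (intro exI[of _ "insert f B"]) simp
qed

lemma residue_basis_exists: "finite X \<Longrightarrow> \<exists>B. residue_basis (ideal_of X) d B"
  by (induction X rule: finite_induct) (use residue_basis_empty residue_basis_insert in blast)+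

lemma hilbert_function_empty: "hilbert_function {} i j = 0"
  using hilbert_function_eq[OF residue_basis_empty] by simp

lemma hilbert_function_insert:
  assumes "finite Y"
  shows "hilbert_function (insert p Y) i j = hilbert_function Y i j + of_bool (separable Y (i, j) p)"
proof -
  obtain B where B: "residue_basis (ideal_of Y) (i, j) B" using residue_basis_exists[OF assms] by blast
  obtain B' where B': "residue_basis (ideal_of (insert p Y)) (i, j) B'"
    "card B' = card B + (if separable Y (i, j) p then 1 else 0)"
    using residue_basis_insert[OF B] by blast
  show ?thesis using hilbert_function_eq[OF B] hilbert_function_eq[OF B'(1)] B'(2) by simp
qed

section \<open>Separators and Hilbert functions on a grid of points\<close>

locale grid =
  fixes a :: nat and u v :: "nat \<Rightarrow> 'k::field P1" and lam :: "nat \<Rightarrow> nat"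
  assumes u_inj: "i \<le> a \<Longrightarrow> i' \<le> a \<Longrightarrow> u i = u i' \<Longrightarrow> i = i'"
    and v_inj: "j < lam 0 \<Longrightarrow> j' < lam 0 \<Longrightarrow> v j = v j' \<Longrightarrow> j = j'"
    and lam_antimono: "i \<le> i' \<Longrightarrow> lam i' \<le> lam i"
    and lam_eq_0: "a < i \<Longrightarrow> lam i = 0"

sublocale grid \<subseteq> staircase a "\<lambda>i. rep_P1 (u i)" "\<lambda>j. rep_P1 (v j)" lam
  by unfold_locales
    (use rep_P1_nonzero u_inj v_inj lam_antimono lam_eq_0 in \<open>auto simp: cross_rep_P1\<close>)

context grid
begin

definition pt :: "nat \<Rightarrow> nat \<Rightarrow> 'k P1 \<times> 'k P1" where
  "pt i j = (u i, v j)"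

definition cells :: "(nat \<times> nat) set" where
  "cells = {(i, j). j < lam i}"

definition points :: "(nat \<times> nat) set \<Rightarrow> 'k quadric" where
  "points L = (\<lambda>(i, j). pt i j) ` L"

text \<open>The common shape of the generators of the staircase and of the separators; it makes all
  of them visibly products of lines.\<close>

definition box :: "nat set \<Rightarrow> nat set \<Rightarrow> 'k bipoly" where
  "box A B = (\<Prod>i\<in>A. alpha (rep_P1 (u i))) * (\<Prod>j\<in>B. beta (rep_P1 (v j)))"

lemma finite_cells: "finite cells"
  by (rule finite_subset[of _ "{..a} \<times> {..<lam 0}"]) (auto simp: cells_def dest: lt_lam)

lemma pt_inj: "i \<le> a \<Longrightarrow> i' \<le> a \<Longrightarrow> j < lam 0 \<Longrightarrow> j' < lam 0 \<Longrightarrow> pt i j = pt i' j' \<longleftrightarrow> i = i' \<and> j = j'"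
  using u_inj v_inj by (auto simp: pt_def)

lemma forms_box: "box A B \<in> forms (int (card A), int (card B))"
  using forms_mult[OF forms_prod_x[of A "\<lambda>i. alpha (rep_P1 (u i))"] forms_prod_y[of B "\<lambda>j. beta (rep_P1 (v j))"]]
  by (simp add: box_def forms_alpha forms_beta)

lemma box_vanishes: "finite A \<Longrightarrow> finite B \<Longrightarrow> i \<in> A \<or> j \<in> B \<Longrightarrow> on_point (pt i j) (box A B) = 0"
  by (auto simp: box_def pt_def on_cone.hom_mult on_cone_prod_eq_0[of _ i] on_cone_prod_eq_0[of _ j] on_cone_self)

lemma box_nonzero:
  assumes "A \<subseteq> {..a}" "i \<le> a" "i \<notin> A" "B \<subseteq> {..<lam 0}" "j < lam 0" "j \<notin> B"
  shows "eval_bipoly (box A B) (rep_P1 (u i)) (rep_P1 (v j)) \<noteq> 0"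
proof -
  have "finite A" "finite B" using assms finite_subset by blast+
  moreover have "cross (rep_P1 (u i)) (rep_P1 (u i')) \<noteq> 0" if "i' \<in> A" for i'
    using assms that by (intro U_cross) auto
  moreover have "cross (rep_P1 (v j)) (rep_P1 (v j')) \<noteq> 0" if "j' \<in> B" for j'
    using assms that by (intro V_cross) auto
  ultimately show ?thesis
    by (simp add: box_def eval.hom_mult eval.hom_prod eval_linear)
qed

text \<open>A factor that raises the degree of a separator without changing its value at the
  point.\<close>

definition unit_form :: "nat \<Rightarrow> nat \<Rightarrow> nat \<Rightarrow> nat \<Rightarrow> 'k bipoly" where
  "unit_form i j m n = linx (dual (rep_P1 (u i))) ^ m * liny (dual (rep_P1 (v j))) ^ n"

lemma forms_unit_form: "unit_form i j m n \<in> forms (int m, int n)"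
  using forms_mult[OF forms_power_x[OF forms_lin(1)] forms_power_y[OF forms_lin(2)]]
  by (simp add: unit_form_def)

lemma eval_unit_form: "eval_bipoly (unit_form i j m n) (rep_P1 (u i)) (rep_P1 (v j)) = 1"
  by (simp add: unit_form_def eval.hom_mult eval.hom_power eval_linear dual[OF rep_P1_nonzero])

lemma separator_degree:
  assumes f: "f \<in> forms (s, t)" "eval_bipoly f (rep_P1 (u i)) (rep_P1 (v j)) \<noteq> 0"
    and A: "A \<subseteq> {..a}" "\<And>i'. i' \<in> A \<Longrightarrow> on_point (pt i' j) f = 0"
    and B: "B \<subseteq> {..<lam 0}" "\<And>j'. j' \<in> B \<Longrightarrow> on_point (pt i j') f = 0"
  shows "int (card A) \<le> s" "int (card B) \<le> t"
proof -
  have fin: "finite A" "finite B" using A(1) B(1) finite_subset by blast+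
  show "int (card A) \<le> s"
    by (rule separator_degree_x[OF f rep_P1_nonzero fin(1), of "\<lambda>i. rep_P1 (u i)"])
      (use A U_cross in \<open>auto simp: pt_def subset_iff rep_P1_nonzero\<close>)
  show "int (card B) \<le> t"
    by (rule separator_degree_y[OF f rep_P1_nonzero fin(2), of "\<lambda>j. rep_P1 (v j)"])
      (use B V_cross in \<open>auto simp: pt_def subset_iff rep_P1_nonzero\<close>)
qed

text \<open>The factors of the box correspond to points of \<open>Y\<close> on the two lines through
  the given point, and each such point costs one degree. So the box is a separator of least degree,
  and \<open>unit_form\<close> reaches all larger degrees.\<close>

lemma separable_iff:
  assumes A: "A \<subseteq> {..a}" "i \<le> a" "i \<notin> A" and B: "B \<subseteq> {..<lam 0}" "j < lam 0" "j \<notin> B"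
    and Y: "\<And>i'. i' \<in> A \<Longrightarrow> pt i' j \<in> Y" "\<And>j'. j' \<in> B \<Longrightarrow> pt i j' \<in> Y"
    and van: "\<And>p. p \<in> Y \<Longrightarrow> on_point p (box A B) = 0"
  shows "separable Y (s, t) (pt i j) \<longleftrightarrow> int (card A) \<le> s \<and> int (card B) \<le> t"
proof
  assume "separable Y (s, t) (pt i j)"
  then obtain f where f: "f \<in> forms (s, t)" "\<And>p. p \<in> Y \<Longrightarrow> vanishes_at f p" "\<not> vanishes_at f (pt i j)"
    by (auto simp: separable_def)
  then have "\<And>p. p \<in> Y \<Longrightarrow> on_point p f = 0" by (simp add: vanishes_at_on_point)
  then show "int (card A) \<le> s \<and> int (card B) \<le> t"
    using separator_degree[of f s t i j A B] f A B Y by (auto simp: vanishes_at_def pt_def)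
next
  assume le: "int (card A) \<le> s \<and> int (card B) \<le> t"
  define f where "f = unit_form i j (nat (s - int (card A))) (nat (t - int (card B))) * box A B"
  have "f \<in> forms (s, t)"
    using forms_mult[OF forms_unit_form forms_box, of i j "nat (s - int (card A))" "nat (t - int (card B))" A B] le
    by (simp add: f_def)
  moreover have "vanishes_at f p" if "p \<in> Y" for p
    using van[OF that] vanishes_at_on_point[OF \<open>f \<in> forms (s, t)\<close>] by (simp add: f_def on_cone.hom_mult)
  moreover have "\<not> vanishes_at f (pt i j)"
    using box_nonzero[OF A B] by (simp add: vanishes_at_def pt_def f_def eval.hom_mult eval_unit_form)
  ultimately show "separable Y (s, t) (pt i j)" unfolding separable_def by blast
qed

text \<open>Remove the last cell \<open>(i, j)\<close> of the last row. It has \<open>i\<close>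
  remaining cells above it and \<open>j\<close> to its left, and every other cell lies in an earlier
  row or an earlier column. So it is separated exactly in the degrees above
  \<open>(i, j)\<close>.\<close>

lemma hilbert_function_points:
  assumes "finite L" "L \<subseteq> {..a} \<times> {..<lam 0}"
    and "\<And>i j i' j'. (i, j) \<in> L \<Longrightarrow> i' \<le> i \<Longrightarrow> j' \<le> j \<Longrightarrow> (i', j') \<in> L"
  shows "hilbert_function (points L) s t = (\<Sum>(i, j)\<in>L. of_bool (int i \<le> s \<and> int j \<le> t))"
  using assms
proof (induction "card L" arbitrary: L)
  case 0
  then show ?case by (simp add: points_def hilbert_function_empty)
next
  case (Suc n)
  then have "L \<noteq> {}" by auto
  define i where "i = Max (fst ` L)"
  have i: "i \<in> fst ` L" unfolding i_def using Suc.prems(1) \<open>L \<noteq> {}\<close> by (intro Max_in) auto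
  have i_max: "i' \<le> i" if "(i', j') \<in> L" for i' j'
    unfolding i_def using Suc.prems(1) that by (intro Max_ge) force+
  define Li where "Li = {j. (i, j) \<in> L}"
  have fin_Li: "finite Li"
    using finite_imageI[OF Suc.prems(1), of snd] by (rule finite_subset[rotated]) (force simp: Li_def)
  define j where "j = Max Li"
  have "j \<in> Li" unfolding j_def using fin_Li i by (intro Max_in) (auto simp: Li_def)
  then have ij: "(i, j) \<in> L" by (simp add: Li_def)
  have j_max: "j' \<le> j" if "(i, j') \<in> L" for j'
    unfolding j_def using fin_Li that by (intro Max_ge) (auto simp: Li_def)
  define L' where "L' = L - {(i, j)}"
  have card': "n = card L'" using Suc.hyps(2) Suc.prems(1) ij by (simp add: L'_def)
  have L': "finite L'" "L' \<subseteq> {..a} \<times> {..<lam 0}"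
    "\<And>i j i' j'. (i, j) \<in> L' \<Longrightarrow> i' \<le> i \<Longrightarrow> j' \<le> j \<Longrightarrow> (i', j') \<in> L'"
  proof -
    fix k l k' l' assume kl: "(k, l) \<in> L'" "k' \<le> k" "l' \<le> l"
    then have "(k', l') \<in> L" using Suc.prems(3)[of k l] by (auto simp: L'_def)
    moreover have "(k', l') \<noteq> (i, j)"
    proof
      assume "(k', l') = (i, j)"
      then have "k = i" using kl i_max[of k l] by (auto simp: L'_def)
      moreover then have "l = j" using kl j_max[of l] \<open>(k', l') = (i, j)\<close> by (auto simp: L'_def)
      ultimately show False using kl by (simp add: L'_def)
    qed
    ultimately show "(k', l') \<in> L'" by (simp add: L'_def)
  qed (use Suc.prems in \<open>auto simp: L'_def\<close>)
  have bounds: "i \<le> a" "j < lam 0" using ij Suc.prems(2) by auto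
  have L_eq: "points L = insert (pt i j) (points L')"
    using ij by (auto simp: points_def L'_def)
  have sep: "separable (points L') (s, t) (pt i j) \<longleftrightarrow> int (card {..<i}) \<le> s \<and> int (card {..<j}) \<le> t"
  proof (rule separable_iff)
    show "pt i' j \<in> points L'" if "i' \<in> {..<i}" for i'
      using that Suc.prems(3)[OF ij, of i' j] by (force simp: points_def L'_def)
    show "pt i j' \<in> points L'" if "j' \<in> {..<j}" for j'
      using that Suc.prems(3)[OF ij, of i j'] by (force simp: points_def L'_def)
    show "on_point p (box {..<i} {..<j}) = 0" if p: "p \<in> points L'" for p
    proof -
      obtain k l where kl: "(k, l) \<in> L'" "p = pt k l" using p by (auto simp: points_def)
      then have "(k, l) \<in> L" "(k, l) \<noteq> (i, j)" by (auto simp: L'_def)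
      then have "k < i \<or> l < j" using i_max[of k l] j_max[of l] by (cases "k = i") auto
      then show ?thesis unfolding kl(2) by (intro box_vanishes) auto
    qed
  qed (use bounds in auto)
  have "finite (points L')" using L'(1) by (simp add: points_def)
  then have "hilbert_function (points L) s t =
      hilbert_function (points L') s t + of_bool (int i \<le> s \<and> int j \<le> t)"
    unfolding L_eq by (simp add: hilbert_function_insert sep)
  also have "hilbert_function (points L') s t = (\<Sum>(i, j)\<in>L'. of_bool (int i \<le> s \<and> int j \<le> t))"
    by (rule Suc.hyps(1)[OF card' L'])
  also have "\<dots> + of_bool (int i \<le> s \<and> int j \<le> t) = (\<Sum>(i, j)\<in>L. of_bool (int i \<le> s \<and> int j \<le> t))"
    using sum.remove[OF Suc.prems(1) ij, of "\<lambda>(i, j). of_bool (int i \<le> s \<and> int j \<le> t) :: int"]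
    by (simp add: L'_def)
  finally show ?case .
qed

lemma hilbert_function_cells:
  "hilbert_function (points cells) s t = (\<Sum>(i, j)\<in>cells. of_bool (int i \<le> s \<and> int j \<le> t))"
proof (rule hilbert_function_points[OF finite_cells])
  show "cells \<subseteq> {..a} \<times> {..<lam 0}" by (auto simp: cells_def dest: lt_lam)
  show "(i', j') \<in> cells" if "(i, j) \<in> cells" "i' \<le> i" "j' \<le> j" for i j i' j'
    using that lam_antimono[of i' i] by (auto simp: cells_def)
qed

text \<open>The diagram as a set of bidegrees. The sign conditions are needed because
  \<open>nat\<close> would send negative degrees to row or column 0.\<close>

definition cell :: "int \<Rightarrow> int \<Rightarrow> bool" where
  "cell i j \<longleftrightarrow> 0 \<le> i \<and> 0 \<le> j \<and> nat j < lam (nat i)"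

lemma of_bool_difference:
  "of_bool (m \<le> i \<and> n \<le> j) - of_bool (m \<le> i - 1 \<and> n \<le> j) - of_bool (m \<le> i \<and> n \<le> j - 1)
    + of_bool (m \<le> i - 1 \<and> n \<le> j - 1) = (of_bool (i = m \<and> j = n) :: int)" for i j m n :: int
  by (auto simp: of_bool_def)

text \<open>Each cell contributes the indicator of a quadrant of degrees, whose mixed difference is
  concentrated at the corner of the quadrant.\<close>

lemma first_difference_cells: "first_difference (points cells) i j = of_bool (cell i j)"
proof -
  have "first_difference (points cells) i j = (\<Sum>(k, l)\<in>cells. of_bool (i = int k \<and> j = int l))"
    unfolding first_difference_def hilbert_function_cells sum_subtractf[symmetric] sum.distrib[symmetric]
    by (intro sum.cong refl) (simp only: split_beta of_bool_difference)
  also have "\<dots> = (\<Sum>e\<in>cells. if e = (nat i, nat j) then of_bool (0 \<le> i \<and> 0 \<le> j) else 0)"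
    by (intro sum.cong refl) auto
  also have "\<dots> = of_bool (cell i j)"
    using finite_cells by (auto simp: sum.delta cell_def cells_def)
  finally show ?thesis .
qed

lemma ideal_of_cells: "ideal_of (points cells) = stair_ideal"
  by (auto simp: mem_ideal_of_iff stair_ideal_def points_def cells_def pt_def)

end

section \<open>Removed points, their separators and the ideal of the rest\<close>

locale removed_points = grid +
  fixes h :: nat and ii jj p q :: "nat \<Rightarrow> nat"
  assumes removed: "l < h \<Longrightarrow> jj l < lam (ii l)"
    and ii_inj: "inj_on ii {..<h}" and jj_inj: "inj_on jj {..<h}"
    and q_def: "l < h \<Longrightarrow> Suc (q l) = card {i. jj l < lam i}"
    and p_def: "l < h \<Longrightarrow> Suc (p l) = lam (ii l)"
begin

definition "X = points cells"
definition "removed_pt l = pt (ii l) (jj l)"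
definition "Z = X - removed_pt ` {..<h}"
text \<open>Row forms are the factors of degree \<open>(1, 0)\<close>, so the first degree of the
  separator counts the other points in the column of the removed point, and the second those in its
  row.\<close>

definition "row_rest l = {i. jj l < lam i} - {ii l}"
definition "col_rest l = {..<lam (ii l)} - {jj l}"
definition "sep l = box (row_rest l) (col_rest l)"

lemma row_rest: "l < h \<Longrightarrow> row_rest l \<subseteq> {..a}" "l < h \<Longrightarrow> card (row_rest l) = q l" "finite (row_rest l)"
proof -
  have fin: "finite {i. jj l < lam i}" by (rule finite_subset[of _ "{..a}"]) (auto dest: lt_lam)
  then show "finite (row_rest l)" by (simp add: row_rest_def)
  show "l < h \<Longrightarrow> row_rest l \<subseteq> {..a}" by (auto simp: row_rest_def dest: lt_lam)
  show "l < h \<Longrightarrow> card (row_rest l) = q l"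
    using card_Diff_singleton[of "ii l" "{i. jj l < lam i}"] removed[of l] q_def[of l] by (simp add: row_rest_def)
qed

lemma col_rest: "l < h \<Longrightarrow> col_rest l \<subseteq> {..<lam 0}" "l < h \<Longrightarrow> card (col_rest l) = p l" "finite (col_rest l)"
proof -
  show "finite (col_rest l)" by (simp add: col_rest_def)
  show "l < h \<Longrightarrow> col_rest l \<subseteq> {..<lam 0}" by (auto simp: col_rest_def dest: lt_lam)
  show "l < h \<Longrightarrow> card (col_rest l) = p l"
    using card_Diff_singleton[of "jj l" "{..<lam (ii l)}"] removed[of l] p_def[of l] by (simp add: col_rest_def)
qed

lemma bounds: "l < h \<Longrightarrow> ii l \<le> a" "l < h \<Longrightarrow> jj l < lam 0"
  using removed lt_lam by blast+

lemma removed_pt_inj: "l < h \<Longrightarrow> l' < h \<Longrightarrow> removed_pt l = removed_pt l' \<longleftrightarrow> l = l'"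
  using bounds pt_inj[of "ii l" "ii l'" "jj l" "jj l'"] ii_inj by (auto simp: removed_pt_def inj_on_def)

lemma removed_pt_mem: "l < h \<Longrightarrow> removed_pt l \<in> X"
  using removed by (auto simp: X_def points_def removed_pt_def cells_def)

lemma finite_X: "finite X"
  using finite_cells by (simp add: X_def points_def)

lemma forms_sep: "l < h \<Longrightarrow> sep l \<in> forms (int (q l), int (p l))"
  using forms_box[of "row_rest l" "col_rest l"] row_rest col_rest by (simp add: sep_def)

lemma sep_nonzero:
  "l < h \<Longrightarrow> eval_bipoly (sep l) (rep_P1 (u (ii l))) (rep_P1 (v (jj l))) \<noteq> 0"
  unfolding sep_def using row_rest col_rest bounds by (intro box_nonzero) (auto simp: row_rest_def col_rest_def)

lemma sep_vanishes:
  assumes "l < h" "x \<in> X" "x \<noteq> removed_pt l"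
  shows "on_point x (sep l) = 0"
proof -
  obtain i j where ij: "j < lam i" "x = pt i j" using assms(2) by (auto simp: X_def points_def cells_def)
  have "i \<in> row_rest l \<or> j \<in> col_rest l"
  proof (cases "i = ii l")
    case True
    with ij assms(3) show ?thesis by (auto simp: col_rest_def removed_pt_def)
  next
    case False
    show ?thesis
    proof (cases "jj l < lam i")
      case True with False show ?thesis by (simp add: row_rest_def)
    next
      case False
      \<comment> \<open>A row too short to reach the column of the removed point has all its points
        in earlier columns, and these belong to \<open>col_rest\<close>.\<close>
      then have "j < jj l" using ij by simp
      with removed[OF assms(1)] show ?thesis by (simp add: col_rest_def)
    qed
  qed
  then show ?thesis unfolding sep_def ij(2) by (intro box_vanishes) (auto simp: row_rest col_rest)
qed

text \<open>Here distinctness of rows and columns is used: no other removed point lies on the two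
  lines through this one, so all points forcing the degree of a separator survive in
  \<open>Z\<close>.\<close>

lemma remaining:
  assumes "l < h"
  shows "i \<in> row_rest l \<Longrightarrow> pt i (jj l) \<in> Z" "j \<in> col_rest l \<Longrightarrow> pt (ii l) j \<in> Z"
proof -
  assume i: "i \<in> row_rest l"
  then have lt: "jj l < lam i" "i \<noteq> ii l" by (auto simp: row_rest_def)
  have "pt i (jj l) \<noteq> removed_pt l'" if "l' < h" for l'
    using pt_inj[of i "ii l'" "jj l" "jj l'"] lt lt_lam[OF lt(1)] bounds[OF that] inj_onD[OF jj_inj, of l l'] assms that
    by (auto simp: removed_pt_def)
  then show "pt i (jj l) \<in> Z" using lt(1) by (auto simp: Z_def X_def points_def cells_def)
next
  assume j: "j \<in> col_rest l"
  then have lt: "j < lam (ii l)" "j \<noteq> jj l" by (auto simp: col_rest_def)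
  have "pt (ii l) j \<noteq> removed_pt l'" if "l' < h" for l'
    using pt_inj[of "ii l" "ii l'" j "jj l'"] lt lt_lam[OF lt(1)] bounds[OF that] inj_onD[OF ii_inj, of l l'] assms that
    by (auto simp: removed_pt_def)
  then show "pt (ii l) j \<in> Z" using lt(1) by (auto simp: Z_def X_def points_def cells_def)
qed

text \<open>\<open>Y\<close> ranges between \<open>Z\<close> and the complement of the point so that
  the removed points can be put back one at a time, always with the same separator degrees.\<close>

lemma separable_removed_pt:
  assumes "l < h" "Z \<subseteq> Y" "Y \<subseteq> X - {removed_pt l}"
  shows "separable Y (s, t) (removed_pt l) \<longleftrightarrow> int (q l) \<le> s \<and> int (p l) \<le> t"
proof -
  have "separable Y (s, t) (pt (ii l) (jj l)) \<longleftrightarrow> int (card (row_rest l)) \<le> s \<and> int (card (col_rest l)) \<le> t"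
  proof (rule separable_iff)
    show "on_point x (box (row_rest l) (col_rest l)) = 0" if "x \<in> Y" for x
      using sep_vanishes[OF assms(1), of x] that assms(3) by (auto simp: sep_def)
  qed (use assms row_rest col_rest bounds remaining in \<open>auto simp: row_rest_def col_rest_def\<close>)
  then show ?thesis using assms(1) by (simp add: removed_pt_def row_rest col_rest)
qed

lemma hilbert_function_removed:
  "hilbert_function X s t = hilbert_function Z s t + (\<Sum>l<h. of_bool (int (q l) \<le> s \<and> int (p l) \<le> t))"
proof -
  have "hilbert_function (Z \<union> removed_pt ` {..<n}) s t =
      hilbert_function Z s t + (\<Sum>l<n. of_bool (int (q l) \<le> s \<and> int (p l) \<le> t))" if "n \<le> h" for n
    using that
  proof (induction n)
    case (Suc n)
    let ?Y = "Z \<union> removed_pt ` {..<n}"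
    have "finite ?Y" using finite_X by (simp add: Z_def)
    moreover have "?Y \<subseteq> X - {removed_pt n}"
      using Suc.prems removed_pt_mem removed_pt_inj[of _ n] by (fastforce simp: Z_def)
    then have "separable ?Y (s, t) (removed_pt n) \<longleftrightarrow> int (q n) \<le> s \<and> int (p n) \<le> t"
      using Suc.prems by (intro separable_removed_pt) auto
    moreover have "Z \<union> removed_pt ` {..<Suc n} = insert (removed_pt n) ?Y"
      by (auto simp: lessThan_Suc)
    ultimately show ?case using Suc by (simp add: hilbert_function_insert)
  qed simp
  from this[of h] have "hilbert_function (Z \<union> removed_pt ` {..<h}) s t =
      hilbert_function Z s t + (\<Sum>l<h. of_bool (int (q l) \<le> s \<and> int (p l) \<le> t))" by simp
  moreover have "Z \<union> removed_pt ` {..<h} = X" using removed_pt_mem by (auto simp: Z_def)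
  ultimately show ?thesis by simp
qed

lemma first_difference_removed:
  "first_difference Z i j = first_difference X i j - int (card {l \<in> {..<h}. (int (q l), int (p l)) = (i, j)})"
proof -
  have "first_difference X i j - first_difference Z i j = (\<Sum>l<h. of_bool (i = int (q l) \<and> j = int (p l)))"
  proof -
    let ?s = "\<lambda>i j. \<Sum>l<h. of_bool (int (q l) \<le> i \<and> int (p l) \<le> j) :: int"
    have "first_difference X i j - first_difference Z i j =
        ?s i j - ?s (i - 1) j - ?s i (j - 1) + ?s (i - 1) (j - 1)"
      by (simp add: first_difference_def hilbert_function_removed)
    also have "\<dots> = (\<Sum>l<h. of_bool (i = int (q l) \<and> j = int (p l)))"
      unfolding sum_subtractf[symmetric] sum.distrib[symmetric] of_bool_difference ..
    finally show ?thesis .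
  qed
  also have "\<dots> = int (card {l \<in> {..<h}. (int (q l), int (p l)) = (i, j)})"
    by (auto simp: sum_of_bool_eq intro!: arg_cong[of _ _ card])
  finally show ?thesis by simp
qed

lemma sep_mem: "l < h \<Longrightarrow> sep l \<in> ideal_of Z"
  using sep_vanishes by (auto simp: mem_ideal_of_iff Z_def)

text \<open>Interpolation: a form vanishing on \<open>Z\<close> is corrected by multiples of the
  separators that match its values at the removed points. The degree bound for separators makes this
  possible within the degree of the form.\<close>

lemma ideal_of_Z: "ideal_of Z = {f + (\<Sum>l<h. y l * sep l) |f y. f \<in> ideal_of X}" (is "_ = ?J")
proof (intro equalityI)
  show "ideal_of Z \<subseteq> ?J"
    unfolding ideal_of_def[of Z]
  proof (rule generated_ideal_least)
    show "{f. \<exists>d. f \<in> forms d \<and> (\<forall>x\<in>Z. vanishes_at f x)} \<subseteq> ?J"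
    proof
      fix f assume "f \<in> {f. \<exists>d. f \<in> forms d \<and> (\<forall>x\<in>Z. vanishes_at f x)}"
      then obtain d where d: "f \<in> forms d" "\<And>x. x \<in> Z \<Longrightarrow> vanishes_at f x" by blast
      obtain s t where "d = (s, t)" by (cases d)
      with d(1) have f1: "f \<in> forms (s, t)" by simp
      have f2: "on_point x f = 0" if "x \<in> Z" for x
        using d(2)[OF that] by (simp add: vanishes_at_on_point[OF d(1)])
      note f = f1 f2
      define ev where "ev l g = eval_bipoly g (rep_P1 (u (ii l))) (rep_P1 (v (jj l)))" for l and g :: "'a bipoly"
      \<comment> \<open>The constant matches the value of \<open>f\<close> at the removed point and
        \<open>unit_form\<close> supplies the missing degree. If that value is 0 then
        \<open>y l\<close> vanishes, whatever the truncations by \<open>nat\<close> produce.\<close>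
      define y where "y l = Const (ev l f / ev l (sep l)) *
        unit_form (ii l) (jj l) (nat (s - int (q l))) (nat (t - int (p l)))" for l
      have y_forms: "y l * sep l \<in> forms (s, t)" if l: "l < h" for l
      proof (cases "ev l f = 0")
        case True
        then show ?thesis by (simp add: y_def forms_0)
      next
        case False
        \<comment> \<open>A form not vanishing at the removed point is itself a separator from
          \<open>Z\<close>, so its degree is at least that of \<open>sep l\<close>.\<close>
        have "int (card (row_rest l)) \<le> s" "int (card (col_rest l)) \<le> t"
          using separator_degree[OF f(1), of "ii l" "jj l" "row_rest l" "col_rest l"] False remaining[OF l] f(2) row_rest(1)[OF l] col_rest(1)[OF l]
          by (auto simp: ev_def)
        then have "int (q l) \<le> s" "int (p l) \<le> t" using row_rest(2)[OF l] col_rest(2)[OF l] by auto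
        then show ?thesis
          using forms_mult[OF forms_Const_mult[OF forms_unit_form] forms_sep[OF l],
              of "ev l f / ev l (sep l)" "ii l" "jj l" "nat (s - int (q l))" "nat (t - int (p l))"]
          by (simp add: y_def)
      qed
      define e where "e = f - (\<Sum>l<h. y l * sep l)"
      have e: "e \<in> forms (s, t)" unfolding e_def using f(1) y_forms by (intro forms_diff forms_sum) auto
      have "e \<in> ideal_of X"
        unfolding form_mem_ideal_of[OF e]
      proof
        fix x assume x: "x \<in> X"
        show "vanishes_at e x"
        proof (cases "x \<in> Z")
          case True
          then have "on_point x (sep l) = 0" if "l < h" for l
            using sep_vanishes[OF that x] that by (auto simp: Z_def)
          then show ?thesis
            unfolding vanishes_at_on_point[OF e] using f(2)[OF True]
            by (simp add: e_def on_cone.hom_minus on_cone.hom_sum on_cone.hom_mult)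
        next
          case False
          then obtain k where k: "k < h" "x = removed_pt k" using x by (auto simp: Z_def)
          have other: "ev k (sep l) = 0" if "l < h" "l \<noteq> k" for l
            using sep_vanishes[OF that(1) x] that removed_pt_inj[of l k] k
              vanishes_at_on_point[OF forms_sep[OF that(1)], of x]
            by (auto simp: ev_def vanishes_at_def removed_pt_def pt_def)
          have "ev k e = ev k f - (\<Sum>l<h. ev k (y l * sep l))"
            by (simp add: e_def ev_def eval.hom_minus eval.hom_sum)
          also have "(\<Sum>l<h. ev k (y l * sep l)) = (\<Sum>l<h. if l = k then ev k f else 0)"
          proof (intro sum.cong refl)
            fix l assume l: "l \<in> {..<h}"
            show "ev k (y l * sep l) = (if l = k then ev k f else 0)"
            proof (cases "l = k")
              case True
              then show ?thesis
                using sep_nonzero[OF k(1)] by (simp add: y_def ev_def eval.hom_mult eval_vars eval_unit_form)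
            next
              case False
              then show ?thesis using other[of l] l by (simp add: ev_def eval.hom_mult)
            qed
          qed
          also have "ev k f - \<dots> = 0" using k(1) by simp
          finally show ?thesis by (simp add: vanishes_at_def k(2) removed_pt_def pt_def ev_def)
        qed
      qed
      then have "e + (\<Sum>l<h. y l * sep l) \<in> ?J" by blast
      then show "f \<in> ?J" by (simp add: e_def)
    qed
  next
    show "0 \<in> ?J"
      by (intro CollectI exI[of _ 0] exI[of _ "\<lambda>_. 0"]) (simp add: ideal_of_closed)
  next
    fix f g assume "f \<in> ?J" "g \<in> ?J"
    then obtain f' y g' z where eq: "f' \<in> ideal_of X" "f = f' + (\<Sum>l<h. y l * sep l)"
      "g' \<in> ideal_of X" "g = g' + (\<Sum>l<h. z l * sep l)" by blast
    have "f + g = (f' + g') + (\<Sum>l<h. (y l + z l) * sep l)"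
      by (simp add: eq sum.distrib algebra_simps)
    then show "f + g \<in> ?J" using ideal_of_closed(2)[OF eq(1,3)]
      by (intro CollectI exI[of _ "f' + g'"] exI[of _ "\<lambda>l. y l + z l"]) simp
  next
    fix c f assume "f \<in> ?J"
    then obtain f' y where eq: "f' \<in> ideal_of X" "f = f' + (\<Sum>l<h. y l * sep l)" by blast
    have "c * f = c * f' + (\<Sum>l<h. (c * y l) * sep l)"
      by (simp add: eq sum_distrib_left algebra_simps)
    then show "c * f \<in> ?J" using ideal_of_closed(4)[OF eq(1)]
      by (intro CollectI exI[of _ "c * f'"] exI[of _ "\<lambda>l. c * y l"]) simp
  qed
next
  show "?J \<subseteq> ideal_of Z"
  proof
    fix g assume "g \<in> ?J"
    then obtain f y where fy: "f \<in> ideal_of X" "g = f + (\<Sum>l<h. y l * sep l)" by blast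
    have "f \<in> ideal_of Z" using fy(1) by (auto simp: mem_ideal_of_iff Z_def)
    moreover have "(\<Sum>l<h. y l * sep l) \<in> ideal_of Z"
    proof -
      have "\<And>l. l \<in> {..<h} \<Longrightarrow> y l * sep l \<in> ideal_of Z" using sep_mem ideal_of_closed(4) by blast
      then show ?thesis unfolding ideal_of_def by (intro generated_ideal_sum) auto
    qed
    ultimately show "g \<in> ideal_of Z" unfolding fy(2) by (rule ideal_of_closed(2))
  qed
qed

text \<open>On the cone over the \<open>k\<close>-th removed point only the \<open>k\<close>-th
  summand survives, so \<open>y k\<close> vanishes there and lies in the ideal of the two
  lines.\<close>

lemma sep_colon:
  assumes "(\<Sum>l<h. y l * sep l) \<in> ideal_of X" "k < h"
  shows "\<exists>s t. y k = alpha (rep_P1 (u (ii k))) * s + beta (rep_P1 (v (jj k))) * t"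
proof (rule on_cone_eq_0_imp[OF rep_P1_nonzero rep_P1_nonzero])
  let ?H = "on_point (removed_pt k)"
  have "0 = ?H (\<Sum>l<h. y l * sep l)"
    using assms removed_pt_mem[OF assms(2)] by (simp add: mem_ideal_of_iff)
  also have "\<dots> = (\<Sum>l<h. if l = k then ?H (y k) * ?H (sep k) else 0)"
    unfolding on_cone.hom_sum on_cone.hom_mult
  proof (intro sum.cong refl)
    fix l assume l: "l \<in> {..<h}"
    then show "?H (y l) * ?H (sep l) = (if l = k then ?H (y k) * ?H (sep k) else 0)"
      using sep_vanishes[of l "removed_pt k"] removed_pt_mem[OF assms(2)] removed_pt_inj[of l k] assms(2) by auto
  qed
  also have "\<dots> = ?H (y k) * ?H (sep k)" using assms(2) by simp
  finally have "?H (y k) * ?H (sep k) = 0" by simp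
  moreover have "?H (sep k) \<noteq> 0"
    using sep_nonzero[OF assms(2)] vanishes_at_on_point[OF forms_sep[OF assms(2)], of "removed_pt k"]
    by (simp add: vanishes_at_def removed_pt_def pt_def)
  ultimately show "on_cone (rep_P1 (u (ii k))) (rep_P1 (v (jj k))) (y k) = 0"
    by (simp add: removed_pt_def pt_def)
qed

lemma line_mult_sep:
  assumes "l < h"
  shows "alpha (rep_P1 (u (ii l))) * sep l \<in> ideal_of X" "beta (rep_P1 (v (jj l))) * sep l \<in> ideal_of X"
proof -
  have "on_point x (alpha (rep_P1 (u (ii l)))) * on_point x (sep l) = 0 \<and>
      on_point x (beta (rep_P1 (v (jj l)))) * on_point x (sep l) = 0" if "x \<in> X" for x
    using sep_vanishes[OF assms that]
    by (cases "x = removed_pt l") (simp_all add: removed_pt_def pt_def on_cone_self)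
  then show "alpha (rep_P1 (u (ii l))) * sep l \<in> ideal_of X" "beta (rep_P1 (v (jj l))) * sep l \<in> ideal_of X"
    by (simp_all add: mem_ideal_of_iff on_cone.hom_mult)
qed

end

section \<open>Degrees of generators and syzygies\<close>

lemma exists_minimal_generating_subset:
  assumes "finite G" "generated_ideal G = I"
  shows "\<exists>H\<subseteq>G. minimal_generating_set H I"
  using assms
proof (induction G rule: finite_psubset_induct)
  case (psubset G)
  show ?case
  proof (cases "\<exists>H. H \<subset> G \<and> generated_ideal H = I")
    case True
    then obtain H where H: "H \<subset> G" "generated_ideal H = I" by blast
    from psubset.IH[OF this] obtain H' where "H' \<subseteq> H" "minimal_generating_set H' I" by blast
    with H(1) show ?thesis by (intro exI[of _ H']) auto
  next
    case False
    with psubset have "minimal_generating_set G I" by (simp add: minimal_generating_set_def)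
    then show ?thesis by blast
  qed
qed

context grid
begin

lemma box_splits:
  assumes "finite A" "finite B"
  shows "\<exists>fs. set fs \<subseteq> forms (1, 0) \<union> forms (0, 1) \<and> box A B = prod_list fs"
proof -
  let ?fs = "map (\<lambda>i. alpha (rep_P1 (u i))) (sorted_list_of_set A) @
    map (\<lambda>j. beta (rep_P1 (v j))) (sorted_list_of_set B)"
  have "box A B = prod_list ?fs"
    using assms by (simp add: box_def prod.distinct_set_conv_list[symmetric])
  moreover have "set ?fs \<subseteq> forms (1, 0) \<union> forms (0, 1)"
    by (auto simp: forms_alpha forms_beta)
  ultimately show ?thesis by blast
qed

lemma stair_form_box: "stair_form k = box {..<k} {..<lam k}"
  by (simp add: stair_form_def box_def)

text \<open>Generator degrees as minimal non-cells. On the axes one neighbour condition is void,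
  which accounts for the first generator \<open>k = 0\<close> and for the last one with
  \<open>j = 0\<close>.\<close>

lemma outer_corner_iff:
  "(i, j) \<in> {(int k, int (lam k)) |k. k \<le> Suc a \<and> (k = 0 \<or> lam k < lam (k - 1))} \<longleftrightarrow>
    \<not> cell i j \<and> (j = 0 \<or> cell i (j - 1)) \<and> (i = 0 \<or> cell (i - 1) j)" (is "?L \<longleftrightarrow> ?R")
proof
  assume ?L
  then obtain k where k: "i = int k" "j = int (lam k)" "k = 0 \<or> lam k < lam (k - 1)" by blast
  have "k = 0 \<or> nat (int k - 1) = k - 1" by auto
  with k show ?R by (auto simp: cell_def nat_diff_distrib)
next
  assume R: ?R
  have ij: "0 \<le> i" "0 \<le> j" using R by (auto simp: cell_def)
  define k where "k = nat i"
  have "lam k \<le> nat j" using R ij by (auto simp: cell_def k_def)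
  moreover have "nat j \<le> lam k" using R ij by (auto simp: cell_def k_def)
  ultimately have "j = int (lam k)" using ij by simp
  moreover have "k = 0 \<or> lam k < lam (k - 1) \<and> k \<le> Suc a"
  proof (cases "i = 0")
    case False
    then have "nat j < lam (nat (i - 1))" "1 \<le> i" using R by (auto simp: cell_def)
    moreover have "nat (i - 1) = k - 1" by (simp add: k_def nat_diff_distrib')
    ultimately show ?thesis using lt_lam(1)[of "nat j" "k - 1"] \<open>lam k \<le> nat j\<close> by auto
  qed (simp add: k_def)
  ultimately show ?L using ij by (intro CollectI exI[of _ k]) (auto simp: k_def)
qed

lemma inner_corner_iff:
  "(i, j) \<in> {(int k + 1, int (lam k)) |k. k \<le> a \<and> lam (Suc k) < lam k} \<longleftrightarrow>
    cell (i - 1) (j - 1) \<and> \<not> cell (i - 1) j \<and> \<not> cell i (j - 1)" (is "?L \<longleftrightarrow> ?R")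
proof
  assume ?L
  then obtain k where k: "i = int k + 1" "j = int (lam k)" "lam (Suc k) < lam k" by blast
  moreover have "nat (int k + 1) = Suc k" by simp
  moreover have "nat (int (lam k) - 1) = lam k - 1" by simp
  ultimately show ?R by (auto simp: cell_def)
next
  assume R: ?R
  have ij: "1 \<le> i" "1 \<le> j" using R by (auto simp: cell_def)
  define k where "k = nat (i - 1)"
  have k: "i = int k + 1" "nat i = Suc k" using ij by (auto simp: k_def)
  have "nat (j - 1) < lam k" "lam k \<le> nat j" "lam (Suc k) \<le> nat (j - 1)"
    using R ij k by (auto simp: cell_def)
  moreover from this have "j = int (lam k)" using ij by linarith
  ultimately show ?L using k lt_lam(1)[of "nat (j - 1)" k] by (intro CollectI exI[of _ k]) auto
qed

end

context removed_points
begin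

definition D :: "nat \<Rightarrow> bideg" where
  "D l = (int (q l), int (p l))"

text \<open>All coincidences of degrees contradict \<open>lam (q l) \<le> p l\<close>:
  \<open>(q, p + 1)\<close> in \<open>F0\<close> or \<open>(q + 1, p + 1)\<close> in
  \<open>F1\<close> would mean \<open>lam q = p + 1\<close>, and \<open>(q + 1, p)\<close> in
  \<open>F0\<close> would mean \<open>p = lam (q + 1) < lam q\<close>.\<close>

lemma resolution_Z:
  assumes res: "minimal_free_resolution (ideal_of X) F0 F1 []"
    and interior: "\<And>l. l < h \<Longrightarrow> lam (q l) \<le> p l"
  shows "minimal_free_resolution (ideal_of Z) (F0 @ map D [0..<h])
    (F1 @ (map (\<lambda>l. D l + (0, 1)) [0..<h] @ map (\<lambda>l. D l + (1, 0)) [0..<h]))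
    (map (\<lambda>l. D l + (1, 1)) [0..<h])"
proof (rule minimal_cone_of_points[OF res, where f = sep and
      \<alpha> = "\<lambda>l. alpha (rep_P1 (u (ii l)))" and \<beta> = "\<lambda>l. beta (rep_P1 (v (jj l)))"])
  note degs = stair_resolution_degrees[OF res[unfolded X_def ideal_of_cells]]
  show "sep l \<in> forms (D l)" if "l < h" for l using forms_sep[OF that] by (simp add: D_def)
  show "\<exists>c. t = alpha (rep_P1 (u (ii l))) * c \<and> s = - (beta (rep_P1 (v (jj l))) * c)"
    if "beta (rep_P1 (v (jj l))) * t + alpha (rep_P1 (u (ii l))) * s = 0" for l t s
    by (rule alpha_beta_regular[OF rep_P1_nonzero rep_P1_nonzero that])
  show "\<exists>s t. y l = alpha (rep_P1 (u (ii l))) * s + beta (rep_P1 (v (jj l))) * t"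
    if "(\<Sum>l<h. y l * sep l) \<in> ideal_of X" "l < h" for y l
    by (rule sep_colon[OF that])
  fix l assume l: "l < h"
  show "D l + (0, 1) \<notin> set F0" "D l + (1, 1) \<notin> set F1"
    using interior[OF l] unfolding degs D_def by auto
  show "D l + (1, 0) \<notin> set F0"
  proof
    assume "D l + (1, 0) \<in> set F0"
    then obtain k where k: "int (q l) + 1 = int k" "p l = lam k" "k = 0 \<or> lam k < lam (k - 1)"
      unfolding degs D_def by auto
    then have "k = Suc (q l)" by linarith
    with k interior[OF l] show False by simp
  qed
qed (simp_all add: forms_alpha forms_beta alpha_nonzero rep_P1_nonzero line_mult_sep ideal_of_Z)

text \<open>Stair forms and separators are boxes and together generate; an irredundant subset of
  them still consists of products of lines.\<close>

lemma split_generators: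
  "\<exists>G. minimal_generating_set G (ideal_of Z) \<and>
    (\<forall>g \<in> G. \<exists>fs. set fs \<subseteq> forms (1, 0) \<union> forms (0, 1) \<and> g = prod_list fs)"
proof -
  define G where "G = stair_form ` {..Suc a} \<union> sep ` {..<h}"
  have "generated_ideal G = ideal_of Z"
  proof (rule equalityI)
    have "stair_form k \<in> ideal_of Z" for k
      using stair_form_mem[of k] unfolding ideal_of_cells[symmetric] by (auto simp: mem_ideal_of_iff Z_def X_def)
    then show "generated_ideal G \<subseteq> ideal_of Z"
      using sep_mem by (intro generated_ideal_least) (auto simp: G_def ideal_of_closed)
    show "ideal_of Z \<subseteq> generated_ideal G"
    proof
      fix f assume "f \<in> ideal_of Z"
      then obtain g y where gy: "g \<in> stair_ideal" "f = g + (\<Sum>l<h. y l * sep l)"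
        unfolding ideal_of_Z X_def ideal_of_cells by blast
      obtain w where w: "g = (\<Sum>k\<le>Suc a. w k * stair_form k)" using stair_ideal_generated[OF gy(1)] by blast
      have "g \<in> generated_ideal G"
        unfolding w by (intro generated_ideal_sum generated_ideal_mult generated_ideal_base) (simp add: G_def)
      moreover have "(\<Sum>l<h. y l * sep l) \<in> generated_ideal G"
        by (intro generated_ideal_sum generated_ideal_mult generated_ideal_base) (simp add: G_def)
      ultimately show "f \<in> generated_ideal G" unfolding gy(2) by (rule generated_ideal_add)
    qed
  qed
  moreover have "finite G" by (simp add: G_def)
  ultimately obtain H where H: "H \<subseteq> G" "minimal_generating_set H (ideal_of Z)"
    using exists_minimal_generating_subset by blast
  have "\<exists>fs. set fs \<subseteq> forms (1, 0) \<union> forms (0, 1) \<and> g = prod_list fs" if "g \<in> G" for g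
    using that box_splits unfolding G_def stair_form_box sep_def by (auto simp: row_rest col_rest)
  with H show ?thesis by blast
qed

lemma first_difference_Z:
  "first_difference Z i j = of_bool (cell i j) - int (card {l \<in> {..<h}. D l = (i, j)})"
  unfolding first_difference_removed X_def first_difference_cells D_def ..

text \<open>No degree of a separator is a cell, so the indicator of the diagram and the subtracted
  multiplicities never meet, and the sign determines which case holds.\<close>

lemma first_difference_Z_cases:
  assumes interior: "\<And>l. l < h \<Longrightarrow> lam (q l) \<le> p l"
  shows "first_difference Z i j = 1 \<longleftrightarrow> cell i j" "first_difference Z i j \<le> 0 \<longleftrightarrow> \<not> cell i j"
    "first_difference Z i j < 0 \<longleftrightarrow> (i, j) \<in> D ` {..<h}"
proof -
  have not_cell: "\<not> cell i j" if "l < h" "D l = (i, j)" for l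
    using interior[OF that(1)] that(2) by (auto simp: D_def cell_def)
  have none: "card {l \<in> {..<h}. D l = (i, j)} = 0 \<longleftrightarrow> (i, j) \<notin> D ` {..<h}"
    by (auto simp: image_iff) (metis lessThan_iff)
  have *: "cell i j \<Longrightarrow> card {l \<in> {..<h}. D l = (i, j)} = 0" using not_cell by auto
  define n where "n = card {l \<in> {..<h}. D l = (i, j)}"
  have fd: "first_difference Z i j = of_bool (cell i j) - int n"
    by (simp only: first_difference_Z n_def)
  have n: "cell i j \<Longrightarrow> n = 0" "n = 0 \<longleftrightarrow> (i, j) \<notin> D ` {..<h}"
    unfolding n_def by (fact *, fact none)
  show "first_difference Z i j = 1 \<longleftrightarrow> cell i j" using n(1) by (cases "cell i j") (simp_all add: fd)
  show "first_difference Z i j \<le> 0 \<longleftrightarrow> \<not> cell i j" using n(1) by (cases "cell i j") (simp_all add: fd)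
  have "first_difference Z i j < 0 \<longleftrightarrow> n \<noteq> 0" using n(1) by (cases "cell i j") (simp_all add: fd)
  then show "first_difference Z i j < 0 \<longleftrightarrow> (i, j) \<in> D ` {..<h}" using n(2) by blast
qed

lemma degrees_Z:
  assumes res: "minimal_free_resolution (ideal_of X) F0 F1 []"
    and interior: "\<And>l. l < h \<Longrightarrow> lam (q l) \<le> p l"
  shows "minimal_generator_degree Z (i, j) \<longleftrightarrow>
      difference_corner (first_difference Z) i j \<or> first_difference Z i j < 0"
    and "first_syzygy_degree Z (i, j) \<longleftrightarrow> difference_vertex (first_difference Z) i j
      \<or> first_difference Z i (j - 1) < 0 \<or> first_difference Z (i - 1) j < 0"
    and "second_syzygy_degree Z (i, j) \<longleftrightarrow> first_difference Z (i - 1) (j - 1) < 0"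
proof -
  note degs = stair_resolution_degrees[OF res[unfolded X_def ideal_of_cells]]
  note resZ = resolution_Z[OF res interior]
  have fd: "first_difference Z i j = 1 \<longleftrightarrow> cell i j" "first_difference Z i j \<le> 0 \<longleftrightarrow> \<not> cell i j"
    "first_difference Z i j < 0 \<longleftrightarrow> (i, j) \<in> D ` {..<h}" for i j
    by (rule first_difference_Z_cases; rule interior; assumption)+
  have "minimal_generator_degree Z (i, j) \<longleftrightarrow> (i, j) \<in> set (F0 @ map D [0..<h])"
    unfolding minimal_generator_degree_def
    using resZ minimal_resolution_degrees(1)[OF _ resZ] by blast
  also have "\<dots> \<longleftrightarrow> (i, j) \<in> set F0 \<or> (i, j) \<in> D ` {..<h}"
    by (simp add: atLeast0LessThan)
  also have "\<dots> \<longleftrightarrow> difference_corner (first_difference Z) i j \<or> first_difference Z i j < 0"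
    unfolding degs outer_corner_iff difference_corner_def by (simp only: fd)
  finally show "minimal_generator_degree Z (i, j) \<longleftrightarrow>
      difference_corner (first_difference Z) i j \<or> first_difference Z i j < 0" .
  have "first_syzygy_degree Z (i, j) \<longleftrightarrow> (i, j) \<in> set (F1 @ (map (\<lambda>l. D l + (0, 1)) [0..<h] @
      map (\<lambda>l. D l + (1, 0)) [0..<h]))"
    unfolding first_syzygy_degree_def
    using resZ minimal_resolution_degrees(2)[OF _ resZ] by blast
  also have "\<dots> \<longleftrightarrow> (i, j) \<in> set F1 \<or> (i, j - 1) \<in> D ` {..<h} \<or> (i - 1, j) \<in> D ` {..<h}"
  proof -
    have "(i, j) = D l + (0, 1) \<longleftrightarrow> (i, j - 1) = D l" "(i, j) = D l + (1, 0) \<longleftrightarrow> (i - 1, j) = D l" for l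
      by (auto simp: D_def)
    then show ?thesis by (simp add: atLeast0LessThan image_iff)
  qed
  also have "\<dots> \<longleftrightarrow> difference_vertex (first_difference Z) i j
      \<or> first_difference Z i (j - 1) < 0 \<or> first_difference Z (i - 1) j < 0"
  proof (cases "first_difference Z i (j - 1) < 0 \<or> first_difference Z (i - 1) j < 0")
    \<comment> \<open>With neither neighbour negative, being \<open>\<le> 0\<close> means being 0,
      so the equality required of a vertex is automatic.\<close>
    case False
    then have "difference_vertex (first_difference Z) i j \<longleftrightarrow>
        first_difference Z (i - 1) (j - 1) = 1 \<and> first_difference Z (i - 1) j \<le> 0 \<and> first_difference Z i (j - 1) \<le> 0"
      unfolding difference_vertex_def by linarith
    then show ?thesis unfolding degs inner_corner_iff fd by auto
  qed (simp add: fd)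
  finally show "first_syzygy_degree Z (i, j) \<longleftrightarrow> difference_vertex (first_difference Z) i j
      \<or> first_difference Z i (j - 1) < 0 \<or> first_difference Z (i - 1) j < 0" .
  have "second_syzygy_degree Z (i, j) \<longleftrightarrow> (i, j) \<in> set (map (\<lambda>l. D l + (1, 1)) [0..<h])"
    unfolding second_syzygy_degree_def
    using resZ minimal_resolution_degrees(3)[OF _ resZ] by blast
  also have "\<dots> \<longleftrightarrow> (i - 1, j - 1) \<in> D ` {..<h}"
  proof -
    have "(i, j) = D l + (1, 1) \<longleftrightarrow> (i - 1, j - 1) = D l" for l by (auto simp: D_def)
    then show ?thesis by (simp add: atLeast0LessThan image_iff)
  qed
  also have "\<dots> \<longleftrightarrow> first_difference Z (i - 1) (j - 1) < 0" by (simp add: fd)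
  finally show "second_syzygy_degree Z (i, j) \<longleftrightarrow> first_difference Z (i - 1) (j - 1) < 0" .
qed

end

section \<open>Lines of the quadric as fibres of the two projections\<close>

lemma cross_rep_abs_P1:
  assumes "z \<noteq> (0, 0)"
  shows "cross x z = 0 \<longleftrightarrow> cross x (rep_P1 (abs_P1 z)) = 0"
proof -
  have "proportional z z" using assms by (auto simp: proportional_def intro!: exI[of _ 1])
  then have "proportional (rep_P1 (abs_P1 z)) z" by (rule Quotient3_rep_abs[OF Quotient3_P1])
  then obtain c where c: "c \<noteq> 0" "z = (c * fst (rep_P1 (abs_P1 z)), c * snd (rep_P1 (abs_P1 z)))"
    unfolding proportional_def by blast
  have "cross x (c * fst y, c * snd y) = c * cross x y" for y
    by (simp add: cross_def algebra_simps)
  from this[of "rep_P1 (abs_P1 z)"] have "cross x z = c * cross x (rep_P1 (abs_P1 z))"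
    unfolding c(2)[symmetric] .
  with c(1) show ?thesis by simp
qed

lemma form_two_terms:
  assumes "f \<in> forms d" "\<And>e. bidegree e = d \<Longrightarrow> e = e1 \<or> e = e2" "e1 \<noteq> e2"
  shows "f = Poly_Mapping.single e1 (Poly_Mapping.lookup f e1) + Poly_Mapping.single e2 (Poly_Mapping.lookup f e2)"
proof (rule poly_mapping_eqI)
  fix e
  have "e = e1 \<or> e = e2 \<or> Poly_Mapping.lookup f e = 0"
  proof (cases "e \<in> Poly_Mapping.keys f")
    case True
    then have "bidegree e = d" using assms(1) by (simp add: forms_def)
    then show ?thesis using assms(2) by blast
  qed (simp add: in_keys_iff)
  then show "Poly_Mapping.lookup f e = Poly_Mapping.lookup (Poly_Mapping.single e1 (Poly_Mapping.lookup f e1) +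
      Poly_Mapping.single e2 (Poly_Mapping.lookup f e2)) e"
    using assms(3) by (auto simp: lookup_add lookup_single when_def)
qed

lemma linear_form_x: "f \<in> forms (1, 0) \<Longrightarrow> \<exists>z. f = alpha z"
proof -
  let ?c = "Poly_Mapping.lookup f (1, 0, 0, 0)" and ?d = "Poly_Mapping.lookup f (0, 1, 0, 0)"
  assume "f \<in> forms (1, 0)"
  then have "f = Poly_Mapping.single (1, 0, 0, 0) ?c + Poly_Mapping.single (0, 1, 0, 0) ?d"
  proof (rule form_two_terms)
    show "e = (1, 0, 0, 0) \<or> e = (0, 1, 0, 0)" if "bidegree e = (1, 0)" for e
      using that by (cases e) auto
  qed simp
  also have "\<dots> = alpha (- ?d, ?c)"
    by (simp add: alpha_def linx_def X0_def X1_def mult_single zero_prod_def)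
  finally show ?thesis by blast
qed

lemma linear_form_y: "f \<in> forms (0, 1) \<Longrightarrow> \<exists>z. f = beta z"
proof -
  let ?c = "Poly_Mapping.lookup f (0, 0, 1, 0)" and ?d = "Poly_Mapping.lookup f (0, 0, 0, 1)"
  assume "f \<in> forms (0, 1)"
  then have "f = Poly_Mapping.single (0, 0, 1, 0) ?c + Poly_Mapping.single (0, 0, 0, 1) ?d"
  proof (rule form_two_terms)
    show "e = (0, 0, 1, 0) \<or> e = (0, 0, 0, 1)" if "bidegree e = (0, 1)" for e
      using that by (cases e) auto
  qed simp
  also have "\<dots> = beta (- ?d, ?c)"
    by (simp add: beta_def liny_def Y0_def Y1_def mult_single zero_prod_def)
  finally show ?thesis by blast
qed

lemma line_of_type_x: "line_of_type (1, 0) L \<longleftrightarrow> (\<exists>w. L = {w} \<times> UNIV)"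
proof
  assume "line_of_type (1, 0) L"
  then obtain f where f: "f \<in> forms (1, 0)" "f \<noteq> 0" "L = zero_locus f" by (auto simp: line_of_type_def)
  obtain z where z: "f = alpha z" using linear_form_x[OF f(1)] by blast
  have "z \<noteq> (0, 0)" using f(2) by (auto simp: z alpha_def linx_def)
  then have "L = {abs_P1 z} \<times> UNIV"
    by (auto simp: f(3) zero_locus_def vanishes_at_def z eval_linear cross_rep_abs_P1 cross_rep_P1)
  then show "\<exists>w. L = {w} \<times> UNIV" by blast
next
  assume "\<exists>w. L = {w} \<times> UNIV"
  then obtain w where "L = {w} \<times> UNIV" by blast
  then have "L = zero_locus (alpha (rep_P1 w))"
    by (auto simp: zero_locus_def vanishes_at_def eval_linear cross_rep_P1)
  then show "line_of_type (1, 0) L"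
    unfolding line_of_type_def using forms_alpha alpha_nonzero[OF rep_P1_nonzero] by blast
qed

lemma line_of_type_y: "line_of_type (0, 1) L \<longleftrightarrow> (\<exists>w. L = UNIV \<times> {w})"
proof
  assume "line_of_type (0, 1) L"
  then obtain f where f: "f \<in> forms (0, 1)" "f \<noteq> 0" "L = zero_locus f" by (auto simp: line_of_type_def)
  obtain z where z: "f = beta z" using linear_form_y[OF f(1)] by blast
  have "z \<noteq> (0, 0)" using f(2) by (auto simp: z beta_def liny_def)
  then have "L = UNIV \<times> {abs_P1 z}"
    by (auto simp: f(3) zero_locus_def vanishes_at_def z eval_linear cross_rep_abs_P1 cross_rep_P1)
  then show "\<exists>w. L = UNIV \<times> {w}" by blast
next
  assume "\<exists>w. L = UNIV \<times> {w}"
  then obtain w where "L = UNIV \<times> {w}" by blast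
  then have "L = zero_locus (beta (rep_P1 w))"
    by (auto simp: zero_locus_def vanishes_at_def eval_linear cross_rep_P1)
  then show "line_of_type (0, 1) L"
    unfolding line_of_type_def using forms_beta beta_nonzero[OF rep_P1_nonzero] by blast
qed

section \<open>From the lines through the scheme to its Ferrers diagram\<close>

theorem theorem3p6:
  fixes X Z :: "'k::alg_closed_field quadric"
    and R C :: "nat \<Rightarrow> 'k quadric"
    and P :: "nat \<Rightarrow> nat \<Rightarrow> 'k P1 \<times> 'k P1"
    and a b m h :: nat
    and d1 d2 :: "nat \<Rightarrow> int \<times> int"
    and ii jj p q :: "nat \<Rightarrow> nat"
    and r :: "int \<Rightarrow> int \<Rightarrow> nat"
  assumes "finite X" and "X \<noteq> {}" and "ACM X"
    and "lines_of X (1, 0) a R" and "lines_of X (0, 1) b C"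
    and "\<And>i j. i \<le> a \<Longrightarrow> j \<le> b \<Longrightarrow> R i \<inter> C j = {P i j}"
    and "ferrers_shape a b P X"
    and "minimal_free_resolution (ideal_of X) (map d1 [1..<m+1]) (map d2 [1..<m]) []"
    and "\<And>l. l \<in> {1..h} \<Longrightarrow> interior_point a b P X (ii l) (jj l)"
    and "inj_on ii {1..h}" and "inj_on jj {1..h}"
    and "Z = X - {P (ii l) (jj l) |l. l \<in> {1..h}}"
    and "\<And>l. l \<in> {1..h} \<Longrightarrow> q l + 1 = card (X \<inter> C (jj l))"
    and "\<And>l. l \<in> {1..h} \<Longrightarrow> p l + 1 = card (X \<inter> R (ii l))"
    and "\<And>i j. r i j = card {l \<in> {1..h}. (int (q l), int (p l)) = (i, j)}"
  shows
    "minimal_free_resolution (ideal_of Z)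
       (map d1 [1..<m+1] @ map (\<lambda>l. (int (q l), int (p l))) [1..<h+1])
       (map d2 [1..<m] @ map (\<lambda>l. (int (q l), int (p l) + 1)) [1..<h+1]
         @ map (\<lambda>l. (int (q l) + 1, int (p l))) [1..<h+1])
       (map (\<lambda>l. (int (q l) + 1, int (p l) + 1)) [1..<h+1])
     \<and> (\<exists>G. minimal_generating_set G (ideal_of Z) \<and>
          (\<forall>g \<in> G. \<exists>fs. set fs \<subseteq> forms (1, 0) \<union> forms (0, 1) \<and> g = prod_list fs))
     \<and> (\<forall>i j. first_difference Z i j = first_difference X i j - int (r i j))
     \<and> (\<forall>i j. minimal_generator_degree Z (i, j) \<longleftrightarrow>
          difference_corner (first_difference Z) i j \<or> first_difference Z i j < 0)
     \<and> (\<forall>i j. first_syzygy_degree Z (i, j) \<longleftrightarrow>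
          difference_vertex (first_difference Z) i j
          \<or> first_difference Z i (j - 1) < 0 \<or> first_difference Z (i - 1) j < 0)
     \<and> (\<forall>i j. second_syzygy_degree Z (i, j) \<longleftrightarrow> first_difference Z (i - 1) (j - 1) < 0)"
proof -
  note lines_X = \<open>lines_of X (1, 0) a R\<close> and lines_Y = \<open>lines_of X (0, 1) b C\<close>
    and P = \<open>\<And>i j. i \<le> a \<Longrightarrow> j \<le> b \<Longrightarrow> R i \<inter> C j = {P i j}\<close> and shape = \<open>ferrers_shape a b P X\<close>
    and res = \<open>minimal_free_resolution (ideal_of X) (map d1 [1..<m+1]) (map d2 [1..<m]) []\<close>
    and interior = \<open>\<And>l. l \<in> {1..h} \<Longrightarrow> interior_point a b P X (ii l) (jj l)\<close>
    and q = \<open>\<And>l. l \<in> {1..h} \<Longrightarrow> q l + 1 = card (X \<inter> C (jj l))\<close>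
    and p = \<open>\<And>l. l \<in> {1..h} \<Longrightarrow> p l + 1 = card (X \<inter> R (ii l))\<close>
    and r = \<open>\<And>i j. r i j = card {l \<in> {1..h}. (int (q l), int (p l)) = (i, j)}\<close>
  note bij_R = lines_X[unfolded lines_of_def] and bij_C = lines_Y[unfolded lines_of_def]
  have "\<exists>w. R i = {w} \<times> UNIV" if "i \<le> a" for i
    using bij_betwE[OF bij_R, rule_format, of i] that by (simp add: line_of_type_x)
  then obtain u where u: "\<And>i. i \<le> a \<Longrightarrow> R i = {u i} \<times> UNIV" by metis
  have "\<exists>w. C j = UNIV \<times> {w}" if "j \<le> b" for j
    using bij_betwE[OF bij_C, rule_format, of j] that by (simp add: line_of_type_y)
  then obtain v where v: "\<And>j. j \<le> b \<Longrightarrow> C j = UNIV \<times> {v j}" by metis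
  have P_eq: "P i j = (u i, v j)" if "i \<le> a" "j \<le> b" for i j
  proof -
    have "(u i, v j) \<in> R i \<inter> C j" by (simp add: u v that)
    then show ?thesis using P[OF that] by simp
  qed
  have row_inj: "i = i'" if "i \<le> a" "i' \<le> a" "u i = u i'" for i i'
    using inj_onD[OF bij_betw_imp_inj_on[OF bij_R], of i i'] that by (simp add: u)
  have col_inj: "j = j'" if "j \<le> b" "j' \<le> b" "v j = v j'" for j j'
    using inj_onD[OF bij_betw_imp_inj_on[OF bij_C], of j j'] that by (simp add: v)
  have X_grid: "\<exists>i\<le>a. \<exists>j\<le>b. x = (u i, v j)" if x: "x \<in> X" for x
  proof -
    obtain x1 x2 where x12: "x = (x1, x2)" by (cases x)
    have "{x1} \<times> UNIV \<in> {M. line_of_type (1, 0) M \<and> M \<inter> X \<noteq> {}}"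
      using x by (auto simp: line_of_type_x x12)
    then obtain i where i: "i \<le> a" "R i = {x1} \<times> UNIV"
      unfolding bij_betw_imp_surj_on[OF bij_R, symmetric] by auto
    have "UNIV \<times> {x2} \<in> {M. line_of_type (0, 1) M \<and> M \<inter> X \<noteq> {}}"
      using x by (auto simp: line_of_type_y x12)
    then obtain j where j: "j \<le> b" "C j = UNIV \<times> {x2}"
      unfolding bij_betw_imp_surj_on[OF bij_C, symmetric] by auto
    have "x1 = u i" using i(2) u[OF i(1)] by auto
    moreover have "x2 = v j" using j(2) v[OF j(1)] by auto
    ultimately show ?thesis using i(1) j(1) x12 by blast
  qed
  \<comment> \<open>Row lengths of the diagram; the value 0 beyond \<open>a\<close> supplies the
    last stair form.\<close>
  define lam where "lam i = (if i \<le> a then card {j. j \<le> b \<and> (u i, v j) \<in> X} else 0)" for i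
  have down: "(u i', v j') \<in> X" if "(u i, v j) \<in> X" "i \<le> a" "j \<le> b" "i' \<le> i" "j' \<le> j" for i j i' j'
    using shape that P_eq unfolding ferrers_shape_def by (metis order_trans)
  have lt_lam_iff: "j < lam i \<longleftrightarrow> i \<le> a \<and> j \<le> b \<and> (u i, v j) \<in> X" for i j
  proof (cases "i \<le> a")
    case True
    let ?S = "{j. j \<le> b \<and> (u i, v j) \<in> X}"
    have closed: "j' \<in> ?S" if "j \<in> ?S" "j' \<le> j" for j j' using that down[of i j i j'] True by auto
    have fin: "finite ?S" by simp
    \<comment> \<open>By the Ferrers shape \<open>?S\<close> is downward closed, hence an initial
      segment of the naturals, so membership is comparison with its cardinality.\<close>
    have "j \<in> ?S \<longleftrightarrow> j < card ?S"
    proof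
      assume "j \<in> ?S"
      then have "{..j} \<subseteq> ?S" using closed by blast
      from card_mono[OF fin this] show "j < card ?S" by simp
    next
      assume lt: "j < card ?S"
      show "j \<in> ?S"
      proof (rule ccontr)
        assume j: "j \<notin> ?S"
        have "?S \<subseteq> {..<j}"
        proof
          fix j' assume j': "j' \<in> ?S"
          have "\<not> j \<le> j'" using closed[OF j', of j] j by blast
          then show "j' \<in> {..<j}" by simp
        qed
        from card_mono[OF _ this] lt show False by simp
      qed
    qed
    then show ?thesis using True by (simp add: lam_def)
  qed (simp add: lam_def)
  have antimono: "lam i' \<le> lam i" if "i \<le> i'" for i i'
  proof (rule ccontr)
    assume "\<not> lam i' \<le> lam i"
    then have "lam i < lam i'" by simp
    then have *: "i' \<le> a" "lam i \<le> b" "(u i', v (lam i)) \<in> X"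
      by (simp_all only: lt_lam_iff[of "lam i" i'])
    have "(u i, v (lam i)) \<in> X" by (rule down[OF *(3,1,2) that]) simp
    then show False using lt_lam_iff[of "lam i" i] * that by simp
  qed
  interpret grid a u v lam
  proof
    show "j = j'" if "j < lam 0" "j' < lam 0" "v j = v j'" for j j'
      using that by (intro col_inj) (simp_all add: lt_lam_iff)
    show "lam i = 0" if "a < i" for i using that by (simp add: lam_def)
  qed (fact row_inj antimono)+
  have X_eq: "X = points cells"
    using X_grid by (force simp: points_def cells_def pt_def lt_lam_iff)
  have cell_int: "jj l < lam (ii l)" "lam (q l) \<le> p l" "Suc (q l) = card {i. jj l < lam i}"
    "Suc (p l) = lam (ii l)" if l: "l \<in> {1..h}" for l
  proof -
    obtain s t where st: "ii l \<le> a" "jj l \<le> b" "P (ii l) (jj l) \<in> X" "ii l < s" "jj l < t"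
      "1 \<le> s" "s \<le> a" "1 \<le> t" "t \<le> b" "P (s - 1) t \<in> X" "P s (t - 1) \<in> X" "P s t \<notin> X"
      using interior[OF l] unfolding interior_point_def scheme_corner_def by blast
    show "jj l < lam (ii l)" using st P_eq by (simp add: lt_lam_iff)
    have "X \<inter> C (jj l) = (\<lambda>i. (u i, v (jj l))) ` {i. jj l < lam i}"
      unfolding v[OF st(2)] using X_grid by (fastforce simp: lt_lam_iff st)
    moreover have "inj_on (\<lambda>i. (u i, v (jj l))) {i. jj l < lam i}"
      using row_inj by (auto simp: inj_on_def lt_lam_iff)
    ultimately show q_eq: "Suc (q l) = card {i. jj l < lam i}"
      using q[OF l] by (simp add: card_image)
    have "X \<inter> R (ii l) = (\<lambda>j. (u (ii l), v j)) ` {..<lam (ii l)}"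
      unfolding u[OF st(1)] using X_grid by (fastforce simp: lt_lam_iff st)
    moreover have "inj_on (\<lambda>j. (u (ii l), v j)) {..<lam (ii l)}"
      using col_inj by (auto simp: inj_on_def lt_lam_iff)
    ultimately show p_eq: "Suc (p l) = lam (ii l)"
      using p[OF l] by (simp add: card_image)
    \<comment> \<open>The corner \<open>(s, t)\<close> lies beyond the point. Rows
      \<open>0..s\<close> all meet its column, which gives \<open>s \<le> q\<close>, and columns
      \<open>0..t\<close> all meet its row, which gives \<open>t \<le> p\<close>. Since the corner
      is not in the diagram, \<open>lam q \<le> lam s \<le> t \<le> p\<close>.\<close>
    have "t < lam (s - 1)" "t - 1 < lam s" "\<not> t < lam s"
      using st P_eq[of "s - 1" t] P_eq[of s "t - 1"] P_eq[of s t] by (auto simp: lt_lam_iff)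
    have "{..s} \<subseteq> {i. jj l < lam i}"
      using \<open>t - 1 < lam s\<close> st antimono by fastforce
    moreover have "finite {i. jj l < lam i}" by (rule finite_subset[of _ "{..a}"]) (auto simp: lt_lam_iff)
    ultimately have "s \<le> q l" using card_mono[of "{i. jj l < lam i}" "{..s}"] q_eq by simp
    moreover have "lam (s - 1) \<le> lam (ii l)" using st by (intro antimono) simp
    then have "t \<le> p l" using \<open>t < lam (s - 1)\<close> p_eq by simp
    ultimately show "lam (q l) \<le> p l" using antimono[of s "q l"] \<open>\<not> t < lam s\<close> by linarith
  qed
  have Suc_mem: "Suc l \<in> {1..h}" if "l < h" for l using that by simp
  \<comment> \<open>The removed points are numbered from 1 in the theorem and from 0 in the locale,
    hence the shift by \<open>Suc\<close>.\<close>
  interpret rp: removed_points a u v lam h "\<lambda>l. ii (Suc l)" "\<lambda>l. jj (Suc l)" "\<lambda>l. p (Suc l)" "\<lambda>l. q (Suc l)"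
  proof
    fix l assume "l < h"
    note cell_int[OF Suc_mem[OF this]]
    then show "jj (Suc l) < lam (ii (Suc l))" "Suc (q (Suc l)) = card {i. jj (Suc l) < lam i}"
      "Suc (p (Suc l)) = lam (ii (Suc l))" by blast+
  next
    show "inj_on (\<lambda>l. ii (Suc l)) {..<h}"
      by (rule inj_onI) (use inj_onD[OF \<open>inj_on ii {1..h}\<close>] Suc_mem in fastforce)
    show "inj_on (\<lambda>l. jj (Suc l)) {..<h}"
      by (rule inj_onI) (use inj_onD[OF \<open>inj_on jj {1..h}\<close>] Suc_mem in fastforce)
  qed
  have X: "rp.X = X" by (simp add: rp.X_def X_eq)
  have range: "{1..h} = Suc ` {..<h}"
    by (simp add: image_Suc_lessThan)
  have "{P (ii l) (jj l) |l. l \<in> {1..h}} = rp.removed_pt ` {..<h}"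
  proof -
    have "P (ii (Suc l)) (jj (Suc l)) = rp.removed_pt l" if "l < h" for l
      using interior[OF Suc_mem[OF that]] P_eq
      by (simp add: rp.removed_pt_def pt_def interior_point_def)
    then have "rp.removed_pt ` {..<h} = (\<lambda>l. P (ii (Suc l)) (jj (Suc l))) ` {..<h}"
      by (intro image_cong) simp_all
    then show ?thesis unfolding range by blast
  qed
  then have Z: "rp.Z = Z" using \<open>Z = _\<close> by (simp add: rp.Z_def X)
  have lists: "map f [1..<h+1] = map (\<lambda>l. f (Suc l)) [0..<h]" for f :: "nat \<Rightarrow> bideg"
    by (simp add: map_Suc_upt[symmetric] comp_def del: upt_Suc)
  have r_eq: "r i j = card {l \<in> {..<h}. rp.D l = (i, j)}" for i j
  proof -
    have "{l \<in> {1..h}. (int (q l), int (p l)) = (i, j)} = Suc ` {l \<in> {..<h}. rp.D l = (i, j)}"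
      unfolding range rp.D_def by auto
    then show ?thesis by (simp add: r card_image)
  qed
  note resX = res[folded X]
  have int: "lam (q (Suc l)) \<le> p (Suc l)" if "l < h" for l using cell_int(2)[OF Suc_mem[OF that]] .
  have min_res: "minimal_free_resolution (ideal_of Z)
       (map d1 [1..<m+1] @ map (\<lambda>l. (int (q l), int (p l))) [1..<h+1])
       (map d2 [1..<m] @ map (\<lambda>l. (int (q l), int (p l) + 1)) [1..<h+1]
         @ map (\<lambda>l. (int (q l) + 1, int (p l))) [1..<h+1])
       (map (\<lambda>l. (int (q l) + 1, int (p l) + 1)) [1..<h+1])"
    using rp.resolution_Z[OF resX int] unfolding lists[of "\<lambda>l. (int (q l), int (p l))"]
      lists[of "\<lambda>l. (int (q l), int (p l) + 1)"] lists[of "\<lambda>l. (int (q l) + 1, int (p l))"]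
      lists[of "\<lambda>l. (int (q l) + 1, int (p l) + 1)"] Z rp.D_def by simp
  have difference: "first_difference Z i j = first_difference X i j - int (r i j)" for i j
    using rp.first_difference_removed[of i j] unfolding X Z r_eq rp.D_def .
  note degrees = rp.degrees_Z[OF resX int, unfolded Z]
  show ?thesis
    by (intro conjI allI min_res rp.split_generators[unfolded Z] difference degrees)
qed

end
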